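(* Let $n\ge2$, $d=2n-1$, $Q=2n$, and let $\epsilon>0$. Let $N\in\mathbb N$, $M\in\mathbb Z$, let $F:\mathbb R\to\mathbb C$ be a bounded Borel function supported in $[0,N]$, and let $\Theta:\mathbb R\to\mathbb C$ be a bump function supported in $[N^2/2,2N^2]$ with $\sum_{k\in\mathbb Z}\Theta(2^k\tau)=1$ for all $\tau>0$. Then for all $f\in L^1(\mathbb S)$ $$\|F_M(\sqrt{\mathcal L},|T|)f\|_{L^2(\mathbb S)}\le C\Big(N^{d/2+\epsilon}\,2^{-M\epsilon/2}+N^{Q/2}\,2^{-M/2}\Big)\|F(N\,\cdot)\|_{N,2}\,\|f\|_{L^1(\mathbb S)},$$ where the constant $C$ depends only on $n$, $\epsilon$ and $\|\Theta\|_{L^\infty}$ (in particular not on $N,M,F,f$).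
   Context: $\mathbb S=\{z\in\mathbb C^n:|z|=1\}$, $n\ge 2$, with its uniform (surface) measure $\sigma$. For $\ell,\ell'\in\mathbb N_0$, $\mathcal H_{\ell,\ell'}$ is the (finite-dimensional) space of restrictions to $\mathbb S$ of harmonic polynomials on $\mathbb C^n$ homogeneous of bidegree $(\ell,\ell')$, i.e. $f(\lambda z)=\lambda^{\ell}\bar\lambda^{\ell'}f(z)$; $L^2(\mathbb S)=\bigoplus\mathcal H_{\ell,\ell'}$ orthogonally. $\pi_{\ell,\ell'}$ is the orthogonal projection onto $\mathcal H_{\ell,\ell'}$, extended to $L^1(\mathbb S)$ by its smooth integral kernel. $\mathcal L$ (the sub-Laplacian) and $|T|$ act on $\mathcal H_{\ell,\ell'}$ as multiplication by $\lambda_{\ell,\ell'}=4\ell\ell'+2(n-1)(\ell+\ell')$ and $|\ell-\ell'|$ respectively. The truncated operator is the (finite) sum $$F_M(\sqrt{\mathcal L},|T|)f=\sum_{\substack{\ell,\ell'\ge0\\ \ell\ne\ell'}}F(\sqrt{\lambda_{\ell,\ell'}})\,\Theta(2^M|\ell-\ell'|)\,\pi_{\ell,\ell'}f .$$ For $G:\mathbb R\to\mathbb C$ supported in $[0,1]$ and $N\in\mathbb N$, $\|G\|_{N,2}=\Big(\frac1N\sum_{i=1}^N\sup_{\lambda\in[\frac{i-1}N,\frac iN]}|G(\lambda)|^2\Big)^{1/2}$. *)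

theory Defs
  imports "HOL-Analysis.Analysis" "HOL-Probability.Essential_Supremum"
begin

(* Surface measure through polar coordinates: the measure of A is DIM('a) times the Lebesgue
   measure of the cone {r a | 0 < r < 1, a in A}; "sgn z" is z / norm z.  It is not normalised. *)
definition sphere_measure :: "'a::euclidean_space measure" where
  "sphere_measure =
     scale_measure (of_nat DIM('a))
       (distr (restrict_space lborel (ball 0 1 - {0})) (restrict_space borel (sphere 0 1)) sgn)"

definition square_integrable :: "'a measure \<Rightarrow> ('a \<Rightarrow> complex) \<Rightarrow> bool" where
  "square_integrable M f \<longleftrightarrow> f \<in> borel_measurable M \<and> integrable M (\<lambda>x. (norm (f x))\<^sup>2)"

definition L1_norm :: "'a measure \<Rightarrow> ('a \<Rightarrow> complex) \<Rightarrow> real" where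
  "L1_norm M f = (LINT x|M. norm (f x))"

definition L2_norm :: "'a measure \<Rightarrow> ('a \<Rightarrow> complex) \<Rightarrow> real" where
  "L2_norm M f = sqrt (LINT x|M. (norm (f x))\<^sup>2)"

definition Linf_norm :: "(real \<Rightarrow> complex) \<Rightarrow> real" where
  "Linf_norm g = real_of_ereal (esssup lborel (\<lambda>x. ereal (norm (g x))))"

definition laplacian :: "('a::euclidean_space \<Rightarrow> complex) \<Rightarrow> 'a \<Rightarrow> complex" where
  "laplacian p x =
     (\<Sum>b\<in>Basis. frechet_derivative (\<lambda>y. frechet_derivative p (at y) b) (at x) b)"

(* "polynomial_function" refers to the real vector space underlying C^n, that is, to polynomials
   in the coordinates of z and their conjugates. *)
definition bihomogeneous_harmonic_polynomial ::
    "nat \<Rightarrow> nat \<Rightarrow> (complex^'n \<Rightarrow> complex) \<Rightarrow> bool" where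
  "bihomogeneous_harmonic_polynomial l l' p \<longleftrightarrow>
     polynomial_function p \<and> (\<forall>z. laplacian p z = 0) \<and>
     (\<forall>c z. p (c *s z) = c ^ l * cnj c ^ l' * p z)"

(* Functions on the sphere are represented by functions on C^n.  Where uniqueness matters (here
   and in the kernel below) the representative vanishes off the sphere. *)
definition harmonic_space :: "nat \<Rightarrow> nat \<Rightarrow> (complex^'n \<Rightarrow> complex) set" where
  "harmonic_space l l' =
     {\<lambda>z. if z \<in> sphere 0 1 then p z else 0 | p. bihomogeneous_harmonic_polynomial l l' p}"

(* orthogonal projection of L^2 onto the finite-dimensional space "harmonic_space l l'" *)
definition harmonic_proj_L2 ::
    "nat \<Rightarrow> nat \<Rightarrow> (complex^'n \<Rightarrow> complex) \<Rightarrow> (complex^'n \<Rightarrow> complex)" where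
  "harmonic_proj_L2 l l' f =
     (THE g. g \<in> harmonic_space l l' \<and>
        (\<forall>h\<in>harmonic_space l l'. (LINT z|sphere_measure. (f z - g z) * cnj (h z)) = 0))"

(* Continuity already determines the kernel uniquely; the kernel is then the restriction of a
   polynomial, hence smooth. *)
definition harmonic_kernel :: "nat \<Rightarrow> nat \<Rightarrow> complex^'n \<Rightarrow> complex^'n \<Rightarrow> complex" where
  "harmonic_kernel l l' =
     (THE K. continuous_on (sphere 0 1 \<times> sphere 0 1) (\<lambda>(z, w). K z w) \<and>
        (\<forall>z w. z \<notin> sphere 0 1 \<or> w \<notin> sphere 0 1 \<longrightarrow> K z w = 0) \<and>
        (\<forall>f. square_integrable sphere_measure f \<longrightarrow>
           (\<forall>z\<in>sphere 0 1. harmonic_proj_L2 l l' f z = (LINT w|sphere_measure. K z w * f w))))"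

definition harmonic_proj ::
    "nat \<Rightarrow> nat \<Rightarrow> (complex^'n \<Rightarrow> complex) \<Rightarrow> (complex^'n \<Rightarrow> complex)" where
  "harmonic_proj l l' f z = (LINT w|sphere_measure. harmonic_kernel l l' z w * f w)"

definition sublaplacian_eigenvalue :: "nat \<Rightarrow> nat \<Rightarrow> nat \<Rightarrow> real" where
  "sublaplacian_eigenvalue n l l' =
     4 * real l * real l' + 2 * (real n - 1) * (real l + real l')"

(* Only finitely many terms are nonzero when F has bounded support and CARD('n) > 1, because the
   eigenvalue is at least 2 (n - 1) (l + l'). *)
definition truncated_operator ::
    "int \<Rightarrow> (real \<Rightarrow> complex) \<Rightarrow> (real \<Rightarrow> complex) \<Rightarrow>
     (complex^'n \<Rightarrow> complex) \<Rightarrow> (complex^'n \<Rightarrow> complex)" where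
  "truncated_operator M \<Theta> F f z =
     (\<Sum>\<^sub>\<infinity>(l, l')\<in>{(l, l'). l \<noteq> l'}.
        F (sqrt (sublaplacian_eigenvalue CARD('n) l l')) *
        \<Theta> (2 powi M * \<bar>real l - real l'\<bar>) * harmonic_proj l l' f z)"

definition block_norm :: "nat \<Rightarrow> (real \<Rightarrow> complex) \<Rightarrow> real" where
  "block_norm N G =
     sqrt (1 / real N *
       (\<Sum>i = 1..N. SUP x\<in>{(real i - 1) / real N..real i / real N}. (norm (G x))\<^sup>2))"

definition bump_function_on :: "real set \<Rightarrow> (real \<Rightarrow> complex) \<Rightarrow> bool" where
  "bump_function_on S g \<longleftrightarrow>
     (\<forall>k x. ((\<lambda>h t. vector_derivative h (at t)) ^^ k) g differentiable (at x)) \<and>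
     (\<forall>x. x \<notin> S \<longrightarrow> g x = 0)"

end

theory Submission
  imports Defs "HOL-Computational_Algebra.Polynomial"
begin

text \<open>
  Write \<open>c(l,l') = F(sqrt \<lambda>) \<Theta>(2^M |l - l'|)\<close>, so that the operator is the finite sum of the
  \<open>c(l,l') \<pi>\<close>, with \<open>\<pi>\<close> the projection of bidegree \<open>(l,l')\<close>.  Spaces of different bidegree are
  orthogonal (\<open>bihomogeneous_orthogonal\<close>), so the square of the \<open>L\<^sup>2\<close> norm of the image of \<open>f\<close> is
  \<open>\<Sum> |c(l,l')|^2 \<parallel>\<pi> f\<parallel>^2\<close>.

  One projection is controlled by a dimension.  Its kernel \<open>K(z,w) = \<Sum> e_i(z) cnj (e_i(w))\<close> is
  reproducing, and the unitary group acts transitively on the sphere and preserves the space; hence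
  \<open>K(z,z)\<close> is constant and equal to the dimension divided by the total mass.  By Cauchy-Schwarz that
  constant also bounds \<open>|K(z,w)|\<close>, and \<open>\<parallel>\<pi> f\<parallel>^2 = <f, \<pi> f> \<le> \<parallel>f\<parallel>_1 sup |\<pi> f|\<close> turns it into a bound of
  \<open>\<parallel>\<pi> f\<parallel>^2\<close> by a multiple of \<open>\<parallel>f\<parallel>_1^2\<close> (\<open>harmonic_proj_L1_L2\<close>).  The dimension is at most
  \<open>(l+l'+2) ((l+1)(l'+1))^(n-2)\<close> (\<open>harmonic_dimension_bound\<close>, \<open>reduced_indices_card\<close>).

  Orthogonality and the dimension bound have one common source: a homogeneous harmonic polynomial is
  orthogonal on the sphere to every homogeneous polynomial of lower degree
  (\<open>harmonic_orthogonal_lower_degree\<close>).  This follows from Green's identity on the sphere, which in turn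
  only expresses that the derivative of a polynomial along a rotation has integral zero.  For the
  dimension, if a harmonic \<open>p\<close> is a multiple \<open>|z_k|^2 q\<close>, then \<open>\<integral> |z_k|^2 |q|^2 = <p, q> = 0\<close>, so \<open>p = 0\<close>;
  therefore the space embeds into the span of the monomials not divisible by \<open>|z_k|^2\<close>.

  What remains is to count lattice points.  Put \<open>a = 2^(-M) N^2\<close>; the cutoff \<open>\<Theta>\<close> forces
  \<open>a/2 \<le> |l - l'| \<le> 2a\<close>.  Since \<open>(2l+n-1)(2l'+n-1) = \<lambda> + (n-1)^2\<close>, the bidegrees with
  \<open>i-1 \<le> sqrt \<lambda> \<le> i\<close> lie close to a hyperbola, and the sum of the dimension bounds over them is
  \<open>O(i^(2n-4) (i^2 + a i))\<close> (\<open>eigenvalue_shell_weight\<close>).  On each such shell \<open>|F|^2\<close> is at most its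
  supremum over \<open>[i-1,i]\<close>; summation over \<open>i \<le> N\<close> gives the square of the block norm times
  \<open>N^(2n-1) + N^(2n-2) a\<close>.  The second term is the square of \<open>N^(Q/2) 2^(-M/2)\<close>.  A nonempty shell
  contains a pair with \<open>1 \<le> |l - l'| \<le> 2a\<close>, so \<open>1 \<le> (2a)^\<epsilon>\<close>, and the first term is at most \<open>2^\<epsilon>\<close> times
  the square of \<open>N^(d/2+\<epsilon>) 2^(-M\<epsilon>/2)\<close>.
\<close>

section \<open>Rotation invariance of the surface measure\<close>

lemma open_null_lborel_empty:
  fixes S :: "'a::euclidean_space set"
  assumes "open S" "emeasure lborel S = 0"
  shows "S = {}"
proof -
  have "S \<in> null_sets (completion lborel)"
    using assms by (intro null_sets_completionI) (auto simp: null_sets_def)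
  then show ?thesis
    using open_not_negligible[OF assms(1)] by (auto simp: negligible_iff_null_sets)
qed

lemma lborel_translation_integral:
  fixes f :: "'a::euclidean_space \<Rightarrow> ennreal"
  assumes [measurable]: "f \<in> borel_measurable borel"
  shows "(\<integral>\<^sup>+x. f (x + y) \<partial>lborel) = (\<integral>\<^sup>+x. f x \<partial>lborel)"
proof -
  have "(\<integral>\<^sup>+x. f x \<partial>lborel) = (\<integral>\<^sup>+x. f x \<partial>distr lborel borel ((+) y))"
    by (simp add: lborel_distr_plus)
  also have "\<dots> = (\<integral>\<^sup>+x. f (y + x) \<partial>lborel)"
    by (rule nn_integral_distr) auto
  finally show ?thesis
    by (simp add: add.commute)
qed

text \<open>
  Haar measure is unique; for an isometry this can be seen directly.  The image measure \<open>\<nu>\<close> is again invariant under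
  translations because \<open>U\<close> is linear and onto, and it agrees with Lebesgue measure on the unit ball
  because \<open>U\<close> preserves the norm.  Evaluating the double integral of \<open>1_A(x) 1_B(y - x)\<close> in both orders
  gives \<open>\<nu>(A) \<lambda>(B) = \<lambda>(A) \<nu>(B)\<close> for every Borel set \<open>A\<close>.
\<close>

lemma lborel_distr_orthogonal_transformation:
  fixes U :: "'a::euclidean_space \<Rightarrow> 'a"
  assumes U: "orthogonal_transformation U"
  shows "distr lborel borel U = lborel"
proof -
  have linU: "linear U"
    using U by (rule orthogonal_transformation_linear)
  have [measurable]: "U \<in> borel \<rightarrow>\<^sub>M borel"
    using linU by (simp add: borel_measurable_continuous_onI linear_continuous_on linear_conv_bounded_linear)
  define \<nu> where "\<nu> = distr lborel (borel::'a measure) U"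
  define B :: "'a set" where "B = ball 0 1"
  have [measurable]: "B \<in> sets borel" by (simp add: B_def)
  have sets_\<nu> [measurable_cong, simp]: "sets \<nu> = sets borel" and space_\<nu> [simp]: "space \<nu> = UNIV"
    by (auto simp: \<nu>_def)
  have \<nu>_nn: "(\<integral>\<^sup>+x. g x \<partial>\<nu>) = (\<integral>\<^sup>+x. g (U x) \<partial>lborel)" if [measurable]: "g \<in> borel_measurable borel" for g
    unfolding \<nu>_def by (rule nn_integral_distr) auto
  have \<nu>_shift: "(\<integral>\<^sup>+x. g (x + y) \<partial>\<nu>) = (\<integral>\<^sup>+x. g x \<partial>\<nu>)"
    if [measurable]: "g \<in> borel_measurable borel" for g y
  proof -
    obtain x0 where x0: "y = U x0"
      using orthogonal_transformation_surj[OF U] by (metis surjD)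
    show ?thesis
      by (simp add: \<nu>_nn x0 flip: linear_add[OF linU])
        (rule lborel_translation_integral[where f = "\<lambda>x. g (U x)"], measurable)
  qed
  have UB: "U x \<in> B \<longleftrightarrow> x \<in> B" for x
    using orthogonal_transformation_norm[OF U] by (simp add: B_def)
  have \<nu>B: "emeasure \<nu> B = emeasure lborel B"
    unfolding \<nu>_def by (subst emeasure_distr) (auto simp: UB vimage_def)
  \<comment> \<open>Balls centred at the origin have finite \<open>\<nu>\<close>-measure, since \<open>U\<close> preserves the norm.\<close>
  have sf: "sigma_finite_measure \<nu>"
  proof
    let ?A = "range (\<lambda>n::nat. ball (0::'a) (real n))"
    have "U -` ball 0 r = ball 0 r" for r
      using orthogonal_transformation_norm[OF U] by auto
    then have "emeasure \<nu> (ball 0 r) = emeasure lborel (ball (0::'a) r)" for r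
      unfolding \<nu>_def by (subst emeasure_distr) auto
    moreover have "emeasure lborel (ball (0::'a) r) \<noteq> top" for r
      using emeasure_lborel_ball_finite[of "0::'a" r] by simp
    moreover have "\<Union> ?A = UNIV"
      by (auto simp: reals_Archimedean2)
    ultimately show "\<exists>A. countable A \<and> A \<subseteq> sets \<nu> \<and> \<Union> A = space \<nu> \<and> (\<forall>a\<in>A. emeasure \<nu> a \<noteq> \<infinity>)"
      by (intro exI[of _ ?A]) auto
  qed
  interpret \<nu>: sigma_finite_measure \<nu> by fact
  interpret pair_sigma_finite \<nu> "lborel :: 'a measure" ..
  have "emeasure \<nu> A = emeasure lborel A" if A [measurable]: "A \<in> sets borel" for A
  proof -
    have "emeasure \<nu> A * emeasure lborel B = (\<integral>\<^sup>+x. indicator A x * emeasure lborel B \<partial>\<nu>)"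
      by (simp add: nn_integral_multc)
    also have "\<dots> = (\<integral>\<^sup>+x. \<integral>\<^sup>+y. indicator A x * indicator B y \<partial>lborel \<partial>\<nu>)"
      by (simp add: nn_integral_cmult)
    also have "\<dots> = (\<integral>\<^sup>+x. \<integral>\<^sup>+y. indicator A x * indicator B (y + (- x)) \<partial>lborel \<partial>\<nu>)"
      by (subst lborel_translation_integral) auto
    also have "\<dots> = (\<integral>\<^sup>+y. \<integral>\<^sup>+x. indicator A x * indicator B (y + (- x)) \<partial>\<nu> \<partial>lborel)"
      by (rule Fubini'[symmetric]) measurable
    also have "\<dots> = (\<integral>\<^sup>+y. \<integral>\<^sup>+x. indicator A (x + y) * indicator B x \<partial>\<nu> \<partial>lborel)"
    proof (rule nn_integral_cong)
      fix y :: 'a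
      have "(\<integral>\<^sup>+x. indicator A x * indicator B (y + (- x)) \<partial>\<nu>)
          = (\<integral>\<^sup>+x. indicator A (x + y) * indicator B (y + (- (x + y))) \<partial>\<nu>)"
        by (subst \<nu>_shift[symmetric, of _ y]) auto
      also have "\<dots> = (\<integral>\<^sup>+x. indicator A (x + y) * indicator B x \<partial>\<nu>)"
        by (intro nn_integral_cong) (auto simp: B_def indicator_def)
      finally show "(\<integral>\<^sup>+x. indicator A x * indicator B (y + (- x)) \<partial>\<nu>) 
          = (\<integral>\<^sup>+x. indicator A (x + y) * indicator B x \<partial>\<nu>)" .
    qed
    also have "\<dots> = (\<integral>\<^sup>+x. \<integral>\<^sup>+y. indicator A (x + y) * indicator B x \<partial>lborel \<partial>\<nu>)"
      by (rule Fubini') measurable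
    also have "\<dots> = (\<integral>\<^sup>+x. emeasure lborel A * indicator B x \<partial>\<nu>)"
      using lborel_translation_integral[of "indicator A"]
      by (simp add: nn_integral_multc add.commute)
    also have "\<dots> = emeasure lborel A * emeasure lborel B"
      by (simp add: nn_integral_cmult \<nu>B)
    finally have "emeasure lborel B * emeasure \<nu> A = emeasure lborel B * emeasure lborel A"
      by (simp add: mult.commute)
    moreover have "emeasure lborel B \<noteq> 0" "emeasure lborel B \<noteq> top"
      using emeasure_lborel_ball_finite[of "0::'a" 1] open_null_lborel_empty[of B]
      by (auto simp: B_def)
    ultimately show ?thesis
      by (simp add: ennreal_mult_cancel_left)
  qed
  then show ?thesis
    unfolding \<nu>_def[symmetric] by (intro measure_eqI) auto
qed

lemma space_sphere_measure [simp]: "space sphere_measure = sphere 0 1"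
  by (simp add: sphere_measure_def space_scale_measure space_restrict_space)

lemma sets_sphere_measure [simp, measurable_cong]:
  "sets sphere_measure = sets (restrict_space borel (sphere 0 1))"
  by (simp add: sphere_measure_def)

lemma measurable_sgn_sphere:
  "sgn \<in> restrict_space lborel (ball 0 1 - {0}) \<rightarrow>\<^sub>M restrict_space borel (sphere (0::'a::euclidean_space) 1)"
proof -
  have "(sgn :: 'a \<Rightarrow> 'a) \<in> borel \<rightarrow>\<^sub>M borel"
    unfolding sgn_div_norm by measurable
  then have "(sgn :: 'a \<Rightarrow> 'a) \<in> restrict_space lborel (ball 0 1 - {0}) \<rightarrow>\<^sub>M borel"
    by (auto intro: measurable_restrict_space1)
  then show ?thesis
    by (auto intro!: measurable_restrict_space2 simp: space_restrict_space norm_sgn)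
qed

lemma emeasure_sphere_measure:
  fixes A :: "'a::euclidean_space set"
  assumes "A \<in> sets sphere_measure"
  shows "emeasure sphere_measure A
    = of_nat DIM('a) * emeasure lborel {x \<in> ball 0 1 - {0}. sgn x \<in> A}"
proof -
  have "sgn -` A \<inter> (ball 0 1 - {0}) = {x \<in> ball 0 1 - {0}. sgn x \<in> A}"
    by auto
  then show ?thesis
    using assms
    by (simp add: sphere_measure_def emeasure_distr measurable_sgn_sphere space_restrict_space)
      (subst emeasure_restrict_space, auto)
qed

lemma emeasure_sphere_measure_space:
  "emeasure sphere_measure (sphere (0::'a::euclidean_space) 1) = of_nat DIM('a) * emeasure lborel (ball 0 1 - {0 :: 'a})"
proof -
  have "sphere (0::'a) 1 \<in> sets sphere_measure"
    using sets.top[of "sphere_measure :: 'a measure"] by simp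
  moreover have "{x \<in> ball 0 1 - {0::'a}. sgn x \<in> sphere 0 1} = ball 0 1 - {0}"
    by (auto simp: norm_sgn)
  ultimately show ?thesis
    by (simp add: emeasure_sphere_measure)
qed

interpretation sphere_measure: finite_measure "sphere_measure :: 'a::euclidean_space measure"
proof
  have "emeasure lborel (ball 0 1 - {0::'a}) \<le> emeasure lborel (ball (0::'a) 1)"
    by (intro emeasure_mono) auto
  also have "\<dots> < \<infinity>"
    by (rule emeasure_lborel_ball_finite)
  finally show "emeasure sphere_measure (space (sphere_measure :: 'a measure)) \<noteq> (\<infinity> :: ennreal)"
    unfolding space_sphere_measure emeasure_sphere_measure_space
    by (simp add: ennreal_mult_eq_top_iff less_top[symmetric])
qed

lemma borel_measurable_sphere_continuous:
  fixes f :: "'a::euclidean_space \<Rightarrow> 'b::topological_space"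
  assumes "continuous_on (sphere 0 1) f"
  shows "f \<in> borel_measurable sphere_measure"
  using borel_measurable_continuous_on_restrict[OF assms]
  by (simp cong: measurable_cong_sets)

lemma integrable_sphere_continuous:
  fixes f :: "'a::euclidean_space \<Rightarrow> 'b::{banach, second_countable_topology}"
  assumes "continuous_on (sphere 0 1) f"
  shows "integrable sphere_measure f"
proof -
  have "bounded (f ` sphere 0 1)"
    using assms by (intro compact_imp_bounded compact_continuous_image) auto
  then obtain B where "\<forall>x\<in>sphere 0 1. norm (f x) \<le> B"
    by (auto simp: bounded_iff simp del: mem_sphere_0)
  then show ?thesis
    by (intro sphere_measure.integrable_const_bound[of _ B] borel_measurable_sphere_continuous assms) auto
qed

text \<open>
  The surface measure charges every nonempty relatively open set, because the cone over such a set is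
  a nonempty open subset of the punctured ball.  This lets an \<open>L\<^sup>2\<close> identity between continuous functions
  be read pointwise.
\<close>

lemma continuous_sphere_integral_0_imp_0:
  fixes h :: "'a::euclidean_space \<Rightarrow> real"
  assumes cont: "continuous_on (sphere 0 1) h"
    and nonneg: "\<And>z. z \<in> sphere 0 1 \<Longrightarrow> 0 \<le> h z"
    and int0: "(LINT z|sphere_measure. h z) = 0"
    and z: "z \<in> sphere 0 1"
  shows "h z = 0"
proof (rule ccontr)
  assume "h z \<noteq> 0"
  with nonneg[OF z] have hz: "0 < h z" by simp
  have "AE x in sphere_measure. 0 \<le> h x"
    using nonneg by (intro AE_I2) simp
  then have "AE x in sphere_measure. h x = 0"
    using integral_nonneg_eq_0_iff_AE[OF integrable_sphere_continuous[OF cont]] int0 by simp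
  then have "AE x in sphere_measure. \<not> 0 < h x"
    by eventually_elim simp
  moreover have pos: "{x \<in> sphere 0 1. 0 < h x} \<in> sets sphere_measure"
    using borel_measurable_less[OF borel_measurable_const borel_measurable_sphere_continuous[OF cont], of 0]
    by (simp only: space_sphere_measure pred_def)
  ultimately have "emeasure sphere_measure {x \<in> sphere 0 1. 0 < h x} = 0"
    by (subst (asm) AE_iff_measurable[OF pos]) auto
  then have "emeasure lborel {x \<in> ball 0 1 - {0}. sgn x \<in> {x \<in> sphere 0 1. 0 < h x}} = 0"
    unfolding emeasure_sphere_measure[OF pos] by simp
  moreover have "{x \<in> ball 0 1 - {0}. sgn x \<in> {x \<in> sphere 0 1. 0 < h x}}
      = {x \<in> ball 0 1 - {0}. 0 < h (sgn x)}"
    by (auto simp: norm_sgn)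
  ultimately have null: "emeasure lborel {x \<in> ball 0 1 - {0}. 0 < h (sgn x)} = 0"
    by simp
  have "continuous_on (ball 0 1 - {0}) (\<lambda>x. h (sgn x))"
    by (rule continuous_on_compose2[OF cont]) (auto intro!: continuous_intros simp: norm_sgn split: if_splits)
  then have "open ((\<lambda>x. h (sgn x)) -` {0<..} \<inter> (ball 0 1 - {0}))"
    by (rule continuous_on_open_vimage[THEN iffD1, rule_format, rotated]) auto
  then have "open {x \<in> ball 0 1 - {0}. 0 < h (sgn x)}"
    by (rule arg_cong[where f = "open", THEN iffD1, rotated]) auto
  moreover have "(1/2) *\<^sub>R z \<in> {x \<in> ball 0 1 - {0}. 0 < h (sgn x)}"
    using z hz by (auto simp: sgn_scaleR sgn_div_norm)
  ultimately show False
    using open_null_lborel_empty[OF _ null] by blast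
qed

text \<open>
  A linear isometry commutes with \<open>sgn\<close>, so invariance passes from Lebesgue measure on the ball to the
  surface measure.
\<close>

lemma distr_sphere_measure_orthogonal_transformation:
  fixes U :: "'a::euclidean_space \<Rightarrow> 'a"
  assumes U: "orthogonal_transformation U"
  shows "U \<in> sphere_measure \<rightarrow>\<^sub>M sphere_measure"
    and "distr sphere_measure sphere_measure U = sphere_measure"
proof -
  have linU: "linear U"
    using U by (rule orthogonal_transformation_linear)
  have norm_U: "norm (U x) = norm x" for x
    using orthogonal_transformation_norm[OF U] .
  have U_meas: "U \<in> borel \<rightarrow>\<^sub>M borel"
    using linU by (simp add: borel_measurable_continuous_onI linear_continuous_on linear_conv_bounded_linear)
  have "U \<in> restrict_space borel (sphere 0 1) \<rightarrow>\<^sub>M restrict_space borel (sphere 0 1)"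
    using U_meas by (auto intro!: measurable_restrict_space3 simp: norm_U)
  then show U_sphere: "U \<in> sphere_measure \<rightarrow>\<^sub>M sphere_measure"
    by (simp cong: measurable_cong_sets)
  show "distr sphere_measure sphere_measure U = sphere_measure"
  proof (rule measure_eqI)
    fix A :: "'a set"
    assume "A \<in> sets (distr sphere_measure sphere_measure U)"
    then have A: "A \<in> sets sphere_measure" by simp
    then have UA: "U -` A \<inter> sphere 0 1 \<in> sets sphere_measure"
      using measurable_sets[OF U_sphere] by simp
    have A_sub: "A \<subseteq> sphere 0 1"
      using sets.sets_into_space[OF A] by simp
    have sgn_U: "sgn (U x) = U (sgn x)" for x
      by (simp add: sgn_div_norm norm_U linear_scale[OF linU])
    let ?E = "{x \<in> ball 0 1 - {0}. sgn x \<in> A}"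
    have E: "?E \<in> sets borel"
      using measurable_sets[OF measurable_sgn_sphere, of A] A
      by (simp add: space_restrict_space sets_restrict_space_iff vimage_def Int_def conj_commute)
    have "{x \<in> ball 0 1 - {0}. sgn x \<in> U -` A \<inter> sphere 0 1} = U -` ?E"
      using norm_U[of 0] by (auto simp: norm_U sgn_U norm_sgn) (metis norm_U norm_eq_zero)+
    then have "emeasure (distr sphere_measure sphere_measure U) A
        = of_nat DIM('a) * emeasure lborel (U -` ?E)"
      using A UA U_sphere by (simp add: emeasure_distr emeasure_sphere_measure)
    also have "emeasure lborel (U -` ?E) = emeasure (distr lborel borel U) ?E"
      using U_meas E by (simp add: emeasure_distr)
    also have "\<dots> = emeasure lborel ?E"
      by (simp add: lborel_distr_orthogonal_transformation[OF U])
    finally show "emeasure (distr sphere_measure sphere_measure U) A = emeasure sphere_measure A"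
      using A by (simp add: emeasure_sphere_measure)
  qed simp
qed

lemma integral_sphere_orthogonal_transformation:
  fixes U :: "'a::euclidean_space \<Rightarrow> 'a"
    and g :: "'a \<Rightarrow> 'b::{banach, second_countable_topology}"
  assumes "orthogonal_transformation U" "g \<in> borel_measurable sphere_measure"
  shows "(LINT x|sphere_measure. g (U x)) = (LINT x|sphere_measure. g x)"
  using integral_distr[OF distr_sphere_measure_orthogonal_transformation(1) assms(2), of U]
    distr_sphere_measure_orthogonal_transformation(2)[of U] assms(1) by simp

section \<open>Green's identity on the sphere\<close>

lemma polynomial_function_complex_iff:
  fixes p :: "'a::real_normed_vector \<Rightarrow> complex"
  shows "polynomial_function p \<longleftrightarrow>
    real_polynomial_function (\<lambda>x. Re (p x)) \<and> real_polynomial_function (\<lambda>x. Im (p x))"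
  by (auto simp: polynomial_function_iff_Basis_inner Basis_complex_def inner_complex_def)

lemma polynomial_mult:
  fixes p q :: "'a::real_normed_vector \<Rightarrow> complex"
  assumes "polynomial_function p" "polynomial_function q"
  shows "polynomial_function (\<lambda>x. p x * q x)"
  using assms unfolding polynomial_function_complex_iff
  by (auto intro!: real_polynomial_function_diff)

lemma polynomial_function_cnj:
  fixes p :: "'a::real_normed_vector \<Rightarrow> complex"
  assumes "polynomial_function p"
  shows "polynomial_function (\<lambda>x. cnj (p x))"
  using assms unfolding polynomial_function_complex_iff by auto

lemma polynomial_of_real_inner:
  "polynomial_function (\<lambda>x::'a::real_inner. complex_of_real (x \<bullet> b))"
  unfolding polynomial_function_complex_iff
  by (auto intro!: real_polynomial_function.intros bounded_linear_inner_left)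

definition dir_deriv :: "'a::real_normed_vector \<Rightarrow> ('a \<Rightarrow> complex) \<Rightarrow> 'a \<Rightarrow> complex"
  where "dir_deriv b p x = frechet_derivative p (at x) b"

text \<open>
  The calculus below is phrased in terms of directional derivatives as functions of the base point,
  since these preserve polynomial functions and lower the degree of homogeneity by one.
\<close>

lemma laplacian_dir_deriv:
  "laplacian p x = (\<Sum>b\<in>Basis. dir_deriv b (dir_deriv b p) x)"
  by (simp add: laplacian_def dir_deriv_def[abs_def])

lemma polynomial_has_derivative:
  fixes p :: "'a::euclidean_space \<Rightarrow> complex"
  assumes "polynomial_function p"
  shows "(p has_derivative (\<lambda>b. dir_deriv b p x)) (at x)"
  using differentiable_at_polynomial_function[OF assms, of x UNIV]
  by (simp add: frechet_derivative_works dir_deriv_def)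

lemma dir_deriv_eqI:
  assumes "(p has_derivative p') (at x)"
  shows "dir_deriv b p x = p' b"
  using frechet_derivative_at[OF assms] by (simp add: dir_deriv_def)

lemma real_polynomial_function_derivative:
  assumes "real_polynomial_function (f :: 'a::euclidean_space \<Rightarrow> real)"
  shows "\<exists>f'. (\<forall>x. (f has_derivative f' x) (at x)) \<and> (\<forall>b. real_polynomial_function (\<lambda>x. f' x b))"
  using assms
proof induction
  case (linear f)
  then show ?case
    by (intro exI[of _ "\<lambda>x. f"]) (auto intro: bounded_linear_imp_has_derivative)
next
  case (const c)
  then show ?case
    by (intro exI[of _ "\<lambda>x b. 0"]) auto
next
  case (add f g)
  then obtain f' g' where "\<forall>x. (f has_derivative f' x) (at x)" "\<forall>b. real_polynomial_function (\<lambda>x. f' x b)"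
    "\<forall>x. (g has_derivative g' x) (at x)" "\<forall>b. real_polynomial_function (\<lambda>x. g' x b)"
    by blast
  then show ?case
    by (intro exI[of _ "\<lambda>x b. f' x b + g' x b"]) (auto intro!: has_derivative_add)
next
  case (mult f g)
  then obtain f' g' where "\<forall>x. (f has_derivative f' x) (at x)" "\<forall>b. real_polynomial_function (\<lambda>x. f' x b)"
    "\<forall>x. (g has_derivative g' x) (at x)" "\<forall>b. real_polynomial_function (\<lambda>x. g' x b)"
    by blast
  with mult.hyps show ?case
    by (intro exI[of _ "\<lambda>x b. f x * g' x b + f' x b * g x"] conjI allI has_derivative_mult
        real_polynomial_function.intros(3,4)) auto
qed

lemma polynomial_dir_deriv:
  fixes p :: "'a::euclidean_space \<Rightarrow> complex"
  assumes "polynomial_function p"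
  shows "polynomial_function (dir_deriv b p)"
proof -
  obtain u v where uv: "\<And>x. ((\<lambda>x. Re (p x)) has_derivative u x) (at x)"
      "\<And>b. real_polynomial_function (\<lambda>x. u x b)"
      "\<And>x. ((\<lambda>x. Im (p x)) has_derivative v x) (at x)" "\<And>b. real_polynomial_function (\<lambda>x. v x b)"
    using assms[unfolded polynomial_function_complex_iff] real_polynomial_function_derivative by metis
  have "((\<lambda>x. Complex (Re (p x)) (Im (p x))) has_derivative (\<lambda>b. Complex (u x b) (v x b))) (at x)" for x
    unfolding Complex_eq
    by (intro has_derivative_add has_derivative_mult_right has_derivative_of_real uv)
  then have "dir_deriv b p x = Complex (u x b) (v x b)" for x
    by (intro dir_deriv_eqI) simp
  then show ?thesis
    using uv by (auto simp: polynomial_function_complex_iff)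
qed

lemma dir_deriv_mult:
  fixes p q :: "'a::euclidean_space \<Rightarrow> complex"
  assumes "polynomial_function p" "polynomial_function q"
  shows "dir_deriv b (\<lambda>x. p x * q x) x
    = p x * dir_deriv b q x + dir_deriv b p x * q x"
  by (rule dir_deriv_eqI)
    (rule has_derivative_mult[OF polynomial_has_derivative polynomial_has_derivative, OF assms])

lemma dir_deriv_add:
  fixes p q :: "'a::euclidean_space \<Rightarrow> complex"
  assumes "polynomial_function p" "polynomial_function q"
  shows "dir_deriv b (\<lambda>x. p x + q x) x
    = dir_deriv b p x + dir_deriv b q x"
  by (rule dir_deriv_eqI)
    (rule has_derivative_add[OF polynomial_has_derivative polynomial_has_derivative, OF assms])

lemma dir_deriv_cmult:
  fixes p :: "'a::euclidean_space \<Rightarrow> complex"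
  assumes "polynomial_function p"
  shows "dir_deriv b (\<lambda>x. c * p x) x = c * dir_deriv b p x"
  by (rule dir_deriv_eqI)
    (rule has_derivative_mult_right[OF polynomial_has_derivative[OF assms]])

lemma dir_deriv_inner:
  "dir_deriv b (\<lambda>x::'a::euclidean_space. complex_of_real (x \<bullet> c)) x = of_real (b \<bullet> c)"
  by (rule dir_deriv_eqI)
    (intro bounded_linear_imp_has_derivative
      bounded_linear_compose[OF bounded_linear_of_real bounded_linear_inner_left])

lemma dir_deriv_expand:
  fixes p :: "'a::euclidean_space \<Rightarrow> complex"
  assumes "polynomial_function p"
  shows "dir_deriv v p x = (\<Sum>b\<in>Basis. of_real (v \<bullet> b) * dir_deriv b p x)"
proof -
  interpret D: linear "\<lambda>b. dir_deriv b p x"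
    using polynomial_has_derivative[OF assms] by (rule has_derivative_linear)
  have "dir_deriv v p x = dir_deriv (\<Sum>b\<in>Basis. (v \<bullet> b) *\<^sub>R b) p x"
    by (simp add: euclidean_representation)
  then show ?thesis
    by (simp add: D.sum D.scale scaleR_conv_of_real)
qed

text \<open>
  The degree is an integer so that differentiation always lowers it by exactly one; a polynomial of
  negative degree vanishes, by \<open>homogeneous_negative_eq_0\<close> below.
\<close>

definition homogeneous :: "int \<Rightarrow> ('a::real_vector \<Rightarrow> complex) \<Rightarrow> bool" where
  "homogeneous k p \<longleftrightarrow> (\<forall>t>0. \<forall>x. p (t *\<^sub>R x) = of_real (t powi k) * p x)"

lemma homogeneousD: "homogeneous k p \<Longrightarrow> 0 < t \<Longrightarrow> p (t *\<^sub>R x) = of_real (t powi k) * p x"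
  by (simp add: homogeneous_def)

lemma homogeneous_mult:
  "homogeneous j p \<Longrightarrow> homogeneous k q \<Longrightarrow> homogeneous (j + k) (\<lambda>x. p x * q x)"
  by (simp add: homogeneous_def power_int_add)

lemma homogeneous_dir_deriv:
  fixes p :: "'a::euclidean_space \<Rightarrow> complex"
  assumes p: "polynomial_function p" and hom: "homogeneous k p"
  shows "homogeneous (k - 1) (dir_deriv b p)"
  unfolding homogeneous_def
proof (intro allI impI)
  fix t :: real and x :: 'a
  assume t: "0 < t"
  have "((\<lambda>x. p (t *\<^sub>R x)) has_derivative (\<lambda>b. dir_deriv (t *\<^sub>R b) p (t *\<^sub>R x))) (at x)"
    by (rule has_derivative_compose[OF _ polynomial_has_derivative[OF p]])
      (auto intro!: bounded_linear_imp_has_derivative bounded_linear_scaleR_right)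
  moreover have "((\<lambda>x. p (t *\<^sub>R x)) has_derivative
      (\<lambda>b. of_real (t powi k) * dir_deriv b p x)) (at x)"
    unfolding homogeneousD[OF hom t]
    by (rule has_derivative_mult_right[OF polynomial_has_derivative[OF p]])
  ultimately have "dir_deriv (t *\<^sub>R b) p (t *\<^sub>R x) = of_real (t powi k) * dir_deriv b p x"
    using has_derivative_unique by metis
  moreover have "dir_deriv (t *\<^sub>R b) p (t *\<^sub>R x) = t *\<^sub>R dir_deriv b p (t *\<^sub>R x)"
    using has_derivative_linear[OF polynomial_has_derivative[OF p]] by (rule linear_scale)
  ultimately show "dir_deriv b p (t *\<^sub>R x) = of_real (t powi (k - 1)) * dir_deriv b p x"
    using t by (simp add: power_int_diff scaleR_conv_of_real field_simps)
qed

text \<open>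
  Both sides are the derivative of \<open>p(t x)\<close> at \<open>t = 1\<close>.
\<close>

lemma euler_identity:
  fixes p :: "'a::euclidean_space \<Rightarrow> complex"
  assumes p: "polynomial_function p" and hom: "homogeneous k p"
  shows "(\<Sum>b\<in>Basis. of_real (x \<bullet> b) * dir_deriv b p x) = of_int k * p x"
proof -
  have "((\<lambda>t. p (t *\<^sub>R x)) has_derivative (\<lambda>h. dir_deriv (h *\<^sub>R x) p (1 *\<^sub>R x))) (at (1::real))"
    by (rule has_derivative_compose[OF _ polynomial_has_derivative[OF p]])
      (auto intro!: bounded_linear_imp_has_derivative bounded_linear_scaleR_left)
  moreover have "((\<lambda>t. of_real (t powi k) * p x) has_derivative
     (\<lambda>h. of_real (h * of_int k) * p x)) (at (1::real))"
    by (auto intro!: derivative_eq_intros)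
  then have "((\<lambda>t. p (t *\<^sub>R x)) has_derivative (\<lambda>h. of_real (h * of_int k) * p x)) (at (1::real))"
    by (rule has_derivative_transform_within_open[where s = "{0<..}"])
      (auto simp: homogeneousD[OF hom])
  ultimately have "(\<lambda>h. dir_deriv (h *\<^sub>R x) p (1 *\<^sub>R x)) = (\<lambda>h. of_real (h * of_int k) * p x)"
    by (rule has_derivative_unique)
  from fun_cong[OF this, of 1] show ?thesis
    by (simp add: dir_deriv_expand[OF p, of x])
qed

text \<open>
  By continuity \<open>p(t x)\<close> stays bounded as \<open>t \<rightarrow> 0\<close>, whereas \<open>t^k\<close> does not.
\<close>

lemma homogeneous_negative_eq_0:
  fixes p :: "'a::euclidean_space \<Rightarrow> complex"
  assumes p: "polynomial_function p" and hom: "homogeneous k p" and k: "k < 0"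
  shows "p x = 0"
proof -
  define t where "t = (\<lambda>n. 1 / real (Suc n))"
  have t: "t \<longlonglongrightarrow> 0"
    unfolding t_def by (intro LIMSEQ_Suc lim_1_over_n)
  then have "(\<lambda>n. t n *\<^sub>R x) \<longlonglongrightarrow> 0 *\<^sub>R x"
    by (intro tendsto_intros)
  then have "(\<lambda>n. p (t n *\<^sub>R x)) \<longlonglongrightarrow> p 0"
    using continuous_polymonial_function[OF p, of 0] by (simp add: isCont_tendsto_compose[where g = p])
  moreover have "(\<lambda>n. t n ^ nat (- k)) \<longlonglongrightarrow> 0 ^ nat (- k)"
    by (intro tendsto_intros t)
  ultimately have "(\<lambda>n. of_real (t n ^ nat (- k)) * p (t n *\<^sub>R x)) \<longlonglongrightarrow> of_real (0 ^ nat (- k)) * p 0"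
    by (intro tendsto_mult tendsto_of_real)
  moreover have "of_real (t n ^ nat (- k)) * p (t n *\<^sub>R x) = p x" for n
  proof -
    have "0 < t n" by (simp add: t_def)
    moreover have "t n ^ nat (- k) * t n powi k = 1"
      using k \<open>0 < t n\<close> by (simp add: power_int_def field_simps)
    ultimately show ?thesis
      by (simp only: homogeneousD[OF hom] mult.assoc[symmetric] of_real_mult[symmetric]) simp
  qed
  ultimately show ?thesis
    using k by (simp add: LIMSEQ_const_iff)
qed

definition plane_rotation :: "'a::euclidean_space \<Rightarrow> 'a \<Rightarrow> real \<Rightarrow> 'a \<Rightarrow> 'a" where
  "plane_rotation b c t x =
     x + ((cos t - 1) * (x \<bullet> b) - sin t * (x \<bullet> c)) *\<^sub>R b + ((cos t - 1) * (x \<bullet> c) + sin t * (x \<bullet> b)) *\<^sub>R c"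

lemma plane_rotation_inner:
  assumes "b \<in> Basis" "c \<in> Basis" "b \<noteq> c"
  shows "plane_rotation b c t x \<bullet> b = cos t * (x \<bullet> b) - sin t * (x \<bullet> c)"
    and "plane_rotation b c t x \<bullet> c = cos t * (x \<bullet> c) + sin t * (x \<bullet> b)"
  using assms by (simp_all add: plane_rotation_def inner_add_left inner_Basis algebra_simps)

lemma plane_rotation_orthogonal:
  fixes b c :: "'a::euclidean_space"
  assumes bc: "b \<in> Basis" "c \<in> Basis" "b \<noteq> c"
  shows "orthogonal_transformation (plane_rotation b c t)"
  unfolding orthogonal_transformation_def
proof (intro conjI allI)
  show "linear (plane_rotation b c t)"
    by (rule linearI) (simp_all add: plane_rotation_def inner_add_left algebra_simps)
  fix x y :: 'a
  have *: "sin t * sin t = 1 - cos t * cos t"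
    using sin_cos_squared_add[of t] by (simp add: power2_eq_square)
  have "plane_rotation b c t x \<bullet> plane_rotation b c t y = x \<bullet> y
    + (y \<bullet> b) * ((cos t - 1) * (x \<bullet> b) - sin t * (x \<bullet> c)) + (y \<bullet> c) * ((cos t - 1) * (x \<bullet> c) + sin t * (x \<bullet> b))
    + (plane_rotation b c t x \<bullet> b) * ((cos t - 1) * (y \<bullet> b) - sin t * (y \<bullet> c))
    + (plane_rotation b c t x \<bullet> c) * ((cos t - 1) * (y \<bullet> c) + sin t * (y \<bullet> b))"
    by (simp add: plane_rotation_def inner_add_left inner_add_right inner_commute)
      (simp add: algebra_simps)
  also have "\<dots> = x \<bullet> y"
    unfolding plane_rotation_inner[OF bc] using * by algebra
  finally show "plane_rotation b c t x \<bullet> plane_rotation b c t y = x \<bullet> y" .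
qed

text \<open>
  The infinitesimal generator of \<open>plane_rotation b c\<close>.
\<close>

definition rotation_field :: "'a::euclidean_space \<Rightarrow> 'a \<Rightarrow> ('a \<Rightarrow> complex) \<Rightarrow> 'a \<Rightarrow> complex" where
  "rotation_field b c p x =
     of_real (x \<bullet> b) * dir_deriv c p x - of_real (x \<bullet> c) * dir_deriv b p x"

lemma polynomial_function_rotation_field:
  "polynomial_function p \<Longrightarrow> polynomial_function (rotation_field b c p)"
  unfolding rotation_field_def[abs_def]
  by (intro polynomial_function_diff polynomial_mult
      polynomial_of_real_inner polynomial_dir_deriv)

lemma has_vector_derivative_plane_rotation:
  fixes p :: "'a::euclidean_space \<Rightarrow> complex"
  assumes p: "polynomial_function p" and bc: "b \<in> Basis" "c \<in> Basis" "b \<noteq> c"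
  shows "((\<lambda>t. p (plane_rotation b c t x)) has_vector_derivative
    rotation_field b c p (plane_rotation b c t x)) (at t)"
proof -
  let ?y = "plane_rotation b c t x"
  have "(plane_rotation b c t has_derivative plane_rotation b c t) (at x)" for t x
    using orthogonal_transformation_linear[OF plane_rotation_orthogonal[OF bc]]
    by (simp add: linear_imp_has_derivative)
  have "((\<lambda>t. plane_rotation b c t x) has_derivative (\<lambda>h. h *\<^sub>R ((?y \<bullet> b) *\<^sub>R c - (?y \<bullet> c) *\<^sub>R b))) (at t)"
    unfolding plane_rotation_inner[OF bc] unfolding plane_rotation_def
    by (auto intro!: derivative_eq_intros simp: algebra_simps)
  from has_derivative_compose[OF this polynomial_has_derivative[OF p]]
  have "((\<lambda>t. p (plane_rotation b c t x)) has_derivative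
    (\<lambda>h. dir_deriv (h *\<^sub>R ((?y \<bullet> b) *\<^sub>R c - (?y \<bullet> c) *\<^sub>R b)) p ?y)) (at t)" .
  moreover have "dir_deriv (h *\<^sub>R ((?y \<bullet> b) *\<^sub>R c - (?y \<bullet> c) *\<^sub>R b)) p ?y
      = h *\<^sub>R rotation_field b c p ?y" for h
  proof -
    interpret D: linear "\<lambda>v. dir_deriv v p ?y"
      using polynomial_has_derivative[OF p] by (rule has_derivative_linear)
    show ?thesis
      by (simp only: D.scale D.diff rotation_field_def scaleR_conv_of_real)
  qed
  ultimately show ?thesis
    by (simp add: has_vector_derivative_def)
qed

text \<open>
  The integral of \<open>p\<close> over the sphere does not change when \<open>p\<close> is composed with a rotation; differentiate
  this at angle \<open>0\<close>.
\<close>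

lemma integral_rotation_field:
  fixes p :: "'a::euclidean_space \<Rightarrow> complex"
  assumes p: "polynomial_function p" and bc: "b \<in> Basis" "c \<in> Basis" "b \<noteq> c"
  shows "(LINT x|sphere_measure. rotation_field b c p x) = 0"
proof -
  define t where "t = (\<lambda>n. 1 / real (Suc n))"
  have t: "0 < t n" for n by (simp add: t_def)
  have t_lim: "t \<longlonglongrightarrow> 0"
    unfolding t_def by (intro LIMSEQ_Suc lim_1_over_n)
  \<comment> \<open>The difference quotients have integral zero and converge boundedly to the rotation field.\<close>
  let ?q = "\<lambda>n x. (p (plane_rotation b c (t n) x) - p x) /\<^sub>R t n"
  have cont_p: "continuous_on S p" and cont_X: "continuous_on S (rotation_field b c p)" for S
    using p polynomial_function_rotation_field[OF p] by (auto intro: continuous_on_polymonial_function)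
  have rotation_0: "plane_rotation b c 0 x = x" for x
    by (simp add: plane_rotation_def)
  have norm_rot: "norm (plane_rotation b c s x) = norm x" for s x
    using orthogonal_transformation_norm[OF plane_rotation_orthogonal[OF bc]] .
  have "bounded (rotation_field b c p ` sphere 0 1)"
    by (intro compact_imp_bounded compact_continuous_image cont_X) auto
  then obtain B where B: "\<forall>x\<in>sphere 0 1. norm (rotation_field b c p x) \<le> B"
    by (auto simp: bounded_iff simp del: mem_sphere_0)
  have cont_rot: "continuous_on S (plane_rotation b c s)" for S s
    unfolding plane_rotation_def by (intro continuous_intros)
  have cont_q: "continuous_on S (?q n)" for S n
    by (intro continuous_intros continuous_on_compose2[OF cont_p cont_rot] cont_p) auto
  have "(\<lambda>n. LINT x|sphere_measure. ?q n x) \<longlonglongrightarrow> (LINT x|sphere_measure. rotation_field b c p x)"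
  proof (rule integral_dominated_convergence[where w = "\<lambda>_. B"])
    show "rotation_field b c p \<in> borel_measurable sphere_measure" "?q n \<in> borel_measurable sphere_measure" for n
      by (intro borel_measurable_sphere_continuous cont_X cont_q)+
    show "AE x in sphere_measure. (\<lambda>n. ?q n x) \<longlonglongrightarrow> rotation_field b c p x"
    proof (rule AE_I2)
      fix x
      have "((\<lambda>s. norm (p (plane_rotation b c s x) - p x - s *\<^sub>R rotation_field b c p x) / norm s) \<longlongrightarrow> 0) (at 0)"
        using has_vector_derivative_plane_rotation[OF p bc, of x 0]
        by (simp add: has_vector_derivative_def has_derivative_at plane_rotation_def)
      moreover have "norm (p (plane_rotation b c s x) - p x - s *\<^sub>R rotation_field b c p x) / norm s
          = norm ((p (plane_rotation b c s x) - p x) /\<^sub>R s - rotation_field b c p x)" if "s \<noteq> 0" for s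
      proof -
        have "(p (plane_rotation b c s x) - p x) /\<^sub>R s - rotation_field b c p x
            = (p (plane_rotation b c s x) - p x - s *\<^sub>R rotation_field b c p x) /\<^sub>R s"
          using that by (simp add: scaleR_diff_right)
        then show ?thesis
          by (simp add: divide_inverse mult.commute)
      qed
      ultimately have "((\<lambda>s. norm ((p (plane_rotation b c s x) - p x) /\<^sub>R s - rotation_field b c p x)) \<longlongrightarrow> 0) (at 0)"
        by (intro Lim_transform_eventually[of _ 0 "at 0" "\<lambda>s. norm ((p (plane_rotation b c s x) - p x) /\<^sub>R s - rotation_field b c p x)"])
          (auto simp: eventually_at_filter)
      then have "((\<lambda>s. (p (plane_rotation b c s x) - p x) /\<^sub>R s) \<longlongrightarrow> rotation_field b c p x) (at 0)"
        by (rule LIM_zero_cancel[OF tendsto_norm_zero_cancel])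
      then show "(\<lambda>n. ?q n x) \<longlonglongrightarrow> rotation_field b c p x"
        by (rule filterlim_compose) (use t t_lim in \<open>auto simp: filterlim_at less_imp_neq[THEN not_sym]\<close>)
    qed
    show "AE x in sphere_measure. norm (?q n x) \<le> B" for n
    proof (rule AE_I2)
      fix x :: 'a assume x: "x \<in> space sphere_measure"
      have "norm (p (plane_rotation b c (t n) x) - p (plane_rotation b c 0 x)) \<le> B * norm (t n - 0)"
      proof (rule differentiable_bound[of UNIV])
        fix s
        show "((\<lambda>s. p (plane_rotation b c s x)) has_derivative
           (\<lambda>h. h *\<^sub>R rotation_field b c p (plane_rotation b c s x))) (at s within UNIV)"
          using has_vector_derivative_plane_rotation[OF p bc] by (simp add: has_vector_derivative_def)
        show "onorm (\<lambda>h. h *\<^sub>R rotation_field b c p (plane_rotation b c s x)) \<le> B"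
        proof (rule onorm_le)
          fix h
          have "plane_rotation b c s x \<in> sphere 0 1"
            using x by (simp add: norm_rot)
          with B have "norm (rotation_field b c p (plane_rotation b c s x)) \<le> B"
            by blast
          then show "norm (h *\<^sub>R rotation_field b c p (plane_rotation b c s x)) \<le> B * norm h"
            by (simp add: mult.commute[of B] mult_left_mono)
        qed
      qed auto
      then show "norm (?q n x) \<le> B"
        using t[of n] by (simp add: rotation_0 divide_inverse[symmetric] mult.commute[of "inverse _"] pos_divide_le_eq)
    qed
  qed auto
  moreover have "(LINT x|sphere_measure. ?q n x) = 0" for n
  proof -
    have "(LINT x|sphere_measure. p (plane_rotation b c (t n) x)) = (LINT x|sphere_measure. p x)"
      by (intro integral_sphere_orthogonal_transformation plane_rotation_orthogonal bc
          borel_measurable_sphere_continuous cont_p)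
    then show ?thesis
      by (subst integral_scaleR_right, subst Bochner_Integration.integral_diff)
        (auto intro!: integrable_sphere_continuous continuous_on_compose2[OF cont_p cont_rot] cont_p)
  qed
  ultimately show ?thesis
    by (simp only: LIMSEQ_const_iff)
qed

text \<open>
  The divergence theorem on the sphere for homogeneous functions.  With \<open>X_c\<close> the rotation field in the
  plane of \<open>b\<close> and \<open>c\<close>, Euler's identity gives
  \<open>\<Sum>_c X_c (x_c g) = (k + D - 1) x_b g - \<partial>_b g\<close> on the unit sphere of dimension \<open>D - 1\<close>, and the left-hand
  side has integral zero.
\<close>

lemma integral_dir_deriv:
  fixes g :: "'a::euclidean_space \<Rightarrow> complex"
  assumes g: "polynomial_function g" and hom: "homogeneous k g" and b: "b \<in> Basis"
  shows "(LINT x|sphere_measure. dir_deriv b g x)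
    = (of_int k + of_nat DIM('a) - 1) * (LINT x|sphere_measure. of_real (x \<bullet> b) * g x)"
proof -
  let ?X = "\<lambda>c. rotation_field b c (\<lambda>x. of_real (x \<bullet> c) * g x)"
  have poly: "polynomial_function (\<lambda>x. of_real (x \<bullet> c) * g x)" for c
    by (intro polynomial_mult polynomial_of_real_inner g)
  have int: "integrable sphere_measure p" if "polynomial_function p" for p :: "'a \<Rightarrow> complex"
    by (intro integrable_sphere_continuous continuous_on_polymonial_function that)
  have "(\<Sum>c\<in>Basis - {b}. ?X c x)
      = (of_int k + of_nat DIM('a) - 1) * (of_real (x \<bullet> b) * g x) - dir_deriv b g x"
    if x: "x \<in> sphere 0 1" for x
  proof -
    let ?d = "\<lambda>c. dir_deriv c g x" and ?x = "\<lambda>c. complex_of_real (x \<bullet> c)"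
    have X: "?X c x = ?x b * g x + ?x b * (?x c * ?d c) - (?x c * ?x c) * ?d b" if "c \<in> Basis - {b}" for c
      using that b not_sym[of c b]
      by (simp add: rotation_field_def dir_deriv_mult polynomial_of_real_inner g
          dir_deriv_inner inner_not_same_Basis algebra_simps)
    have "(\<Sum>c\<in>Basis. ?x c * ?x c) = of_real (\<Sum>c\<in>Basis. (x \<bullet> c) * (x \<bullet> c))"
      by simp
    also have "(\<Sum>c\<in>Basis. (x \<bullet> c) * (x \<bullet> c)) = 1"
      using x by (simp add: euclidean_inner[symmetric] norm_eq_1)
    finally have sq: "(\<Sum>c\<in>Basis - {b}. ?x c * ?x c) = 1 - ?x b * ?x b"
      using b by (simp add: sum_diff1)
    have eu: "(\<Sum>c\<in>Basis - {b}. ?x c * ?d c) = of_int k * g x - ?x b * ?d b"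
      using b by (simp add: sum_diff1 euler_identity[OF g hom])
    have "(\<Sum>c\<in>Basis - {b}. ?X c x)
        = of_nat (card (Basis - {b})) * (?x b * g x)
          + ?x b * (\<Sum>c\<in>Basis - {b}. ?x c * ?d c) - (\<Sum>c\<in>Basis - {b}. ?x c * ?x c) * ?d b"
      by (simp add: X sum_subtractf sum.distrib sum_distrib_left sum_distrib_right)
    also have "card (Basis - {b}) = DIM('a) - 1"
      using b by simp
    finally show ?thesis
      unfolding sq eu using DIM_positive[where 'a = 'a] by (simp add: of_nat_diff algebra_simps)
  qed
  then have "(LINT x|sphere_measure. (\<Sum>c\<in>Basis - {b}. ?X c x))
     = (LINT x|sphere_measure. (of_int k + of_nat DIM('a) - 1) * (of_real (x \<bullet> b) * g x) - dir_deriv b g x)"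
    by (intro Bochner_Integration.integral_cong) auto
  also have "\<dots> = (of_int k + of_nat DIM('a) - 1) * (LINT x|sphere_measure. of_real (x \<bullet> b) * g x)
      - (LINT x|sphere_measure. dir_deriv b g x)"
    by (subst Bochner_Integration.integral_diff)
      (auto intro!: int polynomial_dir_deriv g poly integrable_mult_right)
  also have "(LINT x|sphere_measure. (\<Sum>c\<in>Basis - {b}. ?X c x)) = (\<Sum>c\<in>Basis - {b}. LINT x|sphere_measure. ?X c x)"
    by (intro Bochner_Integration.integral_sum int polynomial_function_rotation_field poly)
  also have "\<dots> = 0"
    using b by (intro sum.neutral ballI integral_rotation_field poly) auto
  finally show ?thesis by simp
qed

text \<open>
  Apply the divergence theorem to \<open>(\<partial>_b p) q\<close>, of degree \<open>j - 1 + k\<close>, and sum over \<open>b\<close>; on the right,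
  Euler's identity reassembles \<open>\<Sum>_b x_b \<partial>_b p\<close> into \<open>j p\<close>.
\<close>

lemma green_identity_half:
  fixes p q :: "'a::euclidean_space \<Rightarrow> complex"
  assumes p: "polynomial_function p" "homogeneous j p"
    and q: "polynomial_function q" "homogeneous k q"
  shows "(LINT x|sphere_measure. laplacian p x * q x)
      + (LINT x|sphere_measure. (\<Sum>b\<in>Basis. dir_deriv b p x * dir_deriv b q x))
    = of_int ((j + k + int DIM('a) - 2) * j) * (LINT x|sphere_measure. p x * q x)"
proof -
  let ?c = "of_int (j + k + int DIM('a) - 2) :: complex"
  have int: "integrable sphere_measure p" if "polynomial_function p" for p :: "'a \<Rightarrow> complex"
    by (intro integrable_sphere_continuous continuous_on_polymonial_function that)
  note poly = polynomial_mult polynomial_dir_deriv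
    polynomial_of_real_inner p(1) q(1)
  have step: "(LINT x|sphere_measure. dir_deriv b (\<lambda>x. dir_deriv b p x * q x) x)
      = ?c * (LINT x|sphere_measure. of_real (x \<bullet> b) * (dir_deriv b p x * q x))"
    if "b \<in> Basis" for b
  proof -
    have "polynomial_function (\<lambda>x. dir_deriv b p x * q x)"
      by (intro poly)
    then show ?thesis
      using integral_dir_deriv[OF _ homogeneous_mult[OF homogeneous_dir_deriv[OF p] q(2)] that]
      by simp
  qed
  have "(LINT x|sphere_measure. laplacian p x * q x)
      + (LINT x|sphere_measure. (\<Sum>b\<in>Basis. dir_deriv b p x * dir_deriv b q x))
    = (LINT x|sphere_measure. (\<Sum>b\<in>Basis. dir_deriv b (\<lambda>x. dir_deriv b p x * q x) x))"
  proof -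
    have "(\<Sum>b\<in>Basis. dir_deriv b (\<lambda>x. dir_deriv b p x * q x) x)
        = laplacian p x * q x + (\<Sum>b\<in>Basis. dir_deriv b p x * dir_deriv b q x)" for x
      by (simp add: laplacian_dir_deriv dir_deriv_mult poly sum_distrib_right
          sum.distrib add.commute)
    moreover have "integrable sphere_measure (\<lambda>x. laplacian p x * q x)"
      unfolding laplacian_dir_deriv by (intro int poly polynomial_function_sum) simp
    moreover have "integrable sphere_measure
        (\<lambda>x. \<Sum>b\<in>Basis. dir_deriv b p x * dir_deriv b q x)"
      by (intro int poly polynomial_function_sum) simp
    ultimately show ?thesis by simp
  qed
  also have "\<dots> = (\<Sum>b\<in>Basis. LINT x|sphere_measure. dir_deriv b (\<lambda>x. dir_deriv b p x * q x) x)"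
    by (intro Bochner_Integration.integral_sum int poly)
  also have "\<dots> = (\<Sum>b\<in>Basis. ?c * (LINT x|sphere_measure. of_real (x \<bullet> b) * (dir_deriv b p x * q x)))"
    by (intro sum.cong refl step)
  also have "\<dots> = ?c * (LINT x|sphere_measure. (\<Sum>b\<in>Basis. of_real (x \<bullet> b) * (dir_deriv b p x * q x)))"
    by (subst Bochner_Integration.integral_sum) (auto intro!: int poly simp: sum_distrib_left)
  also have "(\<lambda>x. \<Sum>b\<in>Basis. of_real (x \<bullet> b) * (dir_deriv b p x * q x)) = (\<lambda>x. of_int j * (p x * q x))"
    using euler_identity[OF p] by (simp add: sum_distrib_right[symmetric] mult.assoc[symmetric])
  finally show ?thesis
    by (simp add: algebra_simps)
qed

text \<open>
  The integral of the product of the gradients is symmetric in \<open>p\<close> and \<open>q\<close> and cancels.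
\<close>

theorem green_identity:
  fixes p q :: "'a::euclidean_space \<Rightarrow> complex"
  assumes p: "polynomial_function p" "homogeneous j p"
    and q: "polynomial_function q" "homogeneous k q"
  shows "(LINT x|sphere_measure. laplacian p x * q x) - (LINT x|sphere_measure. p x * laplacian q x)
    = of_int ((j + k + int DIM('a) - 2) * (j - k)) * (LINT x|sphere_measure. p x * q x)"
proof -
  have comm: "laplacian q x * p x = p x * laplacian q x" "q x * p x = p x * q x"
      "dir_deriv b q x * dir_deriv b p x
        = dir_deriv b p x * dir_deriv b q x" for x b
    by (simp_all only: mult.commute)
  have kj: "k + j + int DIM('a) - 2 = j + k + int DIM('a) - 2"
    by simp
  let ?c = "of_int (j + k + int DIM('a) - 2) :: complex"
  note pq = green_identity_half[OF p q, unfolded of_int_mult]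
  note qp = green_identity_half[OF q p, unfolded comm kj of_int_mult]
  have "(LINT x|sphere_measure. laplacian p x * q x) - (LINT x|sphere_measure. p x * laplacian q x)
      = ?c * of_int j * (LINT x|sphere_measure. p x * q x) - ?c * of_int k * (LINT x|sphere_measure. p x * q x)"
    unfolding pq[symmetric] qp[symmetric] by simp
  then show ?thesis
    unfolding of_int_mult of_int_diff[of j k] by (simp add: left_diff_distrib right_diff_distrib)
qed

lemma homogeneous_laplacian:
  fixes p :: "'a::euclidean_space \<Rightarrow> complex"
  assumes "polynomial_function p" "homogeneous k p"
  shows "polynomial_function (laplacian p)" and "homogeneous (k - 2) (laplacian p)"
proof -
  have "homogeneous (k - 1 - 1) (dir_deriv b (dir_deriv b p))" for b
    by (intro homogeneous_dir_deriv polynomial_dir_deriv assms)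
  then show "homogeneous (k - 2) (laplacian p)"
    by (simp add: homogeneous_def laplacian_dir_deriv sum_distrib_left)
  show "polynomial_function (laplacian p)"
    unfolding laplacian_dir_deriv[abs_def]
    by (intro polynomial_function_sum polynomial_dir_deriv assms) simp
qed

text \<open>
  When \<open>p\<close> is harmonic, Green's identity expresses \<open>\<integral> p q\<close> as a multiple of \<open>\<integral> p \<Delta>q\<close>, and \<open>\<Delta>q\<close> has degree
  \<open>k - 2\<close>.  The induction ends when the degree is negative.  The factor \<open>(j + k + D - 2)(j - k)\<close> is nonzero
  because \<open>0 \<le> k < j\<close> and \<open>2 \<le> D\<close>.
\<close>

theorem harmonic_orthogonal_lower_degree:
  fixes p q :: "'a::euclidean_space \<Rightarrow> complex"
  assumes dim: "2 \<le> DIM('a)"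
    and p: "polynomial_function p" "homogeneous j p" "\<And>x. laplacian p x = 0"
    and q: "polynomial_function q" "homogeneous k q" and less: "k < j"
  shows "(LINT x|sphere_measure. p x * q x) = 0"
  using q less
proof (induction "nat k" arbitrary: k q rule: less_induct)
  case less
  show ?case
  proof (cases "k < 0")
    case True
    then show ?thesis
      using homogeneous_negative_eq_0[OF less.prems(1,2)] by simp
  next
    case False
    have "(LINT x|sphere_measure. p x * laplacian q x) = 0"
    proof (cases "k = 0")
      case True
      then show ?thesis
        using homogeneous_negative_eq_0[OF homogeneous_laplacian[OF less.prems(1,2)]] by simp
    next
      case nz: False
      show ?thesis
        by (rule less.hyps[OF _ homogeneous_laplacian[OF less.prems(1,2)]]) (use nz False less.prems in auto)
    qed
    then have "of_int ((j + k + int DIM('a) - 2) * (j - k)) * (LINT x|sphere_measure. p x * q x) = 0"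
      using green_identity[OF p(1,2) less.prems(1,2)] p(3) by simp
    moreover have "(j + k + int DIM('a) - 2) * (j - k) \<noteq> 0"
      using False less.prems(3) dim by auto
    ultimately show ?thesis
      by (simp del: of_int_mult)
  qed
qed

section \<open>Monomials in z and its conjugate\<close>

definition complex_monomial :: "('n \<Rightarrow> nat) \<times> ('n \<Rightarrow> nat) \<Rightarrow> complex^'n \<Rightarrow> complex" where
  "complex_monomial a z = (\<Prod>i\<in>UNIV. z $ i ^ fst a i * cnj (z $ i) ^ snd a i)"

text \<open>
  \<open>polynomial_function\<close> knows only real coordinates.  The bidegree is visible in the monomials in \<open>z\<close> and
  its conjugate, so polynomial functions are first rewritten as combinations of these.
\<close>

definition monomial_span :: "(complex^'n \<Rightarrow> complex) \<Rightarrow> bool" where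
  "monomial_span p \<longleftrightarrow>
     (\<exists>A c. finite A \<and> (\<forall>z. p z = (\<Sum>a\<in>A. c a * complex_monomial a z)))"

lemma monomial_span_monomial: "monomial_span (\<lambda>z. k * complex_monomial a z)"
  unfolding monomial_span_def by (rule exI[of _ "{a}"], rule exI[of _ "\<lambda>_. k"]) simp

lemma monomial_span_add:
  assumes "monomial_span p" "monomial_span q"
  shows "monomial_span (\<lambda>z. p z + q z)"
proof -
  obtain A c where A: "finite A" "\<forall>z. p z = (\<Sum>a\<in>A. c a * complex_monomial a z)"
    using assms(1) unfolding monomial_span_def by (elim exE conjE)
  obtain B d where B: "finite B" "\<forall>z. q z = (\<Sum>a\<in>B. d a * complex_monomial a z)"
    using assms(2) unfolding monomial_span_def by (elim exE conjE)
  note * = A(1) A(2)[rule_format] B(1) B(2)[rule_format]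
  define e where "e a = (if a \<in> A then c a else 0) + (if a \<in> B then d a else 0)" for a
  have "p z = (\<Sum>a\<in>A \<union> B. (if a \<in> A then c a else 0) * complex_monomial a z)" for z
    unfolding *(2) using * by (intro sum.mono_neutral_cong_left) auto
  moreover have "q z = (\<Sum>a\<in>A \<union> B. (if a \<in> B then d a else 0) * complex_monomial a z)" for z
    unfolding *(4) using * by (intro sum.mono_neutral_cong_left) auto
  ultimately have "p z + q z = (\<Sum>a\<in>A \<union> B. e a * complex_monomial a z)" for z
    by (simp add: e_def sum.distrib distrib_right)
  then show ?thesis
    unfolding monomial_span_def using *
    by (intro exI[where x = "A \<union> B"], intro exI[where x = e]) simp
qed

lemma monomial_span_const: "monomial_span (\<lambda>z. c)"
  using monomial_span_monomial[of c "(\<lambda>_. 0, \<lambda>_. 0)"] by (simp add: complex_monomial_def)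

lemma monomial_span_sum:
  assumes "finite I" "\<And>i. i \<in> I \<Longrightarrow> monomial_span (p i)"
  shows "monomial_span (\<lambda>z. \<Sum>i\<in>I. p i z)"
  using assms by (induction I) (auto intro: monomial_span_add monomial_span_const)

lemma complex_monomial_mult:
  "complex_monomial a z * complex_monomial b z
    = complex_monomial (\<lambda>i. fst a i + fst b i, \<lambda>i. snd a i + snd b i) z"
  by (simp add: complex_monomial_def prod.distrib[symmetric] power_add mult_ac)

lemma monomial_span_mult:
  assumes "monomial_span p" "monomial_span q"
  shows "monomial_span (\<lambda>z. p z * q z)"
proof -
  obtain A c where A: "finite A" "\<forall>z. p z = (\<Sum>a\<in>A. c a * complex_monomial a z)"
    using assms(1) unfolding monomial_span_def by (elim exE conjE)
  obtain B d where B: "finite B" "\<forall>z. q z = (\<Sum>a\<in>B. d a * complex_monomial a z)"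
    using assms(2) unfolding monomial_span_def by (elim exE conjE)
  note * = A(1) A(2)[rule_format] B(1) B(2)[rule_format]
  have "p z * q z = (\<Sum>a\<in>A. \<Sum>b\<in>B. c a * d b *
      complex_monomial (\<lambda>i. fst a i + fst b i, \<lambda>i. snd a i + snd b i) z)" for z
    unfolding * sum_product complex_monomial_mult[symmetric] by (simp add: mult_ac)
  then show ?thesis
    using * by (simp add: monomial_span_sum monomial_span_monomial)
qed

lemma complex_monomial_indicator:
  "complex_monomial (\<lambda>j. of_bool (j = i), \<lambda>_. 0) z = z $ i"
  "complex_monomial (\<lambda>_. 0, \<lambda>j. of_bool (j = i)) z = cnj (z $ i)"
proof -
  have *: "(\<Prod>j\<in>UNIV. f j ^ of_bool (j = i)) = f i" for f :: "'a \<Rightarrow> complex"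
    by (subst prod.remove[of _ i]) (auto intro!: prod.neutral)
  show "complex_monomial (\<lambda>j. of_bool (j = i), \<lambda>_. 0) z = z $ i"
    "complex_monomial (\<lambda>_. 0, \<lambda>j. of_bool (j = i)) z = cnj (z $ i)"
    using *[of "\<lambda>j. z $ j"] *[of "\<lambda>j. cnj (z $ j)"] by (simp_all add: complex_monomial_def)
qed

text \<open>
  The real and imaginary parts of a coordinate are combinations of it and its conjugate.
\<close>

lemma monomial_span_linear:
  fixes f :: "complex^'n \<Rightarrow> real"
  assumes "bounded_linear f"
  shows "monomial_span (\<lambda>z. complex_of_real (f z))"
proof -
  interpret f: bounded_linear f by fact
  define u v where "u i = complex_of_real (f (axis i 1))" and "v i = complex_of_real (f (axis i \<i>))" for i
  have "complex_of_real (f z) = (\<Sum>i\<in>UNIV. (u i - \<i> * v i) / 2 * z $ i + (u i + \<i> * v i) / 2 * cnj (z $ i))" for z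
  proof -
    have "z = (\<Sum>i\<in>UNIV. Re (z $ i) *\<^sub>R axis i 1 + Im (z $ i) *\<^sub>R axis i \<i>)"
    proof (subst vec_eq_iff, intro allI)
      fix j
      have "(\<Sum>i\<in>UNIV. Re (z $ i) *\<^sub>R axis i 1 + Im (z $ i) *\<^sub>R axis i \<i>) $ j
          = (\<Sum>i\<in>UNIV. if i = j then Re (z $ i) *\<^sub>R 1 + Im (z $ i) *\<^sub>R \<i> else 0)"
        unfolding sum_component by (rule sum.cong) (simp_all add: axis_def)
      also have "\<dots> = z $ j"
        by (simp add: complex_eq_iff)
      finally show "z $ j = (\<Sum>i\<in>UNIV. Re (z $ i) *\<^sub>R axis i 1 + Im (z $ i) *\<^sub>R axis i \<i>) $ j" ..
    qed
    moreover have fz: "f (\<Sum>i\<in>UNIV. Re (z $ i) *\<^sub>R axis i 1 + Im (z $ i) *\<^sub>R axis i \<i>)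
        = (\<Sum>i\<in>UNIV. Re (z $ i) * f (axis i 1) + Im (z $ i) * f (axis i \<i>))"
      by (simp add: f.sum f.add f.scaleR)
    ultimately have "f z = (\<Sum>i\<in>UNIV. Re (z $ i) * f (axis i 1) + Im (z $ i) * f (axis i \<i>))"
      by simp
    then have "complex_of_real (f z) = (\<Sum>i\<in>UNIV. of_real (Re (z $ i)) * u i + of_real (Im (z $ i)) * v i)"
      by (simp add: u_def v_def)
    also have "\<dots> = (\<Sum>i\<in>UNIV. (u i - \<i> * v i) / 2 * z $ i + (u i + \<i> * v i) / 2 * cnj (z $ i))"
      by (intro sum.cong refl) (simp add: complex_eq_iff field_simps u_def v_def)
    finally show ?thesis .
  qed
  moreover have lin: "monomial_span (\<lambda>z. k * z $ i)" "monomial_span (\<lambda>z. k * cnj (z $ i))" for k i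
    using monomial_span_monomial[of k "(\<lambda>j. of_bool (j = i), \<lambda>_. 0)"]
      monomial_span_monomial[of k "(\<lambda>_. 0, \<lambda>j. of_bool (j = i))"]
    by (simp_all only: complex_monomial_indicator)
  have "monomial_span (\<lambda>z. \<Sum>i\<in>UNIV. (u i - \<i> * v i) / 2 * z $ i + (u i + \<i> * v i) / 2 * cnj (z $ i))"
    by (intro monomial_span_sum monomial_span_add lin finite_class.finite_UNIV)
  ultimately show ?thesis
    by simp
qed

lemma polynomial_monomial_span:
  fixes p :: "complex^'n \<Rightarrow> complex"
  assumes "polynomial_function p"
  shows "monomial_span p"
proof -
  have real: "monomial_span (\<lambda>z. complex_of_real (f z))"
    if "real_polynomial_function f" for f :: "complex^'n \<Rightarrow> real"
    using that
  proof induction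
    case (linear f)
    then show ?case by (rule monomial_span_linear)
  next
    case (const c)
    show ?case by (rule monomial_span_const)
  next
    case (add f g)
    show ?case
      unfolding of_real_add by (rule monomial_span_add[OF add.IH])
  next
    case (mult f g)
    show ?case
      unfolding of_real_mult by (rule monomial_span_mult[OF mult.IH])
  qed
  have "monomial_span (\<lambda>z. complex_of_real (Re (p z)) + \<i> * complex_of_real (Im (p z)))"
    by (rule monomial_span_add[OF real monomial_span_mult[OF monomial_span_const real]])
      (use assms in \<open>simp_all add: polynomial_function_complex_iff\<close>)
  then show ?thesis
    unfolding complex_eq[symmetric] .
qed

lemma complex_monomial_scale:
  "complex_monomial a (c *s z)
    = c ^ (\<Sum>i\<in>UNIV. fst a i) * cnj c ^ (\<Sum>i\<in>UNIV. snd a i) * complex_monomial a z"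
  by (simp add: complex_monomial_def power_mult_distrib prod.distrib power_sum mult_ac)

lemma polynomial_function_vec_nth: "polynomial_function (\<lambda>z::complex^'n. z $ i)"
  by (intro polynomial_function_bounded_linear bounded_linear_vec_nth)

lemma polynomial_power:
  "polynomial_function p \<Longrightarrow> polynomial_function (\<lambda>x. (p x :: complex) ^ k)"
  by (induction k) (auto intro: polynomial_mult)

lemma polynomial_complex_monomial: "polynomial_function (complex_monomial a)"
proof -
  have "polynomial_function (\<lambda>z. \<Prod>i\<in>I. z $ i ^ fst a i * cnj (z $ i) ^ snd a i)" if "finite I" for I
    using that by induction
      (auto intro!: polynomial_mult polynomial_power
        polynomial_function_vec_nth polynomial_function_cnj)
  then show ?thesis
    by (simp add: complex_monomial_def[abs_def])
qed

lemma coefficient_comparison: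
  fixes d :: "'s \<Rightarrow> 'a::idom"
  assumes "finite S" "infinite X" "\<And>x. x \<in> X \<Longrightarrow> (\<Sum>s\<in>S. d s * x ^ e s) = v * x ^ m"
  shows "(\<Sum>s | s \<in> S \<and> e s = m. d s) = v"
proof -
  define P where "P = (\<Sum>s\<in>S. monom (d s) (e s)) - monom v m"
  have "X \<subseteq> {x. poly P x = 0}"
    using assms(3) by (auto simp: P_def poly_sum poly_monom)
  then have "P = 0"
    using assms(2) poly_roots_finite infinite_super by blast
  then have "0 = coeff P m" by simp
  also have "\<dots> = (\<Sum>s\<in>S. if e s = m then d s else 0) - v"
    by (simp add: P_def coeff_sum)
  also have "(\<Sum>s\<in>S. if e s = m then d s else 0) = (\<Sum>s | s \<in> S \<and> e s = m. d s)"
    using assms(1) by (simp add: sum.inter_filter)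
  finally show ?thesis by simp
qed

text \<open>
  Uniqueness of the coefficients of a polynomial in \<open>c\<close> and \<open>cnj c\<close>.  Real multiples of a fixed \<open>u\<close>
  separate the total degrees \<open>a + b\<close>.  For fixed total degree and \<open>|u| = 1\<close>, multiplication by
  \<open>u^(a+b)\<close> turns \<open>u^a (cnj u)^b\<close> into \<open>(u^2)^a\<close>, which separates \<open>a\<close>.
\<close>

lemma bidegree_comparison:
  fixes w :: "'s \<Rightarrow> complex"
  assumes S: "finite S"
    and eq: "\<And>c. (\<Sum>s\<in>S. w s * (c ^ a s * cnj c ^ b s)) = v * (c ^ l * cnj c ^ l')"
  shows "(\<Sum>s | s \<in> S \<and> a s = l \<and> b s = l'. w s) = v"
proof -
  let ?S = "{s \<in> S. a s + b s = l + l'}"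
  have *: "(\<Sum>s\<in>?S. w s * (u ^ a s * cnj u ^ b s)) = v * (u ^ l * cnj u ^ l')" for u
  proof (rule coefficient_comparison[where S = S and X = "range complex_of_real"
        and d = "\<lambda>s. w s * (u ^ a s * cnj u ^ b s)" and e = "\<lambda>s. a s + b s"
        and v = "v * (u ^ l * cnj u ^ l')" and m = "l + l'", OF S])
    show "infinite (range complex_of_real)"
    proof
      assume "finite (range complex_of_real)"
      then have "finite (UNIV :: real set)"
        by (rule finite_imageD) (simp add: inj_def)
      then show False
        by (simp add: infinite_UNIV_char_0)
    qed
    fix x assume "x \<in> range complex_of_real"
    then obtain t where "x = complex_of_real t" by auto
    then show "(\<Sum>s\<in>S. w s * (u ^ a s * cnj u ^ b s) * x ^ (a s + b s)) = v * (u ^ l * cnj u ^ l') * x ^ (l + l')"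
      using eq[of "x * u"] by (simp add: power_mult_distrib power_add mult_ac)
  qed
  have "(\<Sum>s | s \<in> ?S \<and> a s = l. w s) = v"
  proof (rule coefficient_comparison[where S = ?S and X = "sphere 0 1" and d = w and e = a and v = v and m = l])
    show "infinite (sphere 0 1 :: complex set)"
    proof
      assume "finite (sphere 0 1 :: complex set)"
      moreover have "connected (sphere 0 1 :: complex set)"
        by (rule connected_sphere) simp
      ultimately consider "sphere 0 1 = ({} :: complex set)" | a :: complex where "sphere 0 1 = {a}"
        using connected_finite_iff_sing by blast
      moreover have "1 \<in> (sphere 0 1 :: complex set)" "- 1 \<in> (sphere 0 1 :: complex set)"
        by simp_all
      ultimately show False
        by cases (metis empty_iff, metis one_neq_neg_one singletonD)
    qed
    fix x :: complex assume x: "x \<in> sphere 0 1"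
    define u where "u = csqrt x"
    have u: "u\<^sup>2 = x"
      by (simp add: u_def)
    have norm_u: "norm u = 1"
      using x by (simp add: u_def)
    have uc: "u * cnj u = 1"
      using complex_norm_square[of u] unfolding norm_u by simp
    have rew: "u ^ (i + j) * (u ^ i * cnj u ^ j) = x ^ i" for i j
    proof -
      have "u ^ (i + j) * (u ^ i * cnj u ^ j) = (u\<^sup>2) ^ i * (u * cnj u) ^ j"
        unfolding power_add power_mult_distrib power2_eq_square by (simp only: mult_ac)
      then show ?thesis unfolding u uc by simp
    qed
    have "(\<Sum>s\<in>?S. w s * x ^ a s) = (\<Sum>s\<in>?S. u ^ (l + l') * (w s * (u ^ a s * cnj u ^ b s)))"
    proof (intro sum.cong refl)
      fix s assume "s \<in> ?S"
      then have "l + l' = a s + b s" by simp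
      then show "w s * x ^ a s = u ^ (l + l') * (w s * (u ^ a s * cnj u ^ b s))"
        using rew[of "a s" "b s"] by (simp add: mult_ac)
    qed
    also have "\<dots> = u ^ (l + l') * (v * (u ^ l * cnj u ^ l'))"
      using * by (simp add: sum_distrib_left[symmetric])
    also have "\<dots> = v * x ^ l"
      using rew[of l l'] by (simp add: mult_ac)
    finally show "(\<Sum>s\<in>?S. w s * x ^ a s) = v * x ^ l" .
  qed (use S in auto)
  also have "{s. s \<in> ?S \<and> a s = l} = {s. s \<in> S \<and> a s = l \<and> b s = l'}"
    by auto
  finally show ?thesis .
qed

text \<open>
  The exponents of the monomials of bidegree \<open>(l, l')\<close> that are not divisible by \<open>|z_i|^2\<close>.
\<close>

definition reduced_indices :: "'n \<Rightarrow> nat \<Rightarrow> nat \<Rightarrow> (('n::finite \<Rightarrow> nat) \<times> ('n \<Rightarrow> nat)) set" where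
  "reduced_indices i l l' =
     {a. sum (fst a) UNIV = l \<and> sum (snd a) UNIV = l' \<and> (fst a i = 0 \<or> snd a i = 0)}"

text \<open>
  The entry at \<open>j\<close> is determined by the prescribed sum and the entries on \<open>J\<close>, each of which is at most
  \<open>k\<close>.
\<close>

lemma multi_indices_card:
  fixes j :: "'n::finite"
  assumes J: "j \<notin> J"
  shows "finite {\<alpha> :: 'n \<Rightarrow> nat. sum \<alpha> UNIV = k \<and> (\<forall>i. i \<notin> insert j J \<longrightarrow> \<alpha> i = 0)}"
    and "card {\<alpha> :: 'n \<Rightarrow> nat. sum \<alpha> UNIV = k \<and> (\<forall>i. i \<notin> insert j J \<longrightarrow> \<alpha> i = 0)} \<le> (k + 1) ^ card J"
proof -
  let ?T = "{\<alpha> :: 'n \<Rightarrow> nat. sum \<alpha> UNIV = k \<and> (\<forall>i. i \<notin> insert j J \<longrightarrow> \<alpha> i = 0)}"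
  let ?r = "\<lambda>\<alpha>. restrict \<alpha> J"
  have inj: "inj_on ?r ?T"
  proof (rule inj_onI)
    fix \<alpha> \<beta> assume ab: "\<alpha> \<in> ?T" "\<beta> \<in> ?T" and r: "?r \<alpha> = ?r \<beta>"
    have eq: "\<alpha> i = \<beta> i" if "i \<noteq> j" for i
      using ab fun_cong[OF r, of i] that by (cases "i \<in> J") auto
    have "\<alpha> j + sum \<alpha> (UNIV - {j}) = \<beta> j + sum \<beta> (UNIV - {j})"
      using ab by (simp add: sum.remove[of UNIV j, symmetric])
    moreover have "sum \<alpha> (UNIV - {j}) = sum \<beta> (UNIV - {j})"
      by (intro sum.cong) (auto simp: eq)
    ultimately show "\<alpha> = \<beta>"
      using eq by (intro ext) (metis (full_types) add_right_cancel)
  qed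
  have sub: "?r ` ?T \<subseteq> PiE J (\<lambda>_. {..k})"
  proof (rule image_subsetI)
    fix \<alpha> assume "\<alpha> \<in> ?T"
    then have "\<alpha> i \<le> k" for i
      using member_le_sum[of i UNIV \<alpha>] by simp
    then show "?r \<alpha> \<in> PiE J (\<lambda>_. {..k})"
      by simp
  qed
  have fin: "finite (PiE J (\<lambda>_. {..k}))" and card: "card (PiE J (\<lambda>_. {..k})) = (k + 1) ^ card J"
    by (simp_all add: finite_PiE card_PiE)
  show "finite ?T"
    by (rule inj_on_finite[OF inj sub fin])
  show "card ?T \<le> (k + 1) ^ card J"
    using card_inj_on_le[OF inj sub fin] unfolding card .
qed

lemma reduced_indices_card:
  fixes i :: "'n::finite"
  assumes "2 \<le> CARD('n)"
  shows "finite (reduced_indices i l l')"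
    and "card (reduced_indices i l l') \<le> (l + l' + 2) * ((l + 1) * (l' + 1)) ^ (CARD('n) - 2)"
proof -
  let ?n = "CARD('n)"
  have "UNIV \<noteq> {i}"
    using assms card_1_singleton_iff[of "UNIV :: 'n set"] by auto
  then obtain j where j: "j \<noteq> i"
    by blast
  define T where "T k = {\<alpha> :: 'n \<Rightarrow> nat. sum \<alpha> UNIV = k}" for k
  define T0 where "T0 k = {\<alpha> :: 'n \<Rightarrow> nat. sum \<alpha> UNIV = k \<and> \<alpha> i = 0}" for k
  have T: "finite (T k)" "card (T k) \<le> (k + 1) ^ (?n - 1)" for k
    using multi_indices_card[of j "UNIV - {j}" k] by (simp_all add: T_def insert_UNIV)
  have T0: "finite (T0 k)" "card (T0 k) \<le> (k + 1) ^ (?n - 2)" for k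
  proof -
    have "T0 k = {\<alpha>. sum \<alpha> UNIV = k \<and> (\<forall>m. m \<notin> insert j (UNIV - {i, j}) \<longrightarrow> \<alpha> m = 0)}"
      using j by (auto simp: T0_def)
    moreover have "card (UNIV - {i, j}) = ?n - 2"
      using j by (simp add: card_Diff_subset)
    ultimately show "finite (T0 k)" "card (T0 k) \<le> (k + 1) ^ (?n - 2)"
      using multi_indices_card[of j "UNIV - {i, j}" k] by simp_all
  qed
  have sub: "reduced_indices i l l' \<subseteq> T0 l \<times> T l' \<union> T l \<times> T0 l'"
    by (auto simp: reduced_indices_def T_def T0_def)
  have fin: "finite (T0 l \<times> T l' \<union> T l \<times> T0 l')"
    using T T0 by auto
  then show "finite (reduced_indices i l l')"
    using sub finite_subset by blast
  have "card (reduced_indices i l l') \<le> card (T0 l \<times> T l') + card (T l \<times> T0 l')"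
    using card_mono[OF fin sub] card_Un_le le_trans by blast
  also have "\<dots> \<le> (l + 1) ^ (?n - 2) * (l' + 1) ^ (?n - 1) + (l + 1) ^ (?n - 1) * (l' + 1) ^ (?n - 2)"
    using T T0 by (intro add_mono) (simp_all add: card_cartesian_product mult_mono)
  also have "?n - 1 = Suc (?n - 2)"
    using assms by simp
  also have "(l + 1) ^ (?n - 2) * (l' + 1) ^ Suc (?n - 2) + (l + 1) ^ Suc (?n - 2) * (l' + 1) ^ (?n - 2)
      = (l + l' + 2) * ((l + 1) * (l' + 1)) ^ (?n - 2)"
  proof -
    have "P * ((l' + 1) * Q) + (l + 1) * P * Q = (l + l' + 2) * (P * Q)" for P Q :: nat
      by (simp add: algebra_simps)
    then show ?thesis
      unfolding power_Suc power_mult_distrib .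
  qed
  finally show "card (reduced_indices i l l') \<le> (l + l' + 2) * ((l + 1) * (l' + 1)) ^ (?n - 2)" .
qed

section \<open>Orthogonality and dimension of the bihomogeneous harmonic spaces\<close>

text \<open>
  A homogeneous linear system with more unknowns than equations has a nontrivial solution, by Gaussian
  elimination: solve one equation for an unknown with nonzero coefficient and substitute.
\<close>

lemma homogeneous_system_nontrivial:
  fixes M :: "'i \<Rightarrow> 'g \<Rightarrow> 'a::field"
  assumes "finite G" "finite I" "card G < card I"
  shows "\<exists>x. (\<exists>i\<in>I. x i \<noteq> 0) \<and> (\<forall>g\<in>G. (\<Sum>i\<in>I. x i * M i g) = 0)"
  using assms
proof (induction G arbitrary: I M rule: finite_induct)
  case empty
  then have "I \<noteq> {}" by auto
  then show ?case by (intro exI[where x = "\<lambda>_. 1"]) auto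
next
  case (insert g G)
  show ?case
  proof (cases "\<forall>i\<in>I. M i g = 0")
    case True
    have "card G < card I" using insert by simp
    then obtain x where "\<exists>i\<in>I. x i \<noteq> 0" "\<forall>g\<in>G. (\<Sum>i\<in>I. x i * M i g) = 0"
      using insert.IH[of I M] insert.prems by blast
    then show ?thesis using True by (intro exI[where x = x]) simp
  next
    case False
    then obtain j where j: "j \<in> I" "M j g \<noteq> 0" by auto
    \<comment> \<open>The system for the remaining unknowns once equation \<open>g\<close> has been solved for unknown \<open>j\<close>.\<close>
    define N where "N i h = M i h - M i g / M j g * M j h" for i h
    have "card G < card (I - {j})"
      using insert j by simp
    then obtain x where x: "\<exists>i\<in>I - {j}. x i \<noteq> 0" "\<forall>h\<in>G. (\<Sum>i\<in>I - {j}. x i * N i h) = 0"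
      using insert.IH[of "I - {j}" N] insert.prems by blast
    define s where "s = (\<Sum>i\<in>I - {j}. x i * M i g)"
    define y where "y = x(j := - s / M j g)"
    have y: "(\<Sum>i\<in>I. y i * M i h) = - s / M j g * M j h + (\<Sum>i\<in>I - {j}. x i * M i h)" for h
    proof -
      have "(\<Sum>i\<in>I - {j}. y i * M i h) = (\<Sum>i\<in>I - {j}. x i * M i h)"
        by (intro sum.cong) (auto simp: y_def)
      then show ?thesis
        using j insert.prems by (subst sum.remove[of _ j]) (auto simp: y_def)
    qed
    have "(\<Sum>i\<in>I. y i * M i h) = 0" if "h \<in> G" for h
    proof -
      have "0 = (\<Sum>i\<in>I - {j}. x i * M i h - x i * M i g * (M j h / M j g))"
        using x(2) that by (simp add: N_def algebra_simps)
      also have "\<dots> = (\<Sum>i\<in>I - {j}. x i * M i h) - s * (M j h / M j g)"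
        by (simp add: sum_subtractf s_def sum_distrib_right sum_divide_distrib)
      finally have "(\<Sum>i\<in>I - {j}. x i * M i h) = s * (M j h / M j g)"
        by (rule eq_iff_diff_eq_0[THEN iffD2, OF sym])
      then show ?thesis
        unfolding y by simp
    qed
    moreover have "(\<Sum>i\<in>I. y i * M i g) = 0"
      unfolding y using j by (simp add: s_def)
    moreover have "\<exists>i\<in>I. y i \<noteq> 0"
      using x(1) by (auto simp: y_def)
    ultimately show ?thesis
      by (intro exI[where x = y]) auto
  qed
qed

definition sphere_inner :: "('a::euclidean_space \<Rightarrow> complex) \<Rightarrow> ('a \<Rightarrow> complex) \<Rightarrow> complex" where
  "sphere_inner f g = (LINT z|sphere_measure. f z * cnj (g z))"

lemma integrable_sphere_mult:
  fixes f g :: "'a::euclidean_space \<Rightarrow> complex"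
  assumes f: "integrable sphere_measure f" and g: "continuous_on (sphere 0 1) g"
  shows "integrable sphere_measure (\<lambda>z. f z * g z)"
proof -
  have "bounded (g ` sphere 0 1)"
    using g by (intro compact_imp_bounded compact_continuous_image) auto
  then obtain B where B: "\<forall>x\<in>sphere 0 1. norm (g x) \<le> B"
    by (auto simp: bounded_iff simp del: mem_sphere_0)
  have "integrable sphere_measure (\<lambda>z. B * norm (f z))"
    using f by (intro integrable_mult_right integrable_norm)
  moreover have "(\<lambda>z. f z * g z) \<in> borel_measurable sphere_measure"
    using f borel_measurable_sphere_continuous[OF g] by (intro borel_measurable_times) auto
  moreover have "AE z in sphere_measure. norm (f z * g z) \<le> norm (B * norm (f z))"
  proof (rule AE_I2)
    fix z :: 'a assume "z \<in> space sphere_measure"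
    then have "norm (g z) \<le> B" using B by simp
    then have "norm (f z) * norm (g z) \<le> norm (f z) * B" by (intro mult_left_mono) auto
    also have "\<dots> \<le> norm (B * norm (f z))"
      by (simp add: abs_mult mult.commute[of B] mult_right_mono mult_left_mono)
    finally show "norm (f z * g z) \<le> norm (B * norm (f z))" by (simp add: norm_mult)
  qed
  ultimately show ?thesis by (rule Bochner_Integration.integrable_bound)
qed

lemma sphere_inner_cnj: "cnj (sphere_inner f g) = sphere_inner g f"
proof -
  have "cnj (sphere_inner f g) = (LINT z|sphere_measure. cnj (f z * cnj (g z)))"
    unfolding sphere_inner_def by (rule Bochner_Integration.integral_cnj[symmetric])
  then show ?thesis
    by (simp add: sphere_inner_def mult.commute)
qed

lemma sphere_inner_sum_left:
  assumes "finite I" "\<forall>i\<in>I. integrable sphere_measure (f i)" "continuous_on (sphere 0 1) g"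
  shows "sphere_inner (\<lambda>z. \<Sum>i\<in>I. c i * f i z) g = (\<Sum>i\<in>I. c i * sphere_inner (f i) g)"
proof -
  have int: "integrable sphere_measure (\<lambda>z. f i z * cnj (g z))" if "i \<in> I" for i
    using assms that by (intro integrable_sphere_mult continuous_on_cnj) auto
  have "sphere_inner (\<lambda>z. \<Sum>i\<in>I. c i * f i z) g
      = (LINT z|sphere_measure. (\<Sum>i\<in>I. c i * (f i z * cnj (g z))))"
    by (simp add: sphere_inner_def sum_distrib_right mult.assoc)
  also have "\<dots> = (\<Sum>i\<in>I. LINT z|sphere_measure. c i * (f i z * cnj (g z)))"
    by (rule Bochner_Integration.integral_sum) (rule integrable_mult_right[OF int])
  also have "\<dots> = (\<Sum>i\<in>I. c i * sphere_inner (f i) g)"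
    by (simp add: sphere_inner_def)
  finally show ?thesis .
qed

lemma sphere_inner_diff_left:
  assumes "integrable sphere_measure f" "integrable sphere_measure h" "continuous_on (sphere 0 1) g"
  shows "sphere_inner (\<lambda>z. f z - h z) g = sphere_inner f g - sphere_inner h g"
  unfolding sphere_inner_def left_diff_distrib
  by (intro Bochner_Integration.integral_diff integrable_sphere_mult continuous_on_cnj assms)

lemma sphere_inner_self:
  "sphere_inner f f = complex_of_real (LINT z|sphere_measure. (norm (f z))\<^sup>2)"
  unfolding sphere_inner_def complex_norm_square[symmetric]
  by (subst integral_complex_of_real[symmetric]) simp

lemma sphere_inner_self_eq_0:
  fixes f :: "'a::euclidean_space \<Rightarrow> complex"
  assumes cont: "continuous_on (sphere 0 1) f" and zero: "sphere_inner f f = 0" and z: "z \<in> sphere 0 1"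
  shows "f z = 0"
proof -
  have "(norm (f z))\<^sup>2 = 0"
    using zero z unfolding sphere_inner_self
    by (intro continuous_sphere_integral_0_imp_0[where h = "\<lambda>z. (norm (f z))\<^sup>2"])
      (auto intro!: continuous_intros cont)
  then show ?thesis by simp
qed

lemma scaleR_eq_vector_scalar_mult: "t *\<^sub>R x = complex_of_real t *s x" for x :: "complex^'n"
proof (subst vec_eq_iff, intro allI)
  fix i
  show "(t *\<^sub>R x) $ i = (complex_of_real t *s x) $ i"
    unfolding vector_scaleR_component vector_smult_component by (rule scaleR_conv_of_real)
qed

lemma bihomogeneousD:
  assumes "bihomogeneous_harmonic_polynomial l l' p"
  shows "polynomial_function p" "laplacian p z = 0" "p (c *s z) = c ^ l * cnj c ^ l' * p z"
    "continuous_on S p" "homogeneous (int l + int l') p"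
proof -
  show p: "polynomial_function p" "laplacian p z = 0" "p (c *s z) = c ^ l * cnj c ^ l' * p z" for c z
    using assms by (auto simp: bihomogeneous_harmonic_polynomial_def)
  show "continuous_on S p"
    by (rule continuous_on_polymonial_function[OF p(1)])
  show "homogeneous (int l + int l') p"
    by (simp add: homogeneous_def scaleR_eq_vector_scalar_mult p(3) power_int_add)
qed

lemma bihomogeneous_cmult:
  assumes "bihomogeneous_harmonic_polynomial l l' p"
  shows "bihomogeneous_harmonic_polynomial l l' (\<lambda>z. c * p z)"
proof -
  note p = bihomogeneousD[OF assms]
  have "polynomial_function (\<lambda>z. c * p z)"
    by (rule polynomial_mult[OF polynomial_function_const p(1)])
  moreover have D: "dir_deriv b (\<lambda>z. c * q z) = (\<lambda>z. c * dir_deriv b q z)"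
    if "polynomial_function q" for b and q :: "complex^'a \<Rightarrow> complex"
    using dir_deriv_cmult[OF that] by (rule ext)
  have "laplacian (\<lambda>z. c * p z) z = c * laplacian p z" for z
    unfolding laplacian_dir_deriv D[OF p(1)]
      D[OF polynomial_dir_deriv[OF p(1)]] by (simp add: sum_distrib_left)
  ultimately show ?thesis
    unfolding bihomogeneous_harmonic_polynomial_def by (simp add: p(2,3))
qed

lemma bihomogeneous_add:
  assumes "bihomogeneous_harmonic_polynomial l l' p" "bihomogeneous_harmonic_polynomial l l' q"
  shows "bihomogeneous_harmonic_polynomial l l' (\<lambda>z. p z + q z)"
proof -
  note p = bihomogeneousD[OF assms(1)]
  note q = bihomogeneousD[OF assms(2)]
  have "polynomial_function (\<lambda>z. p z + q z)"
    by (rule polynomial_function_add[OF p(1) q(1)])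
  moreover have D: "dir_deriv b (\<lambda>z. f z + g z) = (\<lambda>z. dir_deriv b f z + dir_deriv b g z)"
    if "polynomial_function f" "polynomial_function g" for b and f g :: "complex^'a \<Rightarrow> complex"
    using dir_deriv_add[OF that] by (rule ext)
  have "laplacian (\<lambda>z. p z + q z) z = laplacian p z + laplacian q z" for z
    unfolding laplacian_dir_deriv D[OF p(1) q(1)]
      D[OF polynomial_dir_deriv[OF p(1)] polynomial_dir_deriv[OF q(1)]]
    by (simp add: sum.distrib)
  ultimately show ?thesis
    unfolding bihomogeneous_harmonic_polynomial_def by (simp add: p(2,3) q(2,3) distrib_left)
qed

lemma bihomogeneous_sum:
  fixes e :: "'i \<Rightarrow> complex^'n \<Rightarrow> complex"
  assumes "finite I" "\<forall>i\<in>I. bihomogeneous_harmonic_polynomial l l' (e i)"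
  shows "bihomogeneous_harmonic_polynomial l l' (\<lambda>z. \<Sum>i\<in>I. c i * e i z)"
  using assms
proof (induction I rule: finite_induct)
  case empty
  have "polynomial_function (\<lambda>z::complex^'n. 0 :: complex)"
    by (rule polynomial_function_const)
  then have "dir_deriv b (\<lambda>z::complex^'n. 0 :: complex) = (\<lambda>z. 0)" for b
    using dir_deriv_cmult[of "\<lambda>z::complex^'n. 0" b 0] by (intro ext) simp
  then have "laplacian (\<lambda>z::complex^'n. 0 :: complex) z = 0" for z
    by (simp add: laplacian_dir_deriv)
  then show ?case
    by (simp add: bihomogeneous_harmonic_polynomial_def)
next
  case (insert i I)
  then have "bihomogeneous_harmonic_polynomial l l' (\<lambda>z. c i * e i z + (\<Sum>i\<in>I. c i * e i z))"
    by (intro bihomogeneous_add bihomogeneous_cmult) simp_all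
  then show ?case
    using insert.hyps by simp
qed

lemma bihomogeneous_diff:
  assumes "bihomogeneous_harmonic_polynomial l l' p" "bihomogeneous_harmonic_polynomial l l' q"
  shows "bihomogeneous_harmonic_polynomial l l' (\<lambda>z. p z - q z)"
  using bihomogeneous_add[OF assms(1) bihomogeneous_cmult[OF assms(2), of "-1"]]
  by simp

text \<open>
  Every vector is a complex multiple of a unit vector; the origin is \<open>0\<close> times one.
\<close>

lemma bihomogeneous_zero_on_sphere:
  assumes p: "bihomogeneous_harmonic_polynomial l l' p" and zero: "\<forall>z\<in>sphere 0 1. p z = 0"
  shows "p z = 0"
proof -
  obtain c u where "z = c *s u" "u \<in> sphere 0 1"
  proof (cases "z = 0")
    case True
    moreover have "axis undefined 1 \<in> sphere (0 :: complex^'a) 1"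
      using norm_Basis[of "axis undefined 1 :: complex^'a"] by (simp add: axis_in_Basis_iff)
    moreover have "z = 0 *s axis undefined 1"
      using True by (simp add: vec_eq_iff)
    ultimately show ?thesis using that by blast
  next
    case False
    have "z = complex_of_real (norm z) *s sgn z"
      unfolding scaleR_eq_vector_scalar_mult[symmetric] using False by (simp add: sgn_div_norm)
    moreover have "sgn z \<in> sphere 0 1"
      using False by (simp add: norm_sgn)
    ultimately show ?thesis using that by blast
  qed
  then show ?thesis
    using bihomogeneousD(3)[OF p] zero by simp
qed

lemma bihomogeneous_inner_self_eq_0:
  assumes "bihomogeneous_harmonic_polynomial l l' p" "sphere_inner p p = 0"
  shows "p z = 0"
  by (rule bihomogeneous_zero_on_sphere[OF assms(1)])
    (use sphere_inner_self_eq_0[OF bihomogeneousD(4)[OF assms(1)] assms(2)] in blast)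

lemma homogeneous_cnj: "homogeneous k p \<Longrightarrow> homogeneous k (\<lambda>x. cnj (p x))"
  by (simp add: homogeneous_def)

lemma harmonic_inner_lower_degree:
  fixes p q :: "complex^'n \<Rightarrow> complex"
  assumes p: "bihomogeneous_harmonic_polynomial l l' p"
    and q: "polynomial_function q" "homogeneous k q" and k: "k < int l + int l'"
  shows "sphere_inner p q = 0"
  unfolding sphere_inner_def
proof (rule harmonic_orthogonal_lower_degree[OF _ bihomogeneousD(1,5)[OF p]])
  have "1 \<le> CARD('n)" by (simp add: Suc_le_eq)
  then show "2 \<le> DIM(complex^'n)" by simp
qed (use k bihomogeneousD(2)[OF p] in
    \<open>simp_all add: polynomial_function_cnj[OF q(1)] homogeneous_cnj[OF q(2)]\<close>)

lemma orthogonal_transformation_complex_scale: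
  assumes "norm c = 1"
  shows "orthogonal_transformation (\<lambda>z::complex^'n. c *s z)"
  unfolding orthogonal_transformation
proof (intro conjI allI)
  show "linear (\<lambda>z::complex^'n. c *s z)"
    by (rule linearI) (simp_all add: vec_eq_iff algebra_simps)
  fix v :: "complex^'n"
  show "norm (c *s v) = norm v"
    using assms by (simp add: norm_vec_def norm_mult)
qed

text \<open>
  If the total degrees differ, the polynomial of larger degree is orthogonal to the other one.  If they
  agree, then \<open>l - l' \<noteq> m - m'\<close>, and multiplication of \<open>z\<close> by a suitable unit complex number changes the
  sign of the integrand but not the integral.
\<close>

theorem bihomogeneous_orthogonal:
  fixes p q :: "complex^'n \<Rightarrow> complex"
  assumes p: "bihomogeneous_harmonic_polynomial l l' p"
    and q: "bihomogeneous_harmonic_polynomial m m' q" and ne: "(l, l') \<noteq> (m, m')"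
  shows "sphere_inner p q = 0"
proof -
  note P = bihomogeneousD[OF p] and Q = bihomogeneousD[OF q]
  consider "m + m' < l + l'" | "l + l' < m + m'" | "l + l' = m + m'" "l + m' \<noteq> m + l'"
    using ne by force
  then show ?thesis
  proof cases
    case 1
    then show ?thesis
      by (intro harmonic_inner_lower_degree[OF p Q(1,5)]) simp
  next
    case 2
    then have "sphere_inner q p = 0"
      by (intro harmonic_inner_lower_degree[OF q P(1,5)]) simp
    then show ?thesis
      using sphere_inner_cnj[of q p] by simp
  next
    case 3
    \<comment> \<open>With \<open>k = |(l + m') - (m + l')|\<close> and \<open>c^k = -1\<close>, the substitution \<open>z \<mapsto> c z\<close> negates the integrand.\<close>
    define k where "k = (if m + l' < l + m' then l + m' - (m + l') else m + l' - (l + m'))"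
    have k: "0 < k" using 3 by (auto simp: k_def)
    define c where "c = cis (pi / real k)"
    have nc: "norm c = 1" by (simp add: c_def)
    have ck: "c ^ k = -1"
      unfolding c_def Complex.DeMoivre using k by simp
    have cc: "c * cnj c = 1"
      using complex_norm_square[of c] by (simp add: nc)
    have "sphere_inner p q = (LINT z|sphere_measure. p (c *s z) * cnj (q (c *s z)))"
      unfolding sphere_inner_def
      by (rule integral_sphere_orthogonal_transformation[OF orthogonal_transformation_complex_scale[OF nc], symmetric])
        (intro borel_measurable_sphere_continuous continuous_on_mult continuous_on_cnj P(4) Q(4))
    also have "\<dots> = (LINT z|sphere_measure. (c ^ (l + m') * cnj c ^ (m + l')) * (p z * cnj (q z)))"
      by (simp add: P(3) Q(3) power_add mult_ac)
    also have "\<dots> = (c ^ (l + m') * cnj c ^ (m + l')) * sphere_inner p q"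
      by (simp add: sphere_inner_def)
    finally have eq: "sphere_inner p q = (c ^ (l + m') * cnj c ^ (m + l')) * sphere_inner p q" .
    have ccn: "c ^ j * cnj c ^ j = 1" for j
      by (simp add: cc power_mult_distrib[symmetric])
    have "c ^ (l + m') * cnj c ^ (m + l') = -1"
    proof (cases "m + l' < l + m'")
      case True
      then have "l + m' = k + (m + l')" by (simp add: k_def)
      then show ?thesis by (simp only: power_add[of c k] ck mult.assoc ccn) simp
    next
      case False
      then have "m + l' = k + (l + m')" by (simp add: k_def)
      then have "c ^ (l + m') * cnj c ^ (m + l') = cnj (c ^ k) * (c ^ (l + m') * cnj c ^ (l + m'))"
        by (simp only: power_add[of "cnj c" k] complex_cnj_power mult.left_commute mult.assoc)
      then show ?thesis by (simp only: ck ccn) simp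
    qed
    with eq show ?thesis by simp
  qed
qed

text \<open>
  Only monomials of bidegree \<open>(l, l')\<close> occur in \<open>p\<close>, by comparison of coefficients; those divisible by
  \<open>|z_i|^2\<close> are collected in the second summand.
\<close>

lemma bihomogeneous_reduction:
  fixes p :: "complex^'n \<Rightarrow> complex"
  assumes poly: "polynomial_function p" and bihom: "\<forall>c z. p (c *s z) = c ^ l * cnj c ^ l' * p z"
    and fin: "finite (reduced_indices i l l')"
  shows "\<exists>d q. polynomial_function q \<and> homogeneous (int l + int l' - 2) q \<and>
    (\<forall>z. p z = (\<Sum>a\<in>reduced_indices i l l'. d a * complex_monomial a z) + z $ i * cnj (z $ i) * q z)"
proof -
  let ?G = "reduced_indices i l l'"
  obtain A c where A: "finite A" "\<forall>z. p z = (\<Sum>a\<in>A. c a * complex_monomial a z)"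
    using polynomial_monomial_span[OF poly] unfolding monomial_span_def
    by (elim exE conjE)
  define B where "B = {a \<in> A. sum (fst a) UNIV = l \<and> sum (snd a) UNIV = l'}"
  have finB: "finite B" using A by (simp add: B_def)
  have pB: "p z = (\<Sum>a\<in>B. c a * complex_monomial a z)" for z
    unfolding B_def
  proof (rule bidegree_comparison[OF A(1), symmetric])
    fix t :: complex
    have "(\<Sum>a\<in>A. c a * complex_monomial a (t *s z)) = t ^ l * cnj t ^ l' * p z"
      using A(2) bihom by metis
    then show "(\<Sum>a\<in>A. c a * complex_monomial a z * (t ^ sum (fst a) UNIV * cnj t ^ sum (snd a) UNIV))
        = p z * (t ^ l * cnj t ^ l')"
      by (simp add: complex_monomial_scale mult_ac)
  qed
  define d where "d a = (if a \<in> B then c a else 0)" for a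
  \<comment> \<open>The exponent that remains after division by \<open>|z_i|^2\<close>.\<close>
  define r where "r a = ((fst a)(i := fst a i - 1), (snd a)(i := snd a i - 1))" for a :: "('n \<Rightarrow> nat) \<times> ('n \<Rightarrow> nat)"
  define q where "q z = (\<Sum>a\<in>B - ?G. c a * complex_monomial (r a) z)" for z
  have BG: "0 < fst a i" "0 < snd a i" "sum (fst a) UNIV = l" "sum (snd a) UNIV = l'" if "a \<in> B - ?G" for a
    using that by (auto simp: B_def reduced_indices_def)
  have mono: "complex_monomial a z = z $ i * cnj (z $ i) * complex_monomial (r a) z" if "a \<in> B - ?G" for a z
  proof -
    have "complex_monomial a z = (z $ i ^ fst a i * cnj (z $ i) ^ snd a i)
        * (\<Prod>j\<in>UNIV - {i}. z $ j ^ fst a j * cnj (z $ j) ^ snd a j)"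
      unfolding complex_monomial_def by (rule prod.remove) auto
    also have "(\<Prod>j\<in>UNIV - {i}. z $ j ^ fst a j * cnj (z $ j) ^ snd a j)
        = (\<Prod>j\<in>UNIV - {i}. z $ j ^ fst (r a) j * cnj (z $ j) ^ snd (r a) j)"
      by (rule prod.cong) (auto simp: r_def)
    also have "z $ i ^ fst a i * cnj (z $ i) ^ snd a i
        = z $ i * cnj (z $ i) * (z $ i ^ fst (r a) i * cnj (z $ i) ^ snd (r a) i)"
      using BG(1,2)[OF that] by (cases "fst a i"; cases "snd a i") (simp_all add: r_def)
    also have "\<dots> * (\<Prod>j\<in>UNIV - {i}. z $ j ^ fst (r a) j * cnj (z $ j) ^ snd (r a) j)
        = z $ i * cnj (z $ i) * complex_monomial (r a) z"
      unfolding complex_monomial_def mult.assoc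
      by (subst prod.remove[of UNIV i]) (simp_all only: finite UNIV_I mult.assoc)
    finally show ?thesis .
  qed
  have deg: "sum (f(i := f i - 1)) UNIV + 1 = sum f UNIV" if "0 < f i" for f :: "'n \<Rightarrow> nat"
  proof -
    have "sum (f(i := f i - 1)) (UNIV - {i}) = sum f (UNIV - {i})"
      by (rule sum.cong) auto
    then show ?thesis
      using that by (simp add: sum.remove[of UNIV i])
  qed
  have "polynomial_function q"
    unfolding q_def using finB
    by (intro polynomial_function_sum polynomial_mult polynomial_function_const
        polynomial_complex_monomial) simp
  moreover have "homogeneous (int l + int l' - 2) q"
    unfolding homogeneous_def
  proof (intro allI impI)
    fix t :: real and x :: "complex^'n" assume t: "0 < t"
    have "complex_monomial (r a) (t *\<^sub>R x) = of_real (t powi (int l + int l' - 2)) * complex_monomial (r a) x"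
      if a: "a \<in> B - ?G" for a
    proof -
      have "sum (fst (r a)) UNIV + 1 = l" "sum (snd (r a)) UNIV + 1 = l'"
        using deg[of "fst a"] deg[of "snd a"] BG[OF a] by (simp_all only: r_def fst_conv snd_conv)
      then have "int l + int l' - 2 = int (sum (fst (r a)) UNIV + sum (snd (r a)) UNIV)"
        by linarith
      then show ?thesis
        unfolding scaleR_eq_vector_scalar_mult complex_monomial_scale by (simp only: power_int_of_nat) (simp add: power_add)
    qed
    then show "q (t *\<^sub>R x) = of_real (t powi (int l + int l' - 2)) * q x"
      unfolding q_def sum_distrib_left by (intro sum.cong) (simp_all only: mult.left_commute)
  qed
  moreover have "p z = (\<Sum>a\<in>?G. d a * complex_monomial a z) + z $ i * cnj (z $ i) * q z" for z
  proof -
    have "p z = (\<Sum>a\<in>B \<inter> ?G. c a * complex_monomial a z) + (\<Sum>a\<in>B - ?G. c a * complex_monomial a z)"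
      unfolding pB using sum.Int_Diff[OF finB] .
    also have "(\<Sum>a\<in>B \<inter> ?G. c a * complex_monomial a z) = (\<Sum>a\<in>?G. d a * complex_monomial a z)"
      by (rule sum.mono_neutral_cong_left[OF fin]) (auto simp: d_def)
    also have "(\<Sum>a\<in>B - ?G. c a * complex_monomial a z) = z $ i * cnj (z $ i) * q z"
      unfolding q_def sum_distrib_left
      by (intro sum.cong refl) (simp only: mono mult.left_commute)
    finally show ?thesis .
  qed
  ultimately show ?thesis by blast
qed

text \<open>
  If the independent family were larger than the set of reduced monomials, some nontrivial combination
  \<open>P\<close> would have vanishing reduced part, that is \<open>P = |z_k|^2 R\<close>.  As \<open>R\<close> has lower degree, \<open>P\<close> is orthogonal
  to it, and \<open>\<integral> |z_k|^2 |R|^2 = 0\<close> forces \<open>P = 0\<close>.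
\<close>

theorem harmonic_dimension_bound:
  fixes e :: "'i \<Rightarrow> complex^'n \<Rightarrow> complex" and k :: 'n
  assumes fin: "finite (reduced_indices k l l')"
    and I: "finite I" and e: "\<forall>i\<in>I. bihomogeneous_harmonic_polynomial l l' (e i)"
    and indep: "\<And>x. \<forall>z. (\<Sum>i\<in>I. x i * e i z) = 0 \<Longrightarrow> \<forall>i\<in>I. x i = 0"
  shows "card I \<le> card (reduced_indices k l l')"
proof (rule ccontr)
  let ?G = "reduced_indices k l l'"
  assume "\<not> card I \<le> card ?G"
  define W where "W i F \<longleftrightarrow> polynomial_function (snd F) \<and> homogeneous (int l + int l' - 2) (snd F) \<and>
    (\<forall>z. e i z = (\<Sum>a\<in>?G. fst F a * complex_monomial a z) + z $ k * cnj (z $ k) * snd F z)" for i F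
  have "\<forall>i\<in>I. \<exists>F. W i F"
  proof
    fix i assume "i \<in> I"
    then have "polynomial_function (e i)" "\<forall>c z. e i (c *s z) = c ^ l * cnj c ^ l' * e i z"
      using e by (simp_all add: bihomogeneous_harmonic_polynomial_def)
    from bihomogeneous_reduction[OF this fin] obtain d q where "W i (d, q)"
      unfolding W_def fst_conv snd_conv by (elim exE)
    then show "\<exists>F. W i F" ..
  qed
  then obtain F where F: "\<forall>i\<in>I. W i (F i)"
    using bchoice[of I W] by blast
  define D where "D i = fst (F i)" for i
  define q where "q i = snd (F i)" for i
  have q: "\<forall>i\<in>I. polynomial_function (q i)" "\<forall>i\<in>I. homogeneous (int l + int l' - 2) (q i)"
    and e_eq: "\<forall>i\<in>I. \<forall>z. e i z = (\<Sum>a\<in>?G. D i a * complex_monomial a z) + z $ k * cnj (z $ k) * q i z"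
    using F by (simp_all add: W_def D_def q_def)
  obtain x where x: "\<exists>i\<in>I. x i \<noteq> 0" "\<forall>a\<in>?G. (\<Sum>i\<in>I. x i * D i a) = 0"
    using homogeneous_system_nontrivial[OF fin I, of D] \<open>\<not> card I \<le> card ?G\<close> by auto
  define P where "P = (\<lambda>z. \<Sum>i\<in>I. x i * e i z)"
  define R where "R = (\<lambda>z. \<Sum>i\<in>I. x i * q i z)"
  have P: "bihomogeneous_harmonic_polynomial l l' P"
    unfolding P_def by (rule bihomogeneous_sum[OF I e])
  have R: "polynomial_function R"
    unfolding R_def using q(1)
    by (intro polynomial_function_sum polynomial_mult polynomial_function_const I) blast
  have R_hom: "homogeneous (int l + int l' - 2) R"
    unfolding homogeneous_def
  proof (intro allI impI)
    fix t :: real and z assume t: "0 < t"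
    have "q i (t *\<^sub>R z) = of_real (t powi (int l + int l' - 2)) * q i z" if "i \<in> I" for i
      by (rule homogeneousD[OF bspec[OF q(2) that] t])
    then show "R (t *\<^sub>R z) = of_real (t powi (int l + int l' - 2)) * R z"
      unfolding R_def sum_distrib_left by (intro sum.cong) (simp_all only: mult.left_commute)
  qed
  have P_eq: "P z = z $ k * cnj (z $ k) * R z" for z
  proof -
    have "P z = (\<Sum>i\<in>I. \<Sum>a\<in>?G. x i * (D i a * complex_monomial a z))
        + (\<Sum>i\<in>I. x i * (z $ k * cnj (z $ k) * q i z))"
      unfolding P_def sum.distrib[symmetric]
      by (intro sum.cong refl) (simp only: e_eq distrib_left sum_distrib_left)
    also have "(\<Sum>i\<in>I. \<Sum>a\<in>?G. x i * (D i a * complex_monomial a z))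
        = (\<Sum>a\<in>?G. (\<Sum>i\<in>I. x i * D i a) * complex_monomial a z)"
      unfolding sum_distrib_right mult.assoc by (rule sum.swap)
    also have "\<dots> = 0"
      using x(2) by simp
    also have "(\<Sum>i\<in>I. x i * (z $ k * cnj (z $ k) * q i z)) = z $ k * cnj (z $ k) * R z"
      unfolding R_def sum_distrib_left by (intro sum.cong refl) (simp only: mult.left_commute)
    finally show ?thesis by simp
  qed
  have "sphere_inner P R = 0"
    by (rule harmonic_inner_lower_degree[OF P R R_hom]) simp
  then have "(LINT z|sphere_measure. complex_of_real ((norm (z $ k) * norm (R z))\<^sup>2)) = 0"
    unfolding sphere_inner_def P_eq mult.assoc complex_norm_square[symmetric] power_mult_distrib of_real_mult
      of_real_power complex_norm_square by (simp add: mult_ac)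
  then have int0: "(LINT z|sphere_measure. (norm (z $ k) * norm (R z))\<^sup>2) = 0"
    by (simp only: integral_complex_of_real of_real_eq_0_iff)
  have "P z = 0" if "z \<in> sphere 0 1" for z
  proof -
    have "(norm (z $ k) * norm (R z))\<^sup>2 = 0"
      by (rule continuous_sphere_integral_0_imp_0[where h = "\<lambda>z. (norm (z $ k) * norm (R z))\<^sup>2", OF _ _ int0 that])
        (auto intro!: continuous_intros continuous_on_polymonial_function[OF R])
    then show ?thesis by (auto simp: P_eq)
  qed
  then have "\<forall>z. P z = 0"
    using bihomogeneous_zero_on_sphere[OF P] by blast
  then show False
    using indep[of x] x(1) unfolding P_def by blast
qed

section \<open>Unitary maps and orthonormal bases\<close>

lemma dir_deriv_sum:
  fixes f :: "'i \<Rightarrow> 'a::euclidean_space \<Rightarrow> complex"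
  assumes "\<And>i. i \<in> I \<Longrightarrow> polynomial_function (f i)"
  shows "dir_deriv b (\<lambda>x. \<Sum>i\<in>I. c i * f i x) x = (\<Sum>i\<in>I. c i * dir_deriv b (f i) x)"
  by (rule dir_deriv_eqI)
    (rule has_derivative_sum, rule has_derivative_mult_right, rule polynomial_has_derivative, rule assms)

lemma polynomial_function_orthogonal_transformation:
  fixes p :: "'a::euclidean_space \<Rightarrow> complex" and U :: "'a \<Rightarrow> 'a"
  assumes p: "polynomial_function p" and U: "orthogonal_transformation U"
  shows "polynomial_function (\<lambda>x. p (U x))"
proof -
  have "polynomial_function U"
    using orthogonal_transformation_linear[OF U]
    by (simp add: polynomial_function_bounded_linear linear_conv_bounded_linear)
  from polynomial_function_compose[OF this p] show ?thesis
    by (simp add: o_def)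
qed

text \<open>
  The Laplacian is the trace of the second derivative, and the trace of a bilinear form is the same in
  every orthonormal basis; here the basis is the image of the standard one under \<open>U\<close>.
\<close>

lemma laplacian_orthogonal_transformation:
  fixes p :: "'a::euclidean_space \<Rightarrow> complex" and U :: "'a \<Rightarrow> 'a"
  assumes p: "polynomial_function p" and U: "orthogonal_transformation U"
  shows "laplacian (\<lambda>x. p (U x)) x = laplacian p (U x)"
proof -
  have dU: "(U has_derivative U) (at x)" for x
    using orthogonal_transformation_linear[OF U] by (rule linear_imp_has_derivative)
  have chain: "dir_deriv b (\<lambda>x. q (U x)) = (\<lambda>x. dir_deriv (U b) q (U x))"
    if "polynomial_function q" for b q
  proof
    fix x
    show "dir_deriv b (\<lambda>x. q (U x)) x = dir_deriv (U b) q (U x)"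
      by (rule dir_deriv_eqI[OF has_derivative_compose[OF dU polynomial_has_derivative[OF that]]])
  qed
  let ?D = "\<lambda>c d. dir_deriv c (dir_deriv d p) (U x)"
  have second: "dir_deriv v (dir_deriv v p) y
      = (\<Sum>c\<in>Basis. \<Sum>d\<in>Basis. of_real ((v \<bullet> c) * (v \<bullet> d)) * dir_deriv c (dir_deriv d p) y)"
    for v y
  proof -
    note pd = polynomial_dir_deriv[OF p]
    have "dir_deriv v p = (\<lambda>y. \<Sum>d\<in>Basis. of_real (v \<bullet> d) * dir_deriv d p y)"
      using dir_deriv_expand[OF p] by (rule ext)
    then have "dir_deriv c (dir_deriv v p) y
        = (\<Sum>d\<in>Basis. of_real (v \<bullet> d) * dir_deriv c (dir_deriv d p) y)" for c
      using dir_deriv_sum[of Basis "\<lambda>d. dir_deriv d p" c "\<lambda>d. of_real (v \<bullet> d)" y] pd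
      by simp
    then show ?thesis
      unfolding dir_deriv_expand[OF pd, of v v] by (simp add: sum_distrib_left mult_ac)
  qed
  have inner_sum: "(\<Sum>b\<in>Basis. (U b \<bullet> c) * (U b \<bullet> d)) = c \<bullet> d" for c d
  proof -
    obtain c' d' where "c = U c'" "d = U d'"
      using orthogonal_transformation_surj[OF U] by (metis surjD)
    then show ?thesis
      using U by (simp add: orthogonal_transformation_def euclidean_inner[of c' d'] inner_commute)
  qed
  have "laplacian (\<lambda>x. p (U x)) x = (\<Sum>b\<in>Basis. dir_deriv (U b) (dir_deriv (U b) p) (U x))"
    unfolding laplacian_dir_deriv chain[OF p]
      chain[OF polynomial_dir_deriv[OF p]] ..
  also have "\<dots> = (\<Sum>b\<in>Basis. \<Sum>c\<in>Basis. \<Sum>d\<in>Basis. of_real ((U b \<bullet> c) * (U b \<bullet> d)) * ?D c d)"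
    unfolding second ..
  also have "\<dots> = (\<Sum>c\<in>Basis. \<Sum>b\<in>Basis. \<Sum>d\<in>Basis. of_real ((U b \<bullet> c) * (U b \<bullet> d)) * ?D c d)"
    by (rule sum.swap)
  also have "\<dots> = (\<Sum>c\<in>Basis. \<Sum>d\<in>Basis. \<Sum>b\<in>Basis. of_real ((U b \<bullet> c) * (U b \<bullet> d)) * ?D c d)"
    by (rule sum.cong[OF refl], rule sum.swap)
  also have "\<dots> = (\<Sum>c\<in>Basis. \<Sum>d\<in>Basis. of_real (c \<bullet> d) * ?D c d)"
    unfolding sum_distrib_right[symmetric] of_real_sum[symmetric] inner_sum ..
  also have "\<dots> = (\<Sum>c\<in>Basis. \<Sum>d\<in>Basis. if d = c then ?D c c else 0)"
    by (intro sum.cong refl) (auto simp: inner_Basis)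
  also have "\<dots> = laplacian p (U x)"
    unfolding laplacian_dir_deriv by (intro sum.cong refl) simp
  finally show ?thesis .
qed

definition unitary_map :: "(complex^'n \<Rightarrow> complex^'n) \<Rightarrow> bool" where
  "unitary_map U \<longleftrightarrow> orthogonal_transformation U \<and> (\<forall>c z. U (c *s z) = c *s U z)"

lemma bihomogeneous_unitary:
  assumes p: "bihomogeneous_harmonic_polynomial l l' p" and U: "unitary_map U"
  shows "bihomogeneous_harmonic_polynomial l l' (\<lambda>z. p (U z))"
proof -
  have U': "orthogonal_transformation U" "\<forall>c z. U (c *s z) = c *s U z"
    using U by (simp_all add: unitary_map_def)
  note P = bihomogeneousD[OF p]
  show ?thesis
    unfolding bihomogeneous_harmonic_polynomial_def
    using polynomial_function_orthogonal_transformation[OF P(1) U'(1)] P(2,3) U'(2)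
    by (simp add: laplacian_orthogonal_transformation[OF P(1) U'(1)])
qed

definition hermitian_inner :: "complex^'n \<Rightarrow> complex^'n \<Rightarrow> complex" where
  "hermitian_inner x y = (\<Sum>i\<in>UNIV. x $ i * cnj (y $ i))"

lemma hermitian_inner_diff_scale:
  "hermitian_inner (x - c *s v) y = hermitian_inner x y - c * hermitian_inner v y"
  "hermitian_inner x (y - c *s v) = hermitian_inner x y - cnj c * hermitian_inner x v"
  by (simp_all add: hermitian_inner_def algebra_simps sum_subtractf sum_distrib_left)

lemma hermitian_inner_scale:
  "hermitian_inner (c *s x) y = c * hermitian_inner x y"
  "hermitian_inner x (c *s y) = cnj c * hermitian_inner x y"
  by (simp_all add: hermitian_inner_def sum_distrib_left mult_ac)

lemma hermitian_inner_cnj: "cnj (hermitian_inner x y) = hermitian_inner y x"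
  by (simp add: hermitian_inner_def mult.commute)

lemma hermitian_inner_self: "hermitian_inner x x = of_real ((norm x)\<^sup>2)"
proof -
  have "(norm x)\<^sup>2 = (\<Sum>i\<in>UNIV. (norm (x $ i))\<^sup>2)"
    by (simp add: norm_vec_def L2_set_def sum_nonneg)
  then show ?thesis
    unfolding hermitian_inner_def complex_norm_square[symmetric] by simp
qed

lemma unitary_map_norm_preserving:
  assumes add: "\<And>x y. U (x + y) = U x + U y" and scale: "\<And>c x. U (c *s x) = c *s U x"
    and norm: "\<And>x. hermitian_inner (U x) (U x) = hermitian_inner x x"
  shows "unitary_map U"
  unfolding unitary_map_def orthogonal_transformation
proof (intro conjI allI scale)
  show "linear U"
    by (rule linearI) (simp_all only: add scale scaleR_eq_vector_scalar_mult)
  fix v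
  have "(norm (U v))\<^sup>2 = (norm v)\<^sup>2"
    using norm[of v] unfolding hermitian_inner_self of_real_eq_iff .
  then show "norm (U v) = norm v" by simp
qed

lemma unitary_map_compose:
  "unitary_map U \<Longrightarrow> unitary_map V \<Longrightarrow> unitary_map (\<lambda>z. U (V z))"
  using orthogonal_transformation_compose[of U V] by (simp add: unitary_map_def o_def)

lemma unitary_map_scale: "norm c = 1 \<Longrightarrow> unitary_map (\<lambda>z. c *s z)"
  using orthogonal_transformation_complex_scale by (simp add: unitary_map_def vec_eq_iff mult_ac)

text \<open>
  The complex Householder reflection in the hyperplane orthogonal to \<open>v\<close>.
\<close>

lemma unitary_map_reflection:
  assumes v: "v \<noteq> 0"
  shows "unitary_map (\<lambda>x. x - (2 * hermitian_inner x v / of_real ((norm v)\<^sup>2)) *s v)"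
proof (rule unitary_map_norm_preserving)
  let ?n = "complex_of_real ((norm v)\<^sup>2)"
  have n: "?n \<noteq> 0" using v by simp
  fix x y :: "complex^'a" and c :: complex
  have *: "hermitian_inner (x + y) v = hermitian_inner x v + hermitian_inner y v"
    by (simp add: hermitian_inner_def distrib_right sum.distrib)
  show "x + y - (2 * hermitian_inner (x + y) v / ?n) *s v
      = x - (2 * hermitian_inner x v / ?n) *s v + (y - (2 * hermitian_inner y v / ?n) *s v)"
    unfolding * by (simp add: vec_eq_iff add_divide_distrib algebra_simps)
  show "c *s x - (2 * hermitian_inner (c *s x) v / ?n) *s v = c *s (x - (2 * hermitian_inner x v / ?n) *s v)"
    unfolding hermitian_inner_scale by (simp add: vec_eq_iff algebra_simps)
  let ?a = "hermitian_inner x v"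
  have "cnj (2 * ?a / ?n) = 2 * cnj ?a / ?n" by simp
  then show "hermitian_inner (x - (2 * ?a / ?n) *s v) (x - (2 * ?a / ?n) *s v) = hermitian_inner x x"
    unfolding hermitian_inner_diff_scale hermitian_inner_self[of v] hermitian_inner_cnj[of x v, symmetric]
    using n by (simp add: field_simps)
qed

text \<open>
  After multiplication of \<open>w\<close> by a unit number \<open>c\<close>, the inner product of \<open>z\<close> with \<open>c w\<close> is real.  The
  reflection in the hyperplane orthogonal to \<open>z - c w\<close> then interchanges \<open>z\<close> and \<open>c w\<close>, and the phase is
  removed afterwards.
\<close>

lemma unitary_map_transitive:
  assumes z: "norm z = 1" and w: "norm w = 1"
  obtains U where "unitary_map U" "U z = w"
proof -
  define a where "a = hermitian_inner z w"
  \<comment> \<open>The phase \<open>c\<close> makes \<open>cnj c * a\<close> equal to the real number \<open>|a|\<close>.\<close>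
  define c where "c = (if a = 0 then 1 else sgn a)"
  have nc: "norm c = 1" by (simp add: c_def norm_sgn)
  have cc: "cnj c * c = 1" using complex_norm_square[of c] by (simp add: nc mult.commute)
  have ca: "cnj c * a = of_real (norm a)"
  proof -
    have "a = of_real (norm a) * c" by (simp add: c_def sgn_eq)
    then have "cnj c * a = of_real (norm a) * (cnj c * c)" by (metis mult.left_commute)
    then show ?thesis by (simp add: cc)
  qed
  define v where "v = z - c *s w"
  have unphase: "unitary_map (\<lambda>z. cnj c *s z)"
    by (rule unitary_map_scale) (simp add: nc)
  have unphase_w: "cnj c *s (c *s w) = w"
    by (simp add: vec_eq_iff mult.assoc[symmetric] cc)
  show ?thesis
  proof (cases "v = 0")
    case True
    then have "z = c *s w" by (simp add: v_def)
    then show ?thesis using that[OF unphase] unphase_w by simp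
  next
    case False
    let ?R = "\<lambda>x. x - (2 * hermitian_inner x v / of_real ((norm v)\<^sup>2)) *s v"
    have zz: "hermitian_inner z z = 1" and ww: "hermitian_inner w w = 1"
      by (simp_all add: hermitian_inner_self z w)
    have zv: "hermitian_inner z v = 1 - of_real (norm a)"
      unfolding v_def hermitian_inner_diff_scale zz using ca by (simp add: a_def)
    have wz: "hermitian_inner w z = cnj a"
      by (simp add: a_def hermitian_inner_cnj)
    have "c * cnj a = of_real (norm a)"
      using arg_cong[OF ca, of cnj] by simp
    then have vv: "hermitian_inner v v = 2 - 2 * of_real (norm a)"
      unfolding v_def hermitian_inner_diff_scale hermitian_inner_scale zz ww wz using ca cc
      by (simp add: a_def[symmetric] algebra_simps)
    have "2 * hermitian_inner z v / of_real ((norm v)\<^sup>2) = 1"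
    proof -
      have "complex_of_real ((norm v)\<^sup>2) \<noteq> 0" using False by simp
      moreover have "2 * hermitian_inner z v = of_real ((norm v)\<^sup>2)"
        unfolding hermitian_inner_self[symmetric] vv zv by simp
      ultimately show ?thesis by simp
    qed
    then have "?R z = c *s w"
      by (simp add: v_def)
    then show ?thesis
      using that[OF unitary_map_compose[OF unphase unitary_map_reflection[OF False]]] unphase_w by simp
  qed
qed

lemma sphere_inner_unitary:
  assumes U: "unitary_map U" and cont: "continuous_on (sphere 0 1) f" "continuous_on (sphere 0 1) g"
  shows "sphere_inner (\<lambda>z. f (U z)) (\<lambda>z. g (U z)) = sphere_inner f g"
  unfolding sphere_inner_def
  by (rule integral_sphere_orthogonal_transformation[where g = "\<lambda>z. f z * cnj (g z)"])
    (use U in \<open>auto simp: unitary_map_def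
      intro!: borel_measurable_sphere_continuous continuous_on_mult continuous_on_cnj cont\<close>)

locale harmonic_basis =
  fixes l l' m :: nat and e :: "nat \<Rightarrow> complex^'n \<Rightarrow> complex"
  assumes basis: "i < m \<Longrightarrow> bihomogeneous_harmonic_polynomial l l' (e i)"
    and orthonormal: "i < m \<Longrightarrow> j < m \<Longrightarrow> sphere_inner (e i) (e j) = of_bool (i = j)"
    and expansion: "bihomogeneous_harmonic_polynomial l l' p \<Longrightarrow> p z = (\<Sum>i<m. sphere_inner p (e i) * e i z)"

lemma sphere_inner_cmult_left: "sphere_inner (\<lambda>z. c * f z) g = c * sphere_inner f g"
  by (simp add: sphere_inner_def mult.assoc)

lemma bihomogeneous_integrable:
  "bihomogeneous_harmonic_polynomial l l' p \<Longrightarrow> integrable sphere_measure p"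
  by (intro integrable_sphere_continuous bihomogeneousD(4))

text \<open>
  An orthonormal family is independent, so its length is at most the dimension bound and a longest one
  exists.  A polynomial not equal to its expansion in that family would, after subtraction of the
  expansion and normalisation, prolong the family.
\<close>

theorem harmonic_basis_exists:
  assumes dim: "2 \<le> CARD('n::finite)"
  obtains m and e :: "nat \<Rightarrow> complex^'n \<Rightarrow> complex"
  where "harmonic_basis l l' m e" "m \<le> (l + l' + 2) * ((l + 1) * (l' + 1)) ^ (CARD('n) - 2)"
proof -
  define ON where "ON m e \<longleftrightarrow> (\<forall>i<m. bihomogeneous_harmonic_polynomial l l' (e i)) \<and>
      (\<forall>i<m. \<forall>j<m. sphere_inner (e i) (e j) = of_bool (i = j))"
    for m and e :: "nat \<Rightarrow> complex^'n \<Rightarrow> complex"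
  let ?b = "(l + l' + 2) * ((l + 1) * (l' + 1)) ^ (CARD('n) - 2)"
  have bound: "m \<le> ?b" if "ON m e" for m e
  proof -
    have e: "bihomogeneous_harmonic_polynomial l l' (e i)" if "i < m" for i
      using \<open>ON m e\<close> that by (simp add: ON_def)
    have "card {..<m} \<le> card (reduced_indices (undefined :: 'n) l l')"
    proof (rule harmonic_dimension_bound)
      show "finite (reduced_indices (undefined :: 'n) l l')"
        by (rule reduced_indices_card[OF dim])
      show "finite {..<m}" "\<forall>i\<in>{..<m}. bihomogeneous_harmonic_polynomial l l' (e i)"
        using e by auto
      fix x assume x: "\<forall>z. (\<Sum>i<m. x i * e i z) = 0"
      show "\<forall>i\<in>{..<m}. x i = 0"
      proof
        fix j assume j: "j \<in> {..<m}"
        have "0 = sphere_inner (\<lambda>z. \<Sum>i<m. x i * e i z) (e j)"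
          using x by (simp add: sphere_inner_def)
        also have "\<dots> = (\<Sum>i<m. x i * sphere_inner (e i) (e j))"
          using e j by (intro sphere_inner_sum_left)
            (auto intro: bihomogeneous_integrable bihomogeneousD(4))
        also have "\<dots> = (\<Sum>i<m. if i = j then x j else 0)"
          using \<open>ON m e\<close> j by (intro sum.cong refl) (auto simp: ON_def)
        also have "\<dots> = x j" using j by simp
        finally show "x j = 0" by simp
      qed
    qed
    also have "\<dots> \<le> ?b"
      by (rule reduced_indices_card[OF dim])
    finally show ?thesis by simp
  qed
  have "ON 0 e" for e by (simp add: ON_def)
  then have "\<exists>m. (\<exists>e. ON m e) \<and> (\<forall>k. (\<exists>e. ON k e) \<longrightarrow> k \<le> m)"
    using bound Nat.ex_has_greatest_nat[of "\<lambda>m. \<exists>e. ON m e" 0 ?b] by blast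
  then obtain m e where me: "ON m e" and max: "\<And>k e. ON k e \<Longrightarrow> k \<le> m"
    by blast
  have e: "bihomogeneous_harmonic_polynomial l l' (e i)" if "i < m" for i
    using me that by (simp add: ON_def)
  have on: "sphere_inner (e i) (e j) = of_bool (i = j)" if "i < m" "j < m" for i j
    using me that by (simp add: ON_def)
  have "p z = (\<Sum>i<m. sphere_inner p (e i) * e i z)" if p: "bihomogeneous_harmonic_polynomial l l' p" for p z
  proof -
    define r where "r = (\<lambda>z. p z - (\<Sum>i<m. sphere_inner p (e i) * e i z))"
    have s: "bihomogeneous_harmonic_polynomial l l' (\<lambda>z. \<Sum>i<m. sphere_inner p (e i) * e i z)"
      using e by (intro bihomogeneous_sum) auto
    have r: "bihomogeneous_harmonic_polynomial l l' r"
      unfolding r_def by (rule bihomogeneous_diff[OF p s])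
    have re: "sphere_inner r (e j) = 0" if j: "j < m" for j
    proof -
      have cont: "continuous_on (sphere 0 1) (e j)"
        by (rule bihomogeneousD(4)[OF e[OF j]])
      have "sphere_inner (\<lambda>z. \<Sum>i<m. sphere_inner p (e i) * e i z) (e j)
          = (\<Sum>i<m. sphere_inner p (e i) * sphere_inner (e i) (e j))"
        by (rule sphere_inner_sum_left[OF _ _ cont]) (auto intro: bihomogeneous_integrable e)
      also have "\<dots> = (\<Sum>i<m. if i = j then sphere_inner p (e j) else 0)"
        using on j by (intro sum.cong refl) auto
      also have "\<dots> = sphere_inner p (e j)" using j by simp
      finally show ?thesis
        unfolding r_def sphere_inner_diff_left[OF bihomogeneous_integrable[OF p] bihomogeneous_integrable[OF s] cont]
        by simp
    qed
    have "sphere_inner r r = 0"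
    proof (rule ccontr)
      assume nz: "sphere_inner r r \<noteq> 0"
      define s where "s = (LINT z|sphere_measure. (norm (r z))\<^sup>2)"
      have rr: "sphere_inner r r = of_real s"
        unfolding s_def by (rule sphere_inner_self)
      have "0 \<le> s" unfolding s_def by (rule integral_nonneg_AE) simp
      with nz rr have s: "0 < s" by (cases "s = 0") auto
      \<comment> \<open>The normalised remainder would be one more orthonormal element.\<close>
      define u where "u = (\<lambda>z. complex_of_real (1 / sqrt s) * r z)"
      have u: "bihomogeneous_harmonic_polynomial l l' u"
        unfolding u_def by (rule bihomogeneous_cmult[OF r])
      have ue: "sphere_inner u (e j) = 0" if "j < m" for j
        unfolding u_def sphere_inner_cmult_left using re[OF that] by simp
      have eu: "sphere_inner (e j) u = 0" if "j < m" for j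
        using sphere_inner_cnj[of u "e j"] ue[OF that] by simp
      have ru: "sphere_inner r u = of_real (1 / sqrt s) * sphere_inner r r"
        using sphere_inner_cnj[of u r] sphere_inner_cnj[of r r]
        unfolding u_def sphere_inner_cmult_left by (metis complex_cnj_mult complex_cnj_complex_of_real)
      have "sphere_inner u u = of_real ((1 / sqrt s) * ((1 / sqrt s) * s))"
      proof -
        have "sphere_inner u u = of_real (1 / sqrt s) * sphere_inner r u"
          by (subst (1) u_def) (rule sphere_inner_cmult_left)
        then show ?thesis
          by (simp only: ru rr of_real_mult)
      qed
      also have "(1 / sqrt s) * ((1 / sqrt s) * s) = 1"
        using s by (simp add: field_simps)
      finally have uu: "sphere_inner u u = 1" by simp
      have "ON (Suc m) (e(m := u))"
        unfolding ON_def
        using e on u uu ue eu by (auto simp: less_Suc_eq)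
      then show False
        using max by fastforce
    qed
    then have "r z = 0"
      by (rule bihomogeneous_inner_self_eq_0[OF r])
    then show ?thesis
      by (simp add: r_def)
  qed
  with e on have "harmonic_basis l l' m e"
    by (unfold_locales)
  then show ?thesis
    using that bound[OF me] by blast
qed

section \<open>Reproducing kernels and the bound from L1 to L2\<close>

lemma square_integrable_imp_integrable_sphere:
  assumes "square_integrable sphere_measure f"
  shows "integrable sphere_measure f"
proof (rule Bochner_Integration.integrable_bound)
  show "integrable sphere_measure (\<lambda>x. 1 + (norm (f x))\<^sup>2)"
    using assms by (intro Bochner_Integration.integrable_add) (auto simp: square_integrable_def)
  show "f \<in> borel_measurable sphere_measure"
    using assms by (simp add: square_integrable_def)
  have "norm (f x) \<le> norm (1 + (norm (f x))\<^sup>2)" for x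
  proof -
    have "0 \<le> (norm (f x) - 1)\<^sup>2 + norm (f x)" by simp
    then have "norm (f x) \<le> 1 + (norm (f x))\<^sup>2" by (simp add: power2_diff)
    also have "\<dots> \<le> norm (1 + (norm (f x))\<^sup>2)"
      unfolding real_norm_def by (rule abs_ge_self)
    finally show ?thesis .
  qed
  then show "AE x in sphere_measure. norm (f x) \<le> norm (1 + (norm (f x))\<^sup>2)"
    by (intro AE_I2)
qed

lemma sphere_measure_total_positive: "0 < measure sphere_measure (sphere (0 :: 'a::euclidean_space) 1)"
proof (rule ccontr)
  assume "\<not> ?thesis"
  then have "measure sphere_measure (sphere (0 :: 'a) 1) = 0"
    using measure_nonneg[of sphere_measure "sphere (0 :: 'a) 1"] by linarith
  then have "(LINT z|sphere_measure. (\<lambda>z::'a. 1 :: real) z) = 0"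
    by simp
  moreover obtain b :: 'a where "b \<in> Basis" using nonempty_Basis by blast
  then have "b \<in> sphere 0 1" by simp
  ultimately have "(1::real) = 0"
    using continuous_sphere_integral_0_imp_0[of "\<lambda>_::'a. 1 :: real" b] by simp
  then show False by simp
qed

lemma norm_sphere_integral_le:
  fixes f g :: "'a::euclidean_space \<Rightarrow> complex"
  assumes f: "integrable sphere_measure f" and g: "continuous_on (sphere 0 1) g"
    and B: "\<And>z. z \<in> sphere 0 1 \<Longrightarrow> norm (g z) \<le> B"
  shows "norm (LINT z|sphere_measure. g z * f z) \<le> B * L1_norm sphere_measure f"
proof -
  have int: "integrable sphere_measure (\<lambda>z. g z * f z)"
    using integrable_sphere_mult[OF f g] by (simp add: mult.commute)
  have "norm (LINT z|sphere_measure. g z * f z) \<le> (LINT z|sphere_measure. norm (g z * f z))"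
    by (rule integral_norm_bound)
  also have "\<dots> \<le> (LINT z|sphere_measure. B * norm (f z))"
  proof (rule integral_mono)
    show "integrable sphere_measure (\<lambda>z. norm (g z * f z))"
      using int by (rule integrable_norm)
    show "integrable sphere_measure (\<lambda>z. B * norm (f z))"
      using f by (intro integrable_mult_right integrable_norm)
    fix z :: 'a assume "z \<in> space sphere_measure"
    then show "norm (g z * f z) \<le> B * norm (f z)"
      using B[of z] by (simp add: norm_mult mult_right_mono)
  qed
  also have "\<dots> = B * L1_norm sphere_measure f"
    by (simp add: L1_norm_def)
  finally show ?thesis .
qed

lemma norm_sum_mult_squared_le:
  fixes a b :: "'i \<Rightarrow> complex"
  shows "(norm (\<Sum>i\<in>I. a i * b i))\<^sup>2 \<le> (\<Sum>i\<in>I. (norm (a i))\<^sup>2) * (\<Sum>i\<in>I. (norm (b i))\<^sup>2)"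
proof -
  have "norm (\<Sum>i\<in>I. a i * b i) \<le> (\<Sum>i\<in>I. norm (a i) * norm (b i))"
    using norm_sum[of "\<lambda>i. a i * b i" I] by (simp add: norm_mult)
  then have "(norm (\<Sum>i\<in>I. a i * b i))\<^sup>2 \<le> (\<Sum>i\<in>I. norm (a i) * norm (b i))\<^sup>2"
    by (rule power_mono) simp
  also have "\<dots> \<le> (\<Sum>i\<in>I. (norm (a i))\<^sup>2) * (\<Sum>i\<in>I. (norm (b i))\<^sup>2)"
    by (rule Cauchy_Schwarz_ineq_sum)
  finally show ?thesis .
qed

text \<open>
  The representative used by \<open>harmonic_space\<close>: zero off the sphere.
\<close>

definition sphere_restrict :: "('a::real_normed_vector \<Rightarrow> complex) \<Rightarrow> 'a \<Rightarrow> complex" where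
  "sphere_restrict p z = (if z \<in> sphere 0 1 then p z else 0)"

lemma harmonic_space_alt:
  "harmonic_space l l' = {sphere_restrict p | p. bihomogeneous_harmonic_polynomial l l' p}"
  by (simp add: harmonic_space_def sphere_restrict_def[abs_def])

lemma harmonic_spaceD:
  assumes "h \<in> harmonic_space l l'"
  shows "\<exists>p. bihomogeneous_harmonic_polynomial l l' p \<and> h = sphere_restrict p"
  using assms unfolding harmonic_space_alt by blast

lemma harmonic_spaceI:
  assumes "bihomogeneous_harmonic_polynomial l l' p"
  shows "sphere_restrict p \<in> harmonic_space l l'"
  using assms unfolding harmonic_space_alt by blast

context harmonic_basis
begin

lemma cont: "i < m \<Longrightarrow> continuous_on S (e i)"
  by (rule bihomogeneousD(4)[OF basis])

definition proj :: "(complex^'n \<Rightarrow> complex) \<Rightarrow> complex^'n \<Rightarrow> complex" where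
  "proj f z = (\<Sum>i<m. sphere_inner f (e i) * e i z)"

definition reproducing_kernel :: "complex^'n \<Rightarrow> complex^'n \<Rightarrow> complex" where
  "reproducing_kernel z w = (\<Sum>i<m. e i z * cnj (e i w))"

definition diagonal :: "complex^'n \<Rightarrow> real" where
  "diagonal z = (\<Sum>i<m. (norm (e i z))\<^sup>2)"

lemma combination_bihomogeneous:
  "bihomogeneous_harmonic_polynomial l l' (\<lambda>z. \<Sum>i<m. c i * e i z)"
  using basis by (intro bihomogeneous_sum) auto

lemma proj_bihomogeneous: "bihomogeneous_harmonic_polynomial l l' (proj f)"
  unfolding proj_def[abs_def] by (rule combination_bihomogeneous)

lemma inner_combination:
  assumes f: "integrable sphere_measure f"
  shows "sphere_inner f (\<lambda>z. \<Sum>i<m. c i * e i z) = (\<Sum>i<m. cnj (c i) * sphere_inner f (e i))"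
proof -
  have int: "integrable sphere_measure (\<lambda>z. f z * cnj (e i z))" if "i < m" for i
    using that by (intro integrable_sphere_mult f continuous_on_cnj cont)
  have "sphere_inner f (\<lambda>z. \<Sum>i<m. c i * e i z)
      = (LINT z|sphere_measure. (\<Sum>i<m. cnj (c i) * (f z * cnj (e i z))))"
    by (simp add: sphere_inner_def sum_distrib_left mult_ac)
  also have "\<dots> = (\<Sum>i<m. LINT z|sphere_measure. cnj (c i) * (f z * cnj (e i z)))"
    by (rule Bochner_Integration.integral_sum) (rule integrable_mult_right, rule int, simp)
  also have "\<dots> = (\<Sum>i<m. cnj (c i) * sphere_inner f (e i))"
    by (simp add: sphere_inner_def)
  finally show ?thesis .
qed

lemma combination_coefficient:
  assumes j: "j < m"
  shows "sphere_inner (\<lambda>z. \<Sum>i<m. c i * e i z) (e j) = c j"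
proof -
  have "sphere_inner (\<lambda>z. \<Sum>i<m. c i * e i z) (e j) = (\<Sum>i<m. c i * sphere_inner (e i) (e j))"
    by (rule sphere_inner_sum_left[OF _ _ cont[OF j]]) (auto intro: bihomogeneous_integrable basis)
  also have "\<dots> = (\<Sum>i<m. if i = j then c j else 0)"
    using orthonormal j by (intro sum.cong refl) auto
  finally show ?thesis using j by simp
qed

lemma combination_norm:
  "(LINT z|sphere_measure. (norm (\<Sum>i<m. c i * e i z))\<^sup>2) = (\<Sum>i<m. (norm (c i))\<^sup>2)"
proof -
  have "complex_of_real (LINT z|sphere_measure. (norm (\<Sum>i<m. c i * e i z))\<^sup>2)
      = (\<Sum>i<m. cnj (c i) * c i)"
    unfolding sphere_inner_self[symmetric] inner_combination[OF bihomogeneous_integrable[OF combination_bihomogeneous]]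
    by (simp add: combination_coefficient)
  also have "\<dots> = complex_of_real (\<Sum>i<m. (norm (c i))\<^sup>2)"
    unfolding of_real_sum by (intro sum.cong refl) (simp add: complex_norm_square mult.commute del: of_real_power)
  finally show ?thesis
    unfolding of_real_eq_iff .
qed

text \<open>
  Expand \<open>p\<close> in the basis and use Cauchy-Schwarz and Parseval.  Equality holds for the kernel function of
  the point, which is what makes \<open>diagonal z\<close> the squared norm of evaluation at \<open>z\<close>.
\<close>

lemma evaluation_bound:
  assumes p: "bihomogeneous_harmonic_polynomial l l' p"
  shows "(norm (p z))\<^sup>2 \<le> (LINT z|sphere_measure. (norm (p z))\<^sup>2) * diagonal z"
proof -
  define c where "c i = sphere_inner p (e i)" for i
  have p_eq: "p z = (\<Sum>i<m. c i * e i z)" for z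
    unfolding c_def by (rule expansion[OF p])
  show ?thesis
    unfolding p_eq combination_norm diagonal_def by (rule norm_sum_mult_squared_le)
qed

lemma diagonal_nonneg: "0 \<le> diagonal z"
  by (simp add: diagonal_def sum_nonneg)

text \<open>
  Apply \<open>evaluation_bound\<close> to \<open>p = q \<circ> U\<close>, with \<open>q\<close> the kernel function of the point \<open>U z\<close>: both
  \<open>q (U z)\<close> and the squared norm of \<open>q\<close>, hence of \<open>p\<close>, are equal to \<open>diagonal (U z)\<close>.
\<close>

lemma diagonal_unitary_le:
  assumes U: "unitary_map U"
  shows "diagonal (U z) \<le> diagonal z"
proof -
  \<comment> \<open>The kernel function of the point \<open>U z\<close>.\<close>
  define q where "q = (\<lambda>y. \<Sum>i<m. cnj (e i (U z)) * e i y)"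
  have q: "bihomogeneous_harmonic_polynomial l l' q"
    unfolding q_def by (rule combination_bihomogeneous)
  have norm_q: "(LINT y|sphere_measure. (norm (q y))\<^sup>2) = diagonal (U z)"
    unfolding q_def combination_norm by (simp add: diagonal_def)
  have qU: "q (U z) = of_real (diagonal (U z))"
    unfolding q_def diagonal_def of_real_sum
    by (intro sum.cong refl) (simp add: complex_norm_square mult.commute del: of_real_power)
  define p where "p = (\<lambda>y. q (U y))"
  have p: "bihomogeneous_harmonic_polynomial l l' p"
    unfolding p_def by (rule bihomogeneous_unitary[OF q U])
  have "complex_of_real (LINT y|sphere_measure. (norm (p y))\<^sup>2) = of_real (LINT y|sphere_measure. (norm (q y))\<^sup>2)"
    unfolding sphere_inner_self[symmetric] p_def
    by (rule sphere_inner_unitary[OF U]) (rule bihomogeneousD(4)[OF q])+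
  then have norm_p: "(LINT y|sphere_measure. (norm (p y))\<^sup>2) = diagonal (U z)"
    unfolding of_real_eq_iff norm_q .
  have "(diagonal (U z))\<^sup>2 = (norm (p z))\<^sup>2"
    unfolding p_def qU by simp
  also have "\<dots> \<le> diagonal (U z) * diagonal z"
    using evaluation_bound[OF p, of z] unfolding norm_p .
  finally have "diagonal (U z) * diagonal (U z) \<le> diagonal (U z) * diagonal z"
    by (simp add: power2_eq_square)
  then show ?thesis
    using diagonal_nonneg[of "U z"] diagonal_nonneg[of z] by (cases "diagonal (U z) = 0") auto
qed

definition density :: real where
  "density = real m / measure sphere_measure (sphere (0 :: complex^'n) 1)"

text \<open>
  By transitivity of the unitary group the diagonal is constant on the sphere, and its integral is the
  sum of the squared norms of the basis elements.
\<close>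

lemma diagonal_eq:
  assumes z: "z \<in> sphere 0 1"
  shows "diagonal z = density"
proof -
  have le: "diagonal w \<le> diagonal z" if "w \<in> sphere 0 1" "z \<in> sphere 0 1" for w z
  proof -
    have "norm z = 1" "norm w = 1"
      using that by simp_all
    then obtain U where "unitary_map U" "U z = w"
      by (rule unitary_map_transitive)
    then show ?thesis using diagonal_unitary_le[of U z] by simp
  qed
  have const: "diagonal w = diagonal z" if "w \<in> sphere 0 1" for w
    using le[OF that z] le[OF z that] by (rule antisym)
  have norm_e: "(LINT w|sphere_measure. (norm (e i w))\<^sup>2) = 1" if "i < m" for i
    using orthonormal[OF that that] unfolding sphere_inner_self by simp
  have "measure sphere_measure (sphere (0 :: complex^'n) 1) * diagonal z = (LINT w|(sphere_measure :: (complex^'n) measure). diagonal z)"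
    by simp
  also have "\<dots> = (LINT w|sphere_measure. diagonal w)"
    by (rule Bochner_Integration.integral_cong[OF refl]) (rule const[symmetric], simp)
  also have "\<dots> = (\<Sum>i<m. LINT w|sphere_measure. (norm (e i w))\<^sup>2)"
    unfolding diagonal_def
    by (rule Bochner_Integration.integral_sum) (auto intro!: integrable_sphere_continuous continuous_intros cont)
  also have "\<dots> = real m"
    by (simp add: norm_e)
  finally show ?thesis
    using sphere_measure_total_positive[where 'a = "complex^'n"]
    unfolding density_def by (simp add: eq_divide_eq mult.commute)
qed

lemma kernel_bound:
  assumes z: "z \<in> sphere 0 1" and w: "w \<in> sphere 0 1"
  shows "norm (reproducing_kernel z w) \<le> density"
proof -
  have "(\<Sum>i<m. (norm (cnj (e i w)))\<^sup>2) = diagonal w"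
    unfolding diagonal_def complex_mod_cnj ..
  then have "(norm (reproducing_kernel z w))\<^sup>2 \<le> diagonal z * diagonal w"
    using norm_sum_mult_squared_le[where I = "{..<m}" and a = "\<lambda>i. e i z" and b = "\<lambda>i. cnj (e i w)"]
    unfolding reproducing_kernel_def diagonal_def[of z] by metis
  also have "\<dots> = density\<^sup>2"
    unfolding diagonal_eq[OF z] diagonal_eq[OF w] by (rule power2_eq_square[symmetric])
  finally show ?thesis
    by (rule power2_le_imp_le) (simp add: density_def)
qed

lemma kernel_continuous: "continuous_on S (\<lambda>w. reproducing_kernel z w)"
  unfolding reproducing_kernel_def by (intro continuous_on_sum continuous_on_mult continuous_on_const continuous_on_cnj cont) simp

lemma kernel_integral:
  assumes f: "integrable sphere_measure f"
  shows "(LINT w|sphere_measure. reproducing_kernel z w * f w) = proj f z"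
proof -
  have int: "integrable sphere_measure (\<lambda>w. f w * cnj (e i w))" if "i < m" for i
    using that by (intro integrable_sphere_mult f continuous_on_cnj cont)
  have "(LINT w|sphere_measure. reproducing_kernel z w * f w)
      = (LINT w|sphere_measure. (\<Sum>i<m. e i z * (f w * cnj (e i w))))"
    by (simp add: reproducing_kernel_def sum_distrib_left sum_distrib_right mult_ac)
  also have "\<dots> = (\<Sum>i<m. LINT w|sphere_measure. e i z * (f w * cnj (e i w)))"
    by (rule Bochner_Integration.integral_sum) (rule integrable_mult_right, rule int, simp)
  also have "\<dots> = proj f z"
    by (simp add: proj_def sphere_inner_def mult.commute)
  finally show ?thesis .
qed

lemma proj_bound:
  assumes f: "integrable sphere_measure f" and z: "z \<in> sphere 0 1"
  shows "norm (proj f z) \<le> density * L1_norm sphere_measure f"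
  unfolding kernel_integral[OF f, symmetric]
  by (rule norm_sphere_integral_le[OF f kernel_continuous]) (rule kernel_bound[OF z])

text \<open>
  \<open>\<parallel>\<pi> f\<parallel>^2 = <f, \<pi> f> \<le> \<parallel>f\<parallel>_1 sup |\<pi> f|\<close>, and the supremum is at most \<open>density \<cdot> \<parallel>f\<parallel>_1\<close> because the kernel is
  bounded by \<open>density\<close>.
\<close>

lemma proj_L2_bound:
  assumes f: "integrable sphere_measure f"
  shows "(LINT z|sphere_measure. (norm (proj f z))\<^sup>2) \<le> density * (L1_norm sphere_measure f)\<^sup>2"
proof -
  have "complex_of_real (LINT z|sphere_measure. (norm (proj f z))\<^sup>2) = (\<Sum>i<m. cnj (sphere_inner f (e i)) * sphere_inner f (e i))"
    unfolding proj_def combination_norm of_real_sum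
    by (intro sum.cong refl) (simp add: complex_norm_square mult.commute del: of_real_power)
  also have "\<dots> = sphere_inner f (proj f)"
    unfolding proj_def[abs_def] inner_combination[OF f] ..
  finally have eq: "complex_of_real (LINT z|sphere_measure. (norm (proj f z))\<^sup>2) = sphere_inner f (proj f)" .
  have "(LINT z|sphere_measure. (norm (proj f z))\<^sup>2) \<le> norm (sphere_inner f (proj f))"
    unfolding eq[symmetric] by simp
  also have "sphere_inner f (proj f) = (LINT z|sphere_measure. cnj (proj f z) * f z)"
    by (simp add: sphere_inner_def mult.commute)
  also have "norm \<dots> \<le> (density * L1_norm sphere_measure f) * L1_norm sphere_measure f"
    by (rule norm_sphere_integral_le[OF f])
      (use proj_bound[OF f] bihomogeneousD(4)[OF proj_bihomogeneous]
        in \<open>auto intro: continuous_on_cnj\<close>)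
  finally show ?thesis
    by (simp add: power2_eq_square mult.assoc)
qed

lemma harmonic_proj_L2_eq:
  assumes "square_integrable sphere_measure f"
  shows "harmonic_proj_L2 l l' f = sphere_restrict (proj f)"
  unfolding harmonic_proj_L2_def
proof (rule the_equality)
  have f: "integrable sphere_measure f"
    by (rule square_integrable_imp_integrable_sphere[OF assms])
  have restrict: "(LINT z|sphere_measure. (f z - sphere_restrict p z) * cnj (sphere_restrict h z))
      = sphere_inner f h - sphere_inner p h"
    if "bihomogeneous_harmonic_polynomial l l' p" "bihomogeneous_harmonic_polynomial l l' h" for p h
  proof -
    have "(LINT z|sphere_measure. (f z - sphere_restrict p z) * cnj (sphere_restrict h z))
        = sphere_inner (\<lambda>z. f z - p z) h"
      unfolding sphere_inner_def by (rule Bochner_Integration.integral_cong) (simp_all add: sphere_restrict_def)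
    then show ?thesis
      using sphere_inner_diff_left[OF f bihomogeneous_integrable[OF that(1)] bihomogeneousD(4)[OF that(2)]]
      by simp
  qed
  have inner_proj: "sphere_inner (proj f) h = sphere_inner f h"
    if h: "bihomogeneous_harmonic_polynomial l l' h" for h
  proof -
    define c where "c i = sphere_inner h (e i)" for i
    have "h z = (\<Sum>i<m. c i * e i z)" for z
      unfolding c_def by (rule expansion[OF h])
    then have h_eq: "h = (\<lambda>z. \<Sum>i<m. c i * e i z)" by (rule ext)
    show ?thesis
      unfolding h_eq inner_combination[OF f] inner_combination[OF bihomogeneous_integrable[OF proj_bihomogeneous]]
      by (simp add: proj_def[abs_def] combination_coefficient)
  qed
  show "sphere_restrict (proj f) \<in> harmonic_space l l' \<and>
      (\<forall>h\<in>harmonic_space l l'. (LINT z|sphere_measure. (f z - sphere_restrict (proj f) z) * cnj (h z)) = 0)"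
  proof (intro conjI ballI)
    show "sphere_restrict (proj f) \<in> harmonic_space l l'"
      by (rule harmonic_spaceI[OF proj_bihomogeneous])
    fix h :: "complex^'n \<Rightarrow> complex" assume "h \<in> harmonic_space l l'"
    from harmonic_spaceD[OF this]
    obtain h' where h': "bihomogeneous_harmonic_polynomial l l' h'" and hh: "h = sphere_restrict h'"
      by blast
    have "(LINT z|sphere_measure. (f z - sphere_restrict (proj f) z) * cnj (sphere_restrict h' z)) = 0"
    proof -
      have 1: "sphere_inner (proj f) h' = sphere_inner f h'"
        by (rule inner_proj[OF h'])
      have 2: "(LINT z|sphere_measure. (f z - sphere_restrict (proj f) z) * cnj (sphere_restrict h' z))
          = sphere_inner f h' - sphere_inner (proj f) h'"
        by (rule restrict[OF proj_bihomogeneous[of f] h'])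
      show ?thesis
        unfolding 2 1 by (rule diff_self)
    qed
    then show "(LINT z|sphere_measure. (f z - sphere_restrict (proj f) z) * cnj (h z)) = 0"
      by (simp only: hh)
  qed
  fix g :: "complex^'n \<Rightarrow> complex"
  assume g: "g \<in> harmonic_space l l' \<and>
      (\<forall>h\<in>harmonic_space l l'. (LINT z|sphere_measure. (f z - g z) * cnj (h z)) = 0)"
  obtain p where p: "bihomogeneous_harmonic_polynomial l l' p" and gp: "g = sphere_restrict p"
    using harmonic_spaceD[OF conjunct1[OF g]] by blast
  define d where "d = (\<lambda>z. proj f z - p z)"
  have d: "bihomogeneous_harmonic_polynomial l l' d"
    unfolding d_def by (rule bihomogeneous_diff[OF proj_bihomogeneous p])
  have "sphere_restrict d \<in> harmonic_space l l'"
    by (rule harmonic_spaceI[OF d])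
  from bspec[OF conjunct2[OF g] this] have fp: "sphere_inner f d - sphere_inner p d = 0"
    unfolding gp restrict[OF p d] .
  have "sphere_inner d d = sphere_inner (proj f) d - sphere_inner p d"
    by (subst (1) d_def)
      (rule sphere_inner_diff_left[OF bihomogeneous_integrable[OF proj_bihomogeneous] bihomogeneous_integrable[OF p]
        bihomogeneousD(4)[OF d]])
  then have dd: "sphere_inner d d = 0"
    using fp inner_proj[OF d] by simp
  have d0: "d z = 0" for z
    by (rule bihomogeneous_inner_self_eq_0[OF d dd])
  show "g = sphere_restrict (proj f)"
  proof
    fix z
    show "g z = sphere_restrict (proj f) z"
      using d0[of z] unfolding gp d_def sphere_restrict_def by simp
  qed
qed

text \<open>
  For uniqueness, let \<open>h\<close> be the difference of two kernels at a fixed first argument.  Testing against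
  \<open>cnj h\<close> shows that \<open>\<integral> |h|^2 = 0\<close>, and \<open>h\<close> is continuous.
\<close>

lemma harmonic_kernel_eq:
  "harmonic_kernel l l' = (\<lambda>z w. if z \<in> sphere 0 1 \<and> w \<in> sphere 0 1 then reproducing_kernel z w else 0)"
    (is "_ = ?K")
  unfolding harmonic_kernel_def
proof (rule the_equality)
  have cong: "(LINT w|sphere_measure. ?K z w * f w) = (LINT w|sphere_measure. reproducing_kernel z w * f w)"
    if "z \<in> sphere 0 1" for z f
    using that by (intro Bochner_Integration.integral_cong) simp_all
  have repr: "harmonic_proj_L2 l l' f z = (LINT w|sphere_measure. ?K z w * f w)"
    if "square_integrable sphere_measure f" "z \<in> sphere 0 1" for f z
    using kernel_integral[OF square_integrable_imp_integrable_sphere[OF that(1)], of z] that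
    unfolding cong[OF that(2)] harmonic_proj_L2_eq[OF that(1)] by (simp add: sphere_restrict_def)
  have "continuous_on (sphere 0 1 \<times> sphere 0 1) (\<lambda>x. reproducing_kernel (fst x) (snd x))"
    unfolding reproducing_kernel_def
    by (intro continuous_on_sum continuous_on_mult continuous_on_cnj
        continuous_on_compose2[OF cont[where S = UNIV]] continuous_intros) auto
  then have "continuous_on (sphere 0 1 \<times> sphere 0 1) (\<lambda>(z, w). ?K z w)"
    by (rule continuous_on_eq) auto
  then show "continuous_on (sphere 0 1 \<times> sphere 0 1) (\<lambda>(z, w). ?K z w) \<and>
      (\<forall>z w. z \<notin> sphere 0 1 \<or> w \<notin> sphere 0 1 \<longrightarrow> ?K z w = 0) \<and>
      (\<forall>f. square_integrable sphere_measure f \<longrightarrow>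
        (\<forall>z\<in>sphere 0 1. harmonic_proj_L2 l l' f z = (LINT w|sphere_measure. ?K z w * f w)))"
    using repr by (intro conjI allI impI ballI) auto
  fix L :: "complex^'n \<Rightarrow> complex^'n \<Rightarrow> complex"
  assume L: "continuous_on (sphere 0 1 \<times> sphere 0 1) (\<lambda>(z, w). L z w) \<and>
      (\<forall>z w. z \<notin> sphere 0 1 \<or> w \<notin> sphere 0 1 \<longrightarrow> L z w = 0) \<and>
      (\<forall>f. square_integrable sphere_measure f \<longrightarrow>
        (\<forall>z\<in>sphere 0 1. harmonic_proj_L2 l l' f z = (LINT w|sphere_measure. L z w * f w)))"
  have eq: "L z w = reproducing_kernel z w" if z: "z \<in> sphere 0 1" and w: "w \<in> sphere 0 1" for z w
  proof -
    have "continuous_on (sphere 0 1) (\<lambda>w. (\<lambda>(z, w). L z w) (z, w))"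
      by (rule continuous_on_compose2[OF conjunct1[OF L]]) (use z in \<open>auto intro: continuous_intros\<close>)
    then have contL: "continuous_on (sphere 0 1) (L z)" by simp
    define h where "h = (\<lambda>w. L z w - reproducing_kernel z w)"
    have cont_h: "continuous_on (sphere 0 1) h"
      unfolding h_def by (intro continuous_on_diff contL kernel_continuous)
    define f where "f = (\<lambda>w. cnj (h w))"
    have cont_f: "continuous_on (sphere 0 1) f"
      unfolding f_def by (intro continuous_on_cnj cont_h)
    have f: "square_integrable sphere_measure f"
      unfolding square_integrable_def
      by (intro conjI borel_measurable_sphere_continuous integrable_sphere_continuous continuous_on_power
          continuous_on_norm cont_f)
    have int: "integrable sphere_measure f"
      by (rule integrable_sphere_continuous[OF cont_f])
    have same: "(LINT w|sphere_measure. L z w * f w) = (LINT w|sphere_measure. reproducing_kernel z w * f w)"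
      using bspec[OF spec[OF conjunct2[OF conjunct2[OF L]], THEN mp, OF f] z]
    unfolding repr[OF f z] cong[OF z] by (rule sym)
    have "integrable sphere_measure (\<lambda>w. L z w * f w)" "integrable sphere_measure (\<lambda>w. reproducing_kernel z w * f w)"
      using integrable_sphere_mult[OF int contL] integrable_sphere_mult[OF int kernel_continuous]
      by (simp_all add: mult.commute)
    from Bochner_Integration.integral_diff[OF this]
    have "(LINT w|sphere_measure. L z w * f w - reproducing_kernel z w * f w) = 0"
      unfolding same by simp
    then have "sphere_inner h h = 0"
      by (simp add: sphere_inner_def f_def h_def left_diff_distrib)
    then have "h w = 0"
      by (rule sphere_inner_self_eq_0[OF cont_h _ w])
    then show ?thesis by (simp add: h_def)
  qed
  show "L = ?K"
  proof (intro ext)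
    fix z w
    show "L z w = ?K z w"
    proof (cases "z \<in> sphere 0 1 \<and> w \<in> sphere 0 1")
      case True
      then show ?thesis using eq by simp
    next
      case False
      then have "L z w = 0"
        using conjunct1[OF conjunct2[OF L]] by blast
      then show ?thesis unfolding if_not_P[OF False] .
    qed
  qed
qed

lemma harmonic_proj_eq:
  assumes f: "integrable sphere_measure f"
  shows "harmonic_proj l l' f = sphere_restrict (proj f)"
proof
  fix z
  have "(LINT w|sphere_measure. harmonic_kernel l l' z w * f w)
      = (LINT w|sphere_measure. (if z \<in> sphere 0 1 then reproducing_kernel z w * f w else 0))"
    unfolding harmonic_kernel_eq by (rule Bochner_Integration.integral_cong) auto
  then show "harmonic_proj l l' f z = sphere_restrict (proj f) z"
    using kernel_integral[OF f, of z] by (simp add: harmonic_proj_def sphere_restrict_def)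
qed

end

theorem harmonic_proj_L1_L2:
  fixes f :: "complex^'n \<Rightarrow> complex"
  assumes dim: "2 \<le> CARD('n::finite)" and f: "integrable sphere_measure f"
  obtains p where "bihomogeneous_harmonic_polynomial l l' p" "harmonic_proj l l' f = sphere_restrict p"
    "(LINT z|sphere_measure. (norm (p z))\<^sup>2)
      \<le> real ((l + l' + 2) * ((l + 1) * (l' + 1)) ^ (CARD('n) - 2))
        / measure sphere_measure (sphere (0 :: complex^'n) 1) * (L1_norm sphere_measure f)\<^sup>2"
proof -
  obtain m and e :: "nat \<Rightarrow> complex^'n \<Rightarrow> complex" where "harmonic_basis l l' m e"
    and m: "m \<le> (l + l' + 2) * ((l + 1) * (l' + 1)) ^ (CARD('n) - 2)"
    by (rule harmonic_basis_exists[OF dim])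
  then interpret harmonic_basis l l' m e by simp
  have "density * (L1_norm sphere_measure f)\<^sup>2 \<le> real ((l + l' + 2) * ((l + 1) * (l' + 1)) ^ (CARD('n) - 2))
        / measure sphere_measure (sphere (0 :: complex^'n) 1) * (L1_norm sphere_measure f)\<^sup>2"
    using m unfolding density_def by (intro mult_right_mono divide_right_mono) (simp_all only: of_nat_le_iff measure_nonneg zero_le_power2)
  then show ?thesis
    using that[OF proj_bihomogeneous harmonic_proj_eq[OF f]] proj_L2_bound[OF f] by linarith
qed

section \<open>Counting bidegrees in an eigenvalue shell\<close>

lemma card_le_of_spread:
  fixes S :: "nat set" and D :: real
  assumes spread: "\<And>x y. x \<in> S \<Longrightarrow> y \<in> S \<Longrightarrow> x \<le> y \<Longrightarrow> real (y - x) \<le> D" and D: "0 \<le> D"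
  shows "finite S" and "real (card S) \<le> D + 1"
proof -
  show fin: "finite S"
  proof (cases "S = {}")
    case False
    then obtain x where x: "x \<in> S" "\<And>y. y \<in> S \<Longrightarrow> x \<le> y"
      by (metis Inf_nat_def1 cInf_lower bdd_below_bot)
    have "S \<subseteq> {..x + nat \<lceil>D\<rceil>}"
    proof
      fix y assume y: "y \<in> S"
      have "real (y - x) \<le> D" using spread[OF x(1) y x(2)[OF y]] .
      then show "y \<in> {..x + nat \<lceil>D\<rceil>}" using x(2)[OF y] by simp linarith
    qed
    then show ?thesis using finite_subset by blast
  qed simp
  show "real (card S) \<le> D + 1"
  proof (cases "S = {}")
    case False
    have sub: "S \<subseteq> {Min S..Max S}"
      using fin by auto
    have "card S \<le> Suc (Max S) - Min S"
      using card_mono[OF _ sub] by simp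
    also have "Suc (Max S) - Min S = Suc (Max S - Min S)"
      using Min_le[OF fin Max_in[OF fin False]] by simp
    finally have "real (card S) \<le> real (Max S - Min S) + 1" by linarith
    also have "real (Max S - Min S) \<le> D"
      by (intro spread Min_in Max_in Min_le fin False)
    finally show ?thesis by simp
  qed (use D in simp)
qed

text \<open>
  Fibrewise count: \<open>f\<close> takes its values in \<open>I\<close>, and on each fibre the injective coordinate \<open>g\<close> varies by at
  most \<open>D\<close>.
\<close>

lemma fibre_count:
  fixes f g :: "'s \<Rightarrow> nat" and D :: real
  assumes I: "finite I" "f ` S \<subseteq> I" and inj: "inj_on (\<lambda>x. (f x, g x)) S" and D: "0 \<le> D"
    and spread: "\<And>x y. x \<in> S \<Longrightarrow> y \<in> S \<Longrightarrow> f x = f y \<Longrightarrow> g x \<le> g y \<Longrightarrow> real (g y - g x) \<le> D"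
  shows "finite S" and "real (card S) \<le> real (card I) * (D + 1)"
proof -
  define T where "T k = {x \<in> S. f x = k}" for k
  have T: "finite (T k)" "real (card (T k)) \<le> D + 1" for k
  proof -
    have inj_g: "inj_on g (T k)"
      using inj by (auto simp: inj_on_def T_def)
    have *: "real (y - x) \<le> D" if "x \<in> g ` T k" "y \<in> g ` T k" "x \<le> y" for x y
      using that spread by (auto simp: T_def)
    show "finite (T k)"
      using card_le_of_spread(1)[of "g ` T k" D, OF * D] inj_g by (rule finite_imageD) 
    show "real (card (T k)) \<le> D + 1"
      using card_le_of_spread(2)[of "g ` T k" D, OF * D] card_image[OF inj_g] by simp
  qed
  have S: "S = (\<Union>k\<in>I. T k)"
    using I(2) by (auto simp: T_def)
  show "finite S"
    unfolding S using I(1) T(1) by blast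
  have "card S \<le> (\<Sum>k\<in>I. card (T k))"
    unfolding S by (rule card_UN_le[OF I(1)])
  then have "real (card S) \<le> (\<Sum>k\<in>I. real (card (T k)))"
    by (simp flip: of_nat_sum)
  also have "\<dots> \<le> real (card I) * (D + 1)"
    using T(2) by (rule sum_bounded_above)
  finally show "real (card S) \<le> real (card I) * (D + 1)" .
qed

definition eigenvalue_shell :: "nat \<Rightarrow> nat \<Rightarrow> real \<Rightarrow> (nat \<times> nat) set" where
  "eigenvalue_shell n i a = {(l, l'). l \<noteq> l' \<and>
     real i - 1 \<le> sqrt (sublaplacian_eigenvalue n l l') \<and> sqrt (sublaplacian_eigenvalue n l l') \<le> real i \<and>
     a / 2 \<le> \<bar>real l - real l'\<bar> \<and> \<bar>real l - real l'\<bar> \<le> 2 * a}"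

text \<open>
  With \<open>u = 2p + m\<close> and \<open>v = 2q + m\<close> one has \<open>u v = \<lambda> + m^2\<close>.  The lower bound \<open>u v \<ge> i^2/2\<close> includes the
  case \<open>i = 1\<close>, thanks to \<open>m \<ge> 1\<close>: \<open>(i-1)^2 + 1 - i^2/2 = (i-2)^2/2\<close>.
\<close>

lemma eigenvalue_shell_bounds:
  fixes n i p q :: nat and a :: real
  assumes n: "2 \<le> n" and i: "1 \<le> i" and pq: "(p, q) \<in> eigenvalue_shell n i a" "q < p"
  defines "m \<equiv> real n - 1"
  shows "(real i - 1)\<^sup>2 \<le> 4 * real p * real q + 2 * m * (real p + real q)"
    and "4 * real p * real q + 2 * m * (real p + real q) \<le> (real i)\<^sup>2"
    and "a / 2 \<le> real p - real q" and "real p - real q \<le> 2 * a"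
    and "(real i)\<^sup>2 / 2 \<le> (2 * real p + m) * (2 * real q + m)"
    and "1 \<le> m" and "real q + 1 \<le> real p"
proof -
  let ?L = "4 * real p * real q + 2 * m * (real p + real q)"
  have L: "sublaplacian_eigenvalue n p q = ?L"
    by (simp add: sublaplacian_eigenvalue_def m_def)
  show m: "1 \<le> m" using n by (simp add: m_def)
  then have L0: "0 \<le> ?L" by simp
  show "real q + 1 \<le> real p" using pq(2) by linarith
  show "a / 2 \<le> real p - real q" "real p - real q \<le> 2 * a"
    using pq by (auto simp: eigenvalue_shell_def)
  have s: "real i - 1 \<le> sqrt ?L" "sqrt ?L \<le> real i"
    using pq(1) by (auto simp: eigenvalue_shell_def L)
  show lo: "(real i - 1)\<^sup>2 \<le> ?L"
    using power_mono[OF s(1), of 2] i L0 by simp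
  show "?L \<le> (real i)\<^sup>2"
    using power_mono[OF s(2), of 2] L0 by simp
  have "0 \<le> (real i - 2)\<^sup>2 / 2" by simp
  also have "\<dots> = (real i - 1)\<^sup>2 + 1 - (real i)\<^sup>2 / 2"
    by (simp add: power2_eq_square field_simps)
  also have "(real i - 1)\<^sup>2 + 1 \<le> ?L + m\<^sup>2"
    using lo m by (intro add_mono) simp_all
  also have "?L + m\<^sup>2 = (2 * real p + m) * (2 * real q + m)"
    by (simp add: power2_eq_square algebra_simps)
  finally show "(real i)\<^sup>2 / 2 \<le> (2 * real p + m) * (2 * real q + m)" by simp
qed

lemma card_le_real_upto:
  fixes X :: real
  assumes "0 \<le> X"
  shows "finite {k::nat. real k + 1 \<le> X}" and "real (card {k::nat. real k + 1 \<le> X}) \<le> X"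
proof -
  have sub: "{k::nat. real k + 1 \<le> X} \<subseteq> {..<nat \<lfloor>X\<rfloor>}"
  proof
    fix k :: nat assume "k \<in> {k. real k + 1 \<le> X}"
    then have "int k + 1 \<le> \<lfloor>X\<rfloor>" by (simp add: le_floor_iff)
    then show "k \<in> {..<nat \<lfloor>X\<rfloor>}" by simp
  qed
  then show "finite {k::nat. real k + 1 \<le> X}"
    by (rule finite_subset) simp
  have "card {k::nat. real k + 1 \<le> X} \<le> nat \<lfloor>X\<rfloor>"
    using card_mono[OF _ sub] by simp
  then show "real (card {k::nat. real k + 1 \<le> X}) \<le> X"
    using assms by linarith
qed

text \<open>
  When the smaller index exceeds \<open>a\<close>, both indices are comparable and \<open>p \<le> i\<close>.  There are at most \<open>2a\<close>
  differences \<open>p - q\<close>.  Along a fixed difference \<open>\<lambda>\<close> grows at a rate of at least \<open>4p\<close>, while \<open>p\<close> is at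
  least a constant times \<open>i\<close> and \<open>\<lambda>\<close> may vary only by \<open>2i\<close>; so the number of points is bounded.
\<close>

lemma shell_sum_near_diagonal:
  fixes n i :: nat and a :: real
  assumes n: "2 \<le> n" and i: "1 \<le> i" and a: "0 < a"
  defines "S \<equiv> {(p, q) \<in> eigenvalue_shell n i a. q < p \<and> a < real q}"
  shows "finite S" and "(\<Sum>(p, q)\<in>S. real p) \<le> 2 * a * (real n + 2) * real i"
proof -
  define m where "m = real n - 1"
  have m: "1 \<le> m" using n by (simp add: m_def)
  have pi: "real p \<le> real i" if "(p, q) \<in> S" for p q
  proof -
    have pq: "(p, q) \<in> eigenvalue_shell n i a" "q < p" "a < real q"
      using that by (auto simp: S_def)
    note B = eigenvalue_shell_bounds[OF n i pq(1,2), folded m_def]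
    have "real p \<le> 3 * real q" using B(4) pq(3) by linarith
    then have "real p * real p \<le> 3 * real q * real p" by (intro mult_right_mono) auto
    also have "\<dots> \<le> 4 * real p * real q + 2 * m * (real p + real q)"
      using m by (simp add: mult.commute)
    also have "\<dots> \<le> (real i)\<^sup>2" by (rule B(2))
    finally have "(real p)\<^sup>2 \<le> (real i)\<^sup>2" by (simp only: power2_eq_square)
    then show ?thesis by (rule power2_le_imp_le) simp
  qed
  let ?I = "{k::nat. real k + 1 \<le> 2 * a}"
  let ?f = "\<lambda>(p, q). p - q - 1 :: nat"
  have fin: "finite ?I"
    by (rule card_le_real_upto) (use a in simp)
    have I: "(\<lambda>(p, q). p - q - 1) ` S \<subseteq> ?I"
    proof (rule image_subsetI)
      fix x assume x: "x \<in> S"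
      obtain p q where xpq: "x = (p, q)" by (cases x)
      have pq: "(p, q) \<in> eigenvalue_shell n i a" "q < p"
        using x by (auto simp: S_def xpq)
      then have "real (p - q - 1) + 1 = real p - real q"
        by (simp add: of_nat_diff)
      then show "(case x of (p, q) \<Rightarrow> p - q - 1) \<in> ?I"
        using eigenvalue_shell_bounds(4)[OF n i pq] by (simp add: xpq)
    qed
    have inj: "inj_on (\<lambda>x. (case x of (p, q) \<Rightarrow> p - q - 1, snd x)) S"
      by (rule inj_onI) (auto simp: S_def)
  have spread: "real (snd y - snd x) \<le> m + 2"
    if x: "x \<in> S" and y: "y \<in> S" and h: "?f x = ?f y" and le: "snd x \<le> snd y" for x y
  proof -
    obtain p q p' q' where xy: "x = (p, q)" "y = (p', q')" by (cases x, cases y)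
    have pq: "(p, q) \<in> eigenvalue_shell n i a" "q < p" and pq': "(p', q') \<in> eigenvalue_shell n i a" "q' < p'"
      using x y by (auto simp: S_def xy)
    note B = eigenvalue_shell_bounds[OF n i pq, folded m_def]
    note B' = eigenvalue_shell_bounds[OF n i pq', folded m_def]
    define d where "d = real q' - real q"
    have d: "0 \<le> d" "real q = real q' - d" using le by (simp_all add: d_def xy)
    have "p + q' = p' + q" using h pq(2) pq'(2) by (simp add: xy)
    then have p: "real p = real p' - d" unfolding d_def by linarith
    have "4 * (d * real p') \<le> 4 * (d * (real p' + (real q' - d))) + 4 * (m * d)"
      using d m by (simp add: distrib_left flip: d(2))
    also have "\<dots> = (4 * real p' * real q' + 2 * m * (real p' + real q')) - (4 * real p * real q + 2 * m * (real p + real q))"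
      unfolding p d(2) by (simp add: algebra_simps)
    also have "\<dots> \<le> (real i)\<^sup>2 - (real i - 1)\<^sup>2"
      using B(1) B'(2) by linarith
    also have "\<dots> \<le> 2 * real i"
      by (simp add: power2_eq_square algebra_simps)
    finally have 1: "2 * (d * real p') \<le> real i" by simp
    have "(real i / 2)\<^sup>2 \<le> (real i)\<^sup>2 / 2" by (simp add: power_divide)
    also have "\<dots> \<le> (2 * real p' + m) * (2 * real q' + m)" by (rule B'(5))
    also have "\<dots> \<le> (2 * real p' + m) * (2 * real p' + m)"
      using m pq'(2) by (intro mult_left_mono) auto
    finally have "(real i / 2)\<^sup>2 \<le> (2 * real p' + m)\<^sup>2" by (simp add: power2_eq_square)
    then have "real i / 2 \<le> 2 * real p' + m"
      by (rule power2_le_imp_le) (use m in simp)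
    also have "m \<le> m * real p'" using m B'(7) by simp
    finally have "real i \<le> 2 * ((m + 2) * real p')" by (simp add: algebra_simps)
    with 1 have "d * real p' \<le> (m + 2) * real p'" by linarith
    then have "d \<le> m + 2" using pq'(2) by simp
    then show "real (snd y - snd x) \<le> m + 2" using le by (simp add: xy d_def of_nat_diff)
  qed
  have "0 \<le> m + 2" using m by simp
  note count = fibre_count[where f = ?f and g = snd, OF fin I inj this spread]
  show "finite S" by (rule count(1))
  have "(\<Sum>(p, q)\<in>S. real p) \<le> real (card S) * real i"
    by (rule sum_bounded_above) (use pi in auto)
  also have "real (card S) * real i \<le> 2 * a * (m + 3) * real i"
  proof (rule mult_right_mono)
    have "real (card ?I) * (m + 2 + 1) \<le> 2 * a * (m + 3)"
      using card_le_real_upto(2)[of "2 * a"] a m by (intro mult_mono) auto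
    with count(2) show "real (card S) \<le> 2 * a * (m + 3)" by linarith
  qed simp
  also have "m + 3 = real n + 2" by (simp add: m_def)
  finally show "(\<Sum>(p, q)\<in>S. real p) \<le> 2 * a * (real n + 2) * real i" .
qed

text \<open>
  When the smaller index \<open>q\<close> is at most \<open>a\<close>, the larger one satisfies \<open>a/2 \<le> p \<le> 3a\<close>, which leaves at
  most \<open>i^2/a\<close> values of \<open>q\<close>.  For fixed \<open>q\<close>, \<open>\<lambda>\<close> grows in \<open>p\<close> at the rate \<open>2v\<close> with \<open>v = 2q + m\<close>.  Since
  \<open>(2p + m) v \<ge> i^2/2\<close> and \<open>2p + m\<close> is at most a multiple of \<open>a\<close>, the range \<open>2i\<close> of \<open>\<lambda>\<close> allows \<open>O(1 + a/i)\<close>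
  values of \<open>p\<close>.
\<close>

lemma shell_sum_off_diagonal:
  fixes n i :: nat and a :: real
  assumes n: "2 \<le> n" and i: "1 \<le> i" and a: "0 < a"
  defines "S \<equiv> {(p, q) \<in> eigenvalue_shell n i a. q < p \<and> real q \<le> a}"
  shows "finite S" and "(\<Sum>(p, q)\<in>S. real p) \<le> 3 * (real i)\<^sup>2 + 12 * (real n + 2) * a * real i"
proof -
  define m where "m = real n - 1"
  have m: "1 \<le> m" using n by (simp add: m_def)
  have i0: "0 < real i" using i by simp
  have pa: "real p \<le> 3 * a" if "(p, q) \<in> S" for p q
  proof -
    have pq: "(p, q) \<in> eigenvalue_shell n i a" "q < p" "real q \<le> a"
      using that by (auto simp: S_def)
    then show ?thesis
      using eigenvalue_shell_bounds(4)[OF n i pq(1,2)] by linarith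
  qed
  let ?I = "{k::nat. real k + 1 \<le> (real i)\<^sup>2 / a}"
  let ?D = "(12 + 4 * m) * a / real i"
  have fin: "finite ?I"
    by (rule card_le_real_upto) (use a in simp)
  have I: "snd ` S \<subseteq> ?I"
  proof (rule image_subsetI)
    fix x assume x: "x \<in> S"
    obtain p q where xpq: "x = (p, q)" by (cases x)
    have pq: "(p, q) \<in> eigenvalue_shell n i a" "q < p"
      using x by (auto simp: S_def xpq)
    note B = eigenvalue_shell_bounds[OF n i pq, folded m_def]
    have "(real q + 1) * a \<le> (real q + 1) * (2 * real p)"
      using B(3) by (intro mult_left_mono) auto
    also have "\<dots> = 2 * (real p * real q) + 2 * real p"
      by (simp add: algebra_simps)
    also have "\<dots> \<le> 4 * (real p * real q) + 2 * (m * (real p + real q))"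
      using mult_right_mono[OF m, of "real p + real q"] by (intro add_mono) simp_all
    also have "\<dots> \<le> (real i)\<^sup>2"
      using B(2) by (simp add: mult.assoc)
    finally show "snd x \<in> ?I"
      using a by (simp add: xpq pos_le_divide_eq)
  qed
  have inj: "inj_on (\<lambda>x. (snd x, fst x)) S"
    by (rule inj_onI) (simp add: prod_eq_iff)
  have spread: "real (fst y - fst x) \<le> ?D"
    if x: "x \<in> S" and y: "y \<in> S" and h: "snd x = snd y" and le: "fst x \<le> fst y" for x y
  proof -
    obtain p q p' where xy: "x = (p, q)" "y = (p', q)" using h by (cases x, cases y) simp
    have pq: "(p, q) \<in> eigenvalue_shell n i a" "q < p" and pq': "(p', q) \<in> eigenvalue_shell n i a" "q < p'"
      using x y by (auto simp: S_def xy)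
    note B = eigenvalue_shell_bounds[OF n i pq, folded m_def]
    note B' = eigenvalue_shell_bounds[OF n i pq', folded m_def]
    define d where "d = real p' - real p"
    have d: "0 \<le> d" using le by (simp add: d_def xy)
    define v where "v = 2 * real q + m"
    have v: "0 \<le> v" using m by (simp add: v_def)
    have "2 * (d * v) = (4 * real p' * real q + 2 * m * (real p' + real q)) - (4 * real p * real q + 2 * m * (real p + real q))"
      by (simp add: d_def v_def algebra_simps)
    also have "\<dots> \<le> (real i)\<^sup>2 - (real i - 1)\<^sup>2"
      using B(1) B'(2) by linarith
    also have "\<dots> \<le> 2 * real i"
      by (simp add: power2_eq_square algebra_simps)
    finally have dv: "d * v \<le> real i" by simp
    have "1 \<le> 2 * a" using B(4,7) by linarith
    then have "m * 1 \<le> m * (2 * a)" using m by (intro mult_left_mono) auto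
    then have u: "2 * real p + m \<le> (6 + 2 * m) * a"
      using pa[of p q] x by (simp add: xy algebra_simps)
    have "(real i)\<^sup>2 / 2 \<le> (2 * real p + m) * v"
      using B(5) by (simp add: v_def)
    also have "\<dots> \<le> (6 + 2 * m) * a * v"
      using u v by (rule mult_right_mono)
    finally have "d * ((real i)\<^sup>2 / 2) \<le> d * ((6 + 2 * m) * a * v)"
      using d by (rule mult_left_mono)
    also have "\<dots> = (6 + 2 * m) * a * (d * v)" by simp
    also have "\<dots> \<le> (6 + 2 * m) * a * real i"
      using dv a m by (intro mult_left_mono) auto
    finally have "(d * real i) * real i \<le> ((12 + 4 * m) * a) * real i"
      by (simp add: power2_eq_square algebra_simps)
    then have "d * real i \<le> (12 + 4 * m) * a"
      using i0 by simp
    then have "d \<le> ?D"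
      using i0 by (simp add: pos_le_divide_eq)
    then show ?thesis using le by (simp add: xy d_def of_nat_diff)
  qed
  have D: "0 \<le> ?D" using m a by simp
  note count = fibre_count[where f = snd and g = fst, OF fin I inj D spread]
  show "finite S" by (rule count(1))
  have "(\<Sum>(p, q)\<in>S. real p) \<le> real (card S) * (3 * a)"
    by (rule sum_bounded_above) (use pa in auto)
  also have "\<dots> \<le> ((real i)\<^sup>2 / a * (?D + 1)) * (3 * a)"
  proof (rule mult_right_mono)
    have "real (card ?I) * (?D + 1) \<le> (real i)\<^sup>2 / a * (?D + 1)"
      using card_le_real_upto(2)[of "(real i)\<^sup>2 / a"] a D by (intro mult_right_mono) auto
    with count(2) show "real (card S) \<le> (real i)\<^sup>2 / a * (?D + 1)" by linarith
  qed (use a in simp)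
  also have "\<dots> = 3 * (real i)\<^sup>2 + 3 * (12 + 4 * m) * a * real i"
    using a i0 by (simp add: field_simps power2_eq_square)
  also have "3 * (12 + 4 * m) = 12 * (real n + 2)" by (simp add: m_def)
  finally show "(\<Sum>(p, q)\<in>S. real p) \<le> 3 * (real i)\<^sup>2 + 12 * (real n + 2) * a * real i" .
qed

text \<open>
  The bound for the dimension of the space of bidegree \<open>(l, l')\<close> obtained in \<open>harmonic_basis_exists\<close>.
\<close>

definition dimension_weight :: "nat \<Rightarrow> nat \<times> nat \<Rightarrow> nat" where
  "dimension_weight n = (\<lambda>(l, l'). (l + l' + 2) * ((l + 1) * (l' + 1)) ^ (n - 2))"

text \<open>
  By symmetry consider \<open>l' < l\<close>.  On the shell \<open>(l+1)(l'+1) \<le> 2 i^2\<close>, so the weight is at most a constant times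
  \<open>l i^(2n-4)\<close>, and the sum of \<open>l\<close> is split at \<open>l' = a\<close>.
\<close>

theorem eigenvalue_shell_weight:
  fixes n i :: nat and a :: real
  assumes n: "2 \<le> n" and i: "1 \<le> i" and a: "0 < a"
  shows "finite (eigenvalue_shell n i a)"
    and "(\<Sum>x\<in>eigenvalue_shell n i a. real (dimension_weight n x))
      \<le> 112 * (real n + 2) * 2 ^ (n - 2) * (((real i)\<^sup>2) ^ (n - 2) * ((real i)\<^sup>2 + a * real i))"
proof -
  let ?E = "eigenvalue_shell n i a"
  define S where "S = {(p, q) \<in> ?E. q < p}"
  define S1 where "S1 = {(p, q) \<in> ?E. q < p \<and> a < real q}"
  define S2 where "S2 = {(p, q) \<in> ?E. q < p \<and> real q \<le> a}"
  note near = shell_sum_near_diagonal[OF n i a, folded S1_def]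
  note off = shell_sum_off_diagonal[OF n i a, folded S2_def]
  have S: "S = S1 \<union> S2" "S1 \<inter> S2 = {}"
    by (auto simp: S_def S1_def S2_def)
  have finS: "finite S" using near(1) off(1) S by simp
  have "(\<Sum>(p, q)\<in>S. real p) = (\<Sum>(p, q)\<in>S1. real p) + (\<Sum>(p, q)\<in>S2. real p)"
    unfolding S(1) by (rule sum.union_disjoint[OF near(1) off(1) S(2)])
  also have "\<dots> \<le> 2 * a * (real n + 2) * real i + (3 * (real i)\<^sup>2 + 12 * (real n + 2) * a * real i)"
    using near(2) off(2) by (rule add_mono)
  also have "\<dots> = 3 * (real i)\<^sup>2 + 14 * (real n + 2) * (a * real i)"
    by (simp add: algebra_simps)
  also have "\<dots> \<le> 14 * (real n + 2) * (real i)\<^sup>2 + 14 * (real n + 2) * (a * real i)"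
    by (intro add_right_mono mult_right_mono) auto
  finally have sum_p: "(\<Sum>(p, q)\<in>S. real p) \<le> 14 * (real n + 2) * ((real i)\<^sup>2 + a * real i)"
    by (simp add: distrib_left)
  have weight: "real (dimension_weight n x) \<le> 4 * (2 * (real i)\<^sup>2) ^ (n - 2) * real (fst x)" if "x \<in> S" for x
  proof -
    obtain p q where x: "x = (p, q)" by (cases x)
    have pq: "(p, q) \<in> ?E" "q < p" using that by (auto simp: S_def x)
    note B = eigenvalue_shell_bounds[OF n i pq]
    have 1: "real p + real q \<le> (real n - 1) * (real p + real q)"
      using mult_right_mono[OF B(6), of "real p + real q"] by simp
    have 2: "4 * (real p * real q) + 2 * ((real n - 1) * (real p + real q)) \<le> (real i)\<^sup>2"
      using B(2) by (simp only: mult.assoc)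
    have 3: "1 \<le> (real i)\<^sup>2" using i by simp
    have "Y + P + 1 \<le> 2 * J"
      if "P \<le> X" "4 * Y + 2 * X \<le> J" "1 \<le> J" "0 \<le> Y" "0 \<le> P" for X Y J P :: real
      using that by linarith
    from this[OF 1 2 3] have "real p * real q + (real p + real q) + 1 \<le> 2 * (real i)\<^sup>2"
      by simp
    then have "(real p + 1) * (real q + 1) \<le> 2 * (real i)\<^sup>2"
      by (simp add: algebra_simps)
    then have "((real p + 1) * (real q + 1)) ^ (n - 2) \<le> (2 * (real i)\<^sup>2) ^ (n - 2)"
      by (intro power_mono) auto
    moreover have "real p + real q + 2 \<le> 4 * real p"
      using B(7) by linarith
    ultimately have "(real p + real q + 2) * ((real p + 1) * (real q + 1)) ^ (n - 2)
        \<le> (4 * real p) * (2 * (real i)\<^sup>2) ^ (n - 2)"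
      by (intro mult_mono) auto
    then show ?thesis
      by (simp add: x dimension_weight_def algebra_simps)
  qed
  have "(\<Sum>x\<in>S. real (dimension_weight n x)) \<le> (\<Sum>x\<in>S. 4 * (2 * (real i)\<^sup>2) ^ (n - 2) * real (fst x))"
    using weight by (rule sum_mono)
  also have "\<dots> = 4 * (2 * (real i)\<^sup>2) ^ (n - 2) * (\<Sum>(p, q)\<in>S. real p)"
    by (simp add: sum_distrib_left case_prod_unfold)
  also have "\<dots> \<le> 4 * (2 * (real i)\<^sup>2) ^ (n - 2) * (14 * (real n + 2) * ((real i)\<^sup>2 + a * real i))"
    using sum_p by (rule mult_left_mono) simp
  finally have half: "(\<Sum>x\<in>S. real (dimension_weight n x))
      \<le> 4 * (2 * (real i)\<^sup>2) ^ (n - 2) * (14 * (real n + 2) * ((real i)\<^sup>2 + a * real i))" .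
  have sym: "(l', l) \<in> ?E" if "(l, l') \<in> ?E" for l l'
  proof -
    have "sublaplacian_eigenvalue n l' l = sublaplacian_eigenvalue n l l'"
      by (simp add: sublaplacian_eigenvalue_def algebra_simps)
    then show ?thesis using that by (auto simp: eigenvalue_shell_def abs_minus_commute)
  qed
  have E: "?E = S \<union> prod.swap ` S"
  proof (intro equalityI subsetI)
    fix x assume x: "x \<in> ?E"
    obtain l l' where xl: "x = (l, l')" by (cases x)
    have "l \<noteq> l'" using x by (simp add: xl eigenvalue_shell_def)
    then consider "l' < l" | "l < l'" by linarith
    then show "x \<in> S \<union> prod.swap ` S"
    proof cases
      case 1
      then show ?thesis using x by (simp add: S_def xl)
    next
      case 2
      then have "(l', l) \<in> S" using x sym by (simp add: S_def xl)
      then show ?thesis by (auto simp: xl intro: rev_image_eqI)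
    qed
  next
    fix x assume "x \<in> S \<union> prod.swap ` S"
    then show "x \<in> ?E" using sym by (auto simp: S_def)
  qed
  show "finite ?E" unfolding E using finS by simp
  have "(\<Sum>x\<in>?E. real (dimension_weight n x)) \<le> (\<Sum>x\<in>S. real (dimension_weight n x)) + (\<Sum>x\<in>prod.swap ` S. real (dimension_weight n x))"
    unfolding E using finS by (subst sum_Un) (auto intro: sum_nonneg)
  also have "(\<Sum>x\<in>prod.swap ` S. real (dimension_weight n x)) = (\<Sum>x\<in>S. real (dimension_weight n (prod.swap x)))"
    by (subst sum.reindex) (auto simp: inj_on_def)
  also have "\<dots> = (\<Sum>x\<in>S. real (dimension_weight n x))"
  proof (rule sum.cong[OF refl])
    fix x :: "nat \<times> nat"
    obtain a b where x: "x = (a, b)" by (cases x)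
    show "real (dimension_weight n (prod.swap x)) = real (dimension_weight n x)"
      by (simp only: x dimension_weight_def swap_simp prod.case mult.commute[of "b + 1"] add.commute[of b a])
  qed
  finally have "(\<Sum>x\<in>?E. real (dimension_weight n x)) \<le> 2 * (4 * (2 * (real i)\<^sup>2) ^ (n - 2) * (14 * (real n + 2) * ((real i)\<^sup>2 + a * real i)))"
    using half by linarith
  also have "\<dots> = 112 * (real n + 2) * 2 ^ (n - 2) * (((real i)\<^sup>2) ^ (n - 2) * ((real i)\<^sup>2 + a * real i))"
    unfolding power_mult_distrib by (simp add: mult_ac)
  finally show "(\<Sum>x\<in>?E. real (dimension_weight n x))
      \<le> 112 * (real n + 2) * 2 ^ (n - 2) * (((real i)\<^sup>2) ^ (n - 2) * ((real i)\<^sup>2 + a * real i))" .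
qed

section \<open>The truncated operator\<close>

text \<open>
  A continuous function is bounded by its essential supremum everywhere, because a nonempty open set
  is not a null set.
\<close>

lemma bump_function_le_Linf_norm:
  assumes "bump_function_on {\<alpha>..\<beta>} \<Theta>"
  shows "norm (\<Theta> x) \<le> Linf_norm \<Theta>"
proof -
  have "\<Theta> differentiable (at x)" for x
    using assms[unfolded bump_function_on_def, THEN conjunct1, rule_format, of 0] by simp
  then have "isCont \<Theta> x" for x
    by (rule differentiable_imp_continuous_within)
  then have cont: "continuous_on S \<Theta>" for S
    by (simp add: continuous_at_imp_continuous_on)
  have "bounded (\<Theta> ` {\<alpha>..\<beta>})"
    by (intro compact_imp_bounded compact_continuous_image cont) simp
  then obtain b where b: "\<forall>x\<in>{\<alpha>..\<beta>}. norm (\<Theta> x) \<le> b"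
    by (auto simp: bounded_iff)
  define r where "r = max b 0"
  have bound: "norm (\<Theta> x) \<le> r" for x
  proof (cases "x \<in> {\<alpha>..\<beta>}")
    case True
    then have "norm (\<Theta> x) \<le> b" using b by blast
    then show ?thesis by (simp add: r_def)
  next
    case False
    then show ?thesis using assms by (simp add: bump_function_on_def r_def)
  qed
  let ?g = "\<lambda>x. ereal (norm (\<Theta> x))"
  define E where "E = esssup lborel ?g"
  have cont_g: "continuous_on UNIV ?g"
    by (intro continuous_on_ereal continuous_on_norm cont)
  have meas: "?g \<in> borel_measurable lborel"
    using borel_measurable_continuous_onI[OF cont_g] by simp
  have le: "?g x \<le> E" for x
  proof (rule ccontr)
    assume "\<not> ?g x \<le> E"
    then have x: "x \<in> ?g -` {E<..}" by simp
    have "open (?g -` {E<..})"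
      using continuous_on_open_vimage[of UNIV ?g] cont_g by simp
    moreover have "AE y in lborel. y \<notin> ?g -` {E<..}"
      using esssup_AE[where M = lborel and f = ?g] by eventually_elim (simp add: E_def)
    then have "emeasure lborel (?g -` {E<..}) = 0"
      by (subst (asm) AE_iff_measurable[where N = "?g -` {E<..}"]) (use calculation in auto)
    ultimately have "?g -` {E<..} = {}"
      by (rule open_null_lborel_empty)
    then show False using x by blast
  qed
  have "E \<le> ereal r"
    unfolding E_def by (rule esssup_I[OF meas], rule AE_I2) (simp only: ereal_less_eq bound)
  then have "\<bar>E\<bar> \<noteq> \<infinity>"
    using le[of 0] by (cases E) auto
  then show ?thesis
    using le[of x] unfolding Linf_norm_def E_def[symmetric] by (cases E) auto
qed

lemma sum_UNION_le:
  fixes h :: "'a \<Rightarrow> real"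
  assumes "finite I" "\<And>i. i \<in> I \<Longrightarrow> finite (A i)" "\<And>x. 0 \<le> h x"
  shows "sum h (\<Union>i\<in>I. A i) \<le> (\<Sum>i\<in>I. sum h (A i))"
  using assms
proof (induction I rule: finite_induct)
  case (insert i I)
  have "sum h (\<Union>i\<in>insert i I. A i) \<le> sum h (A i) + sum h (\<Union>i\<in>I. A i)"
    using insert.prems insert.hyps(1) by (simp add: sum_Un sum_nonneg)
  also have "sum h (\<Union>i\<in>I. A i) \<le> (\<Sum>i\<in>I. sum h (A i))"
    using insert by simp
  finally show ?case using insert.hyps by simp
qed simp

theorem norm_orthogonal_sum:
  fixes P :: "nat \<times> nat \<Rightarrow> complex^'n \<Rightarrow> complex"
  assumes U: "finite U" and P: "\<forall>x\<in>U. bihomogeneous_harmonic_polynomial (fst x) (snd x) (P x)"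
  shows "(LINT z|sphere_measure. (norm (\<Sum>x\<in>U. c x * P x z))\<^sup>2)
    = (\<Sum>x\<in>U. (norm (c x))\<^sup>2 * (LINT z|sphere_measure. (norm (P x z))\<^sup>2))"
proof -
  have cont: "continuous_on S (P x)" if "x \<in> U" for x S
    using P that by (blast intro: bihomogeneousD(4))
  have int: "integrable sphere_measure (P x)" if "x \<in> U" for x
    using cont[OF that] by (rule integrable_sphere_continuous)
  let ?g = "\<lambda>z. \<Sum>x\<in>U. c x * P x z"
  have cont_g: "continuous_on S ?g" for S
    by (intro continuous_on_sum continuous_on_mult continuous_on_const cont)
  have ortho: "sphere_inner (P x) (P y) = 0" if "x \<in> U" "y \<in> U" "x \<noteq> y" for x y
    using P that by (intro bihomogeneous_orthogonal[of "fst x" "snd x" _ "fst y" "snd y"]) auto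
  have inner: "sphere_inner (P x) ?g = cnj (c x) * sphere_inner (P x) (P x)" if x: "x \<in> U" for x
  proof -
    have "sphere_inner ?g (P x) = (\<Sum>y\<in>U. c y * sphere_inner (P y) (P x))"
      by (rule sphere_inner_sum_left[OF U _ cont[OF x]]) (use int in blast)
    also have "\<dots> = (\<Sum>y\<in>U. if y = x then c x * sphere_inner (P x) (P x) else 0)"
      using ortho x by (intro sum.cong refl) auto
    also have "\<dots> = c x * sphere_inner (P x) (P x)"
      using U x by simp
    finally have "cnj (sphere_inner ?g (P x)) = cnj (c x) * cnj (sphere_inner (P x) (P x))"
      by simp
    then show ?thesis unfolding sphere_inner_cnj .
  qed
  have "complex_of_real (LINT z|sphere_measure. (norm (?g z))\<^sup>2) = sphere_inner ?g ?g"
    by (rule sphere_inner_self[symmetric])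
  also have "\<dots> = (\<Sum>x\<in>U. c x * sphere_inner (P x) ?g)"
    by (rule sphere_inner_sum_left[OF U _ cont_g]) (use int in blast)
  also have "\<dots> = (\<Sum>x\<in>U. complex_of_real ((norm (c x))\<^sup>2 * (LINT z|sphere_measure. (norm (P x z))\<^sup>2)))"
  proof (rule sum.cong[OF refl])
    fix x assume "x \<in> U"
    show "c x * sphere_inner (P x) ?g = complex_of_real ((norm (c x))\<^sup>2 * (LINT z|sphere_measure. (norm (P x z))\<^sup>2))"
      unfolding inner[OF \<open>x \<in> U\<close>] of_real_mult complex_norm_square sphere_inner_self mult.assoc ..
  qed
  finally show ?thesis
    unfolding of_real_sum[symmetric] of_real_eq_iff .
qed

text \<open>
  Inserts the factor \<open>a^\<epsilon>\<close> into the first term of the estimate; a nonempty shell has \<open>1/2 \<le> a\<close>.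
\<close>

lemma one_le_powr_of_double:
  assumes "1/2 \<le> a" "0 < \<epsilon>"
  shows "1 \<le> 2 powr \<epsilon> * a powr (\<epsilon>::real)"
proof -
  have "1 = 1 powr \<epsilon>" by simp
  also have "\<dots> \<le> (2 * a) powr \<epsilon>"
    using assms by (intro powr_mono2) auto
  also have "\<dots> = 2 powr \<epsilon> * a powr \<epsilon>"
    using assms by (simp add: powr_mult)
  finally show ?thesis .
qed

text \<open>
  The two terms of the estimate, squared and expressed through \<open>a = 2^(-M) N^2\<close>.
\<close>

lemma bound_terms_squared:
  fixes n N :: nat and \<epsilon> \<mu> :: real
  assumes n: "2 \<le> n" and N: "1 \<le> N"
  defines "a \<equiv> 2 powr (-\<mu>) * (real N)\<^sup>2"
  shows "(real N powr (real (2 * n - 1) / 2 + \<epsilon>) * 2 powr (- (\<mu> * \<epsilon> / 2)))\<^sup>2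
      = ((real N)\<^sup>2) ^ (n - 2) * (real N)\<^sup>2 * real N * a powr \<epsilon>"
    and "(real N powr (real (2 * n) / 2) * 2 powr (- (\<mu> / 2)))\<^sup>2
      = ((real N)\<^sup>2) ^ (n - 2) * (a * real N) * real N"
proof -
  have N0: "0 < real N" using N by simp
  have sq: "(x powr y)\<^sup>2 = x powr (2 * y)" for x y :: real
    by (cases "x = 0") (simp_all add: power2_eq_square powr_add[symmetric])
  have Nn: "((real N)\<^sup>2) ^ (n - 2) = real N powr (2 * real n - 4)"
  proof -
    have "((real N)\<^sup>2) ^ (n - 2) = real N ^ (2 * (n - 2))" by (simp add: power_mult)
    also have "\<dots> = real N powr real (2 * (n - 2))" by (rule powr_realpow[OF N0, symmetric])
    also have "real (2 * (n - 2)) = 2 * real n - 4" using n by (simp add: of_nat_diff)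
    finally show ?thesis .
  qed
  have N2: "(real N)\<^sup>2 = real N powr 2" using N0 by (simp add: powr_numeral)
  have N1: "real N = real N powr 1" using N0 by simp
  have ap: "a powr \<epsilon> = 2 powr (- \<mu> * \<epsilon>) * real N powr (2 * \<epsilon>)"
  proof -
    have "(real N)\<^sup>2 powr \<epsilon> = real N powr (2 * \<epsilon>)" unfolding N2 by (rule powr_powr)
    then show ?thesis unfolding a_def by (simp add: powr_mult powr_powr)
  qed
  have e1: "real (2 * n - 1) = 2 * real n - 1" using n by (simp add: of_nat_diff)
  have "(real N powr (real (2 * n - 1) / 2 + \<epsilon>) * 2 powr (- (\<mu> * \<epsilon> / 2)))\<^sup>2
      = real N powr (2 * real n - 1 + 2 * \<epsilon>) * 2 powr (- \<mu> * \<epsilon>)"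
  proof -
    have "2 * ((2 * real n - 1) / 2 + \<epsilon>) = 2 * real n - 1 + 2 * \<epsilon>" "2 * (- (\<mu> * \<epsilon> / 2)) = - \<mu> * \<epsilon>"
      by simp_all
    then show ?thesis
      unfolding power_mult_distrib sq e1 by (simp only:)
  qed
  also have "real N powr (2 * real n - 1 + 2 * \<epsilon>)
      = real N powr (2 * real n - 4) * real N powr 2 * real N powr 1 * real N powr (2 * \<epsilon>)"
    unfolding powr_add[symmetric] by (simp add: algebra_simps)
  finally show "(real N powr (real (2 * n - 1) / 2 + \<epsilon>) * 2 powr (- (\<mu> * \<epsilon> / 2)))\<^sup>2
      = ((real N)\<^sup>2) ^ (n - 2) * (real N)\<^sup>2 * real N * a powr \<epsilon>"
    unfolding Nn unfolding ap N2 N1[symmetric] by (simp only: mult_ac)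
  have "(real N powr (real (2 * n) / 2) * 2 powr (- (\<mu> / 2)))\<^sup>2 = real N powr (2 * real n) * 2 powr (- \<mu>)"
    unfolding power_mult_distrib sq by simp
  also have "real N powr (2 * real n) = real N powr (2 * real n - 4) * real N powr 2 * real N powr 1 * real N powr 1"
    unfolding powr_add[symmetric] by (simp add: algebra_simps)
  finally show "(real N powr (real (2 * n) / 2) * 2 powr (- (\<mu> / 2)))\<^sup>2
      = ((real N)\<^sup>2) ^ (n - 2) * (a * real N) * real N"
    unfolding Nn unfolding a_def N2 N1[symmetric] by (simp only: mult_ac)
qed

lemma block_norm_square:
  assumes N: "1 \<le> N" and bdd: "bounded (range G)"
  shows "0 \<le> (SUP x\<in>{(real i - 1) / real N..real i / real N}. (norm (G x))\<^sup>2)"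
    and "y \<in> {(real i - 1) / real N..real i / real N} \<Longrightarrow>
      (norm (G y))\<^sup>2 \<le> (SUP x\<in>{(real i - 1) / real N..real i / real N}. (norm (G x))\<^sup>2)"
    and "(\<Sum>i = 1..N. SUP x\<in>{(real i - 1) / real N..real i / real N}. (norm (G x))\<^sup>2) = real N * (block_norm N G)\<^sup>2"
proof -
  obtain b where b: "\<forall>x. norm (G x) \<le> b"
    using bdd by (auto simp: bounded_iff)
  let ?S = "\<lambda>i. {(real i - 1) / real N..real i / real N}"
  have bdd_above: "bdd_above ((\<lambda>x. (norm (G x))\<^sup>2) ` S)" for S
    using b by (intro bdd_aboveI[of _ "b\<^sup>2"]) (auto intro!: power_mono)
  show le: "(norm (G y))\<^sup>2 \<le> (SUP x\<in>?S i. (norm (G x))\<^sup>2)" if "y \<in> ?S i" for y i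
    by (rule cSUP_upper[OF that bdd_above])
  show nonneg: "0 \<le> (SUP x\<in>?S i. (norm (G x))\<^sup>2)" for i
  proof -
    have "real i / real N \<in> ?S i" by (simp add: divide_right_mono)
    from le[OF this] show ?thesis by (rule order_trans[OF zero_le_power2])
  qed
  have "(block_norm N G)\<^sup>2 = 1 / real N * (\<Sum>i = 1..N. SUP x\<in>?S i. (norm (G x))\<^sup>2)"
    unfolding block_norm_def by (rule real_sqrt_pow2) (intro mult_nonneg_nonneg sum_nonneg nonneg, simp)
  then show "(\<Sum>i = 1..N. SUP x\<in>?S i. (norm (G x))\<^sup>2) = real N * (block_norm N G)\<^sup>2"
    using N by simp
qed

text \<open>
  A nonzero coefficient has \<open>0 < sqrt \<lambda> \<le> N\<close>, so it lies in the shell with number \<open>\<lceil>sqrt \<lambda>\<rceil>\<close>; the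
  support of \<open>\<Theta>\<close> confines \<open>|l - l'|\<close>.
\<close>

lemma truncated_operator_support:
  fixes F :: "real \<Rightarrow> complex" and \<Theta> :: "real \<Rightarrow> complex" and M :: int
  assumes n: "2 \<le> n" and F: "\<forall>x. x \<notin> {0..real N} \<longrightarrow> F x = 0"
    and \<Theta>: "\<forall>x. x \<notin> {(real N)\<^sup>2 / 2..2 * (real N)\<^sup>2} \<longrightarrow> \<Theta> x = 0"
    and ne: "l \<noteq> l'"
    and nz: "F (sqrt (sublaplacian_eigenvalue n l l')) * \<Theta> (2 powi M * \<bar>real l - real l'\<bar>) \<noteq> 0"
  shows "(l, l') \<in> (\<Union>i\<in>{1..N}. eigenvalue_shell n i (2 powr (- real_of_int M) * (real N)\<^sup>2))"
proof -
  let ?s = "sqrt (sublaplacian_eigenvalue n l l')"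
  have "0 < real l + real l'" using ne by linarith
  then have "0 < 2 * (real n - 1) * (real l + real l')" using n by simp
  then have "0 < sublaplacian_eigenvalue n l l'"
    unfolding sublaplacian_eigenvalue_def by (intro add_nonneg_pos) simp_all
  then have s0: "0 < ?s" by simp
  have sN: "?s \<le> real N"
    using F nz by force
  define i where "i = nat \<lceil>?s\<rceil>"
  have i: "1 \<le> i" "i \<le> N" "real i - 1 \<le> ?s" "?s \<le> real i"
  proof -
    have "0 < \<lceil>?s\<rceil>" using s0 by (simp only: zero_less_ceiling)
    then have ri: "real i = of_int \<lceil>?s\<rceil>" and i1: "1 \<le> i"
      unfolding i_def by linarith+
    show "1 \<le> i" by (rule i1)
    show "?s \<le> real i" "real i - 1 \<le> ?s"
      unfolding ri by linarith+
    have "\<lceil>?s\<rceil> \<le> int N" by (rule ceiling_le) (simp only: of_int_of_nat_eq sN)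
    then show "i \<le> N" unfolding i_def by linarith
  qed
  have "2 powi M * \<bar>real l - real l'\<bar> \<in> {(real N)\<^sup>2 / 2..2 * (real N)\<^sup>2}"
    using \<Theta> nz by force
  moreover have "(2::real) powi M = 2 powr real_of_int M"
    by (simp add: powr_real_of_int')
  ultimately have T: "(real N)\<^sup>2 / 2 \<le> 2 powr real_of_int M * \<bar>real l - real l'\<bar>"
      "2 powr real_of_int M * \<bar>real l - real l'\<bar> \<le> 2 * (real N)\<^sup>2"
    by simp_all
  have inv: "2 powr (- real_of_int M) * (2 powr real_of_int M * y) = y" for y :: real
    by (simp add: powr_minus)
  have pos: "0 \<le> 2 powr (- real_of_int M)" by simp
  have "(l, l') \<in> eigenvalue_shell n i (2 powr (- real_of_int M) * (real N)\<^sup>2)"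
    using mult_left_mono[OF T(1) pos] mult_left_mono[OF T(2) pos] i(3,4) ne
    unfolding inv by (simp add: eigenvalue_shell_def)
  then show ?thesis using i(1,2) by auto
qed

lemma truncated_operator_bound:
  fixes f :: "complex^'n \<Rightarrow> complex" and F \<Theta> :: "real \<Rightarrow> complex" and M :: int and N n :: nat
  assumes n_def: "n = CARD('n::finite)" and n: "2 \<le> n" and N: "1 \<le> N" and \<epsilon>: "0 < \<epsilon>"
    and bdd: "bounded (range F)" and F: "\<forall>x. x \<notin> {0..real N} \<longrightarrow> F x = 0"
    and bump: "bump_function_on {(real N)\<^sup>2 / 2..2 * (real N)\<^sup>2} \<Theta>"
    and f: "integrable sphere_measure f"
  defines "X \<equiv> real N powr (real (2 * n - 1) / 2 + \<epsilon>) * 2 powr (- (real_of_int M * \<epsilon> / 2))"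
    and "Y \<equiv> real N powr (real (2 * n) / 2) * 2 powr (- (real_of_int M / 2))"
    and "K \<equiv> 112 * (real n + 2) * 2 ^ (n - 2) / measure sphere_measure (sphere (0 :: complex^'n) 1)"
  shows "square_integrable sphere_measure (truncated_operator M \<Theta> F f)"
    and "L2_norm sphere_measure (truncated_operator M \<Theta> F f)
      \<le> Linf_norm \<Theta> * sqrt (K * 2 powr \<epsilon>) * (X + Y) * block_norm N (\<lambda>x. F (real N * x)) * L1_norm sphere_measure f"
proof -
  define a where "a = 2 powr (- real_of_int M) * (real N)\<^sup>2"
  have a0: "0 < a" using N by (simp add: a_def)
  define \<sigma> where "\<sigma> = measure sphere_measure (sphere (0 :: complex^'n) 1)"
  have \<sigma>: "0 < \<sigma>" unfolding \<sigma>_def by (rule sphere_measure_total_positive)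
  define t where "t = Linf_norm \<Theta>"
  have t: "norm (\<Theta> x) \<le> t" for x
    unfolding t_def by (rule bump_function_le_Linf_norm[OF bump])
  then have t0: "0 \<le> t" using norm_ge_zero order_trans by blast
  define L where "L = L1_norm sphere_measure f"
  have L0: "0 \<le> L" unfolding L_def L1_norm_def by (rule integral_nonneg_AE) simp
  have bump_zero: "\<forall>x. x \<notin> {(real N)\<^sup>2 / 2..2 * (real N)\<^sup>2} \<longrightarrow> \<Theta> x = 0"
    using bump unfolding bump_function_on_def by (rule conjunct2)
  define c where "c x = F (sqrt (sublaplacian_eigenvalue n (fst x) (snd x))) * \<Theta> (2 powi M * \<bar>real (fst x) - real (snd x)\<bar>)" for x
  define U where "U = (\<Union>i\<in>{1..N}. eigenvalue_shell n i a)"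
  have fin_shell: "finite (eigenvalue_shell n i a)" if "i \<in> {1..N}" for i
    using that by (intro eigenvalue_shell_weight(1) n a0) simp
  then have U: "finite U" by (simp add: U_def)
  define Good where "Good x p \<longleftrightarrow> bihomogeneous_harmonic_polynomial (fst x) (snd x) p \<and>
      harmonic_proj (fst x) (snd x) f = sphere_restrict p \<and>
      (LINT z|sphere_measure. (norm (p z))\<^sup>2) \<le> real (dimension_weight n x) / \<sigma> * L\<^sup>2" for x p
  \<comment> \<open>For every bidegree choose a polynomial that represents the projection of \<open>f\<close>.\<close>
  have "\<exists>p. Good x p" for x
  proof -
    have dim: "2 \<le> CARD('n)" using n n_def by simp
    obtain p where "bihomogeneous_harmonic_polynomial (fst x) (snd x) p"
      "harmonic_proj (fst x) (snd x) f = sphere_restrict p"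
      "(LINT z|sphere_measure. (norm (p z))\<^sup>2)
        \<le> real ((fst x + snd x + 2) * ((fst x + 1) * (snd x + 1)) ^ (CARD('n) - 2))
          / measure sphere_measure (sphere (0 :: complex^'n) 1) * (L1_norm sphere_measure f)\<^sup>2"
      by (rule harmonic_proj_L1_L2[OF dim f])
    then have "Good x p"
      unfolding Good_def dimension_weight_def n_def \<sigma>_def L_def case_prod_unfold by blast
    then show ?thesis by (rule exI[where x = p])
  qed
  then have "\<exists>P. \<forall>x. Good x (P x)" by (intro choice allI)
  then obtain P where P: "\<forall>x. Good x (P x)" ..
  have P1: "bihomogeneous_harmonic_polynomial (fst x) (snd x) (P x)"
    and P2: "harmonic_proj (fst x) (snd x) f = sphere_restrict (P x)"
    and P3: "(LINT z|sphere_measure. (norm (P x z))\<^sup>2) \<le> real (dimension_weight n x) / \<sigma> * L\<^sup>2" for x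
    using P[rule_format, of x] unfolding Good_def by blast+
  define g where "g = (\<lambda>z. \<Sum>x\<in>U. c x * P x z)"
  have cont_g: "continuous_on (sphere 0 1) g"
    unfolding g_def
    by (intro continuous_on_sum continuous_on_mult continuous_on_const bihomogeneousD(4)[OF P1])
  have T_eq: "truncated_operator M \<Theta> F f z = g z" if z: "z \<in> sphere 0 1" for z
  proof -
    have "truncated_operator M \<Theta> F f z = infsum (\<lambda>x. c x * harmonic_proj (fst x) (snd x) f z) {x. fst x \<noteq> snd x}"
      by (simp add: truncated_operator_def c_def n_def case_prod_unfold)
    also have "\<dots> = infsum (\<lambda>x. c x * harmonic_proj (fst x) (snd x) f z) U"
    proof (rule infsum_cong_neutral)
      fix x assume "x \<in> U - {x. fst x \<noteq> snd x}"
      then show "c x * harmonic_proj (fst x) (snd x) f z = 0"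
        by (auto simp: U_def eigenvalue_shell_def)
    next
      fix x assume x: "x \<in> {x. fst x \<noteq> snd x} - U"
      have "c x = 0"
      proof (rule ccontr)
        assume "c x \<noteq> 0"
        then have "(fst x, snd x) \<in> U"
          unfolding U_def a_def using x
          by (intro truncated_operator_support[OF n F bump_zero]) (simp_all only: c_def mem_Collect_eq Diff_iff not_False_eq_True)
        then show False using x by simp
      qed
      then show "c x * harmonic_proj (fst x) (snd x) f z = 0" by simp
    qed simp
    also have "\<dots> = g z"
      using U z by (simp add: g_def P2 sphere_restrict_def)
    finally show ?thesis .
  qed
  have cont_T: "continuous_on (sphere 0 1) (truncated_operator M \<Theta> F f)"
    using cont_g by (rule continuous_on_eq) (rule T_eq[symmetric])
  show "square_integrable sphere_measure (truncated_operator M \<Theta> F f)"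
    unfolding square_integrable_def
    by (intro conjI borel_measurable_sphere_continuous integrable_sphere_continuous continuous_on_power
        continuous_on_norm cont_T)
  let ?G = "\<lambda>x. F (real N * x)"
  define b where "b = block_norm N ?G"
  have b0: "0 \<le> b"
    unfolding b_def block_norm_def
    by (rule real_sqrt_ge_zero, rule mult_nonneg_nonneg, simp, rule sum_nonneg, rule block_norm_square(1)[OF N])
      (use bdd in \<open>auto simp: bounded_iff\<close>)
  define S where "S i = (SUP x\<in>{(real i - 1) / real N..real i / real N}. (norm (?G x))\<^sup>2)" for i :: nat
  have bddG: "bounded (range ?G)"
    using bdd by (auto simp: bounded_iff)
  have S0: "0 \<le> S i" for i
    unfolding S_def by (rule block_norm_square(1)[OF N bddG])
  have S_sum: "(\<Sum>i = 1..N. S i) = real N * b\<^sup>2"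
    unfolding S_def b_def by (rule block_norm_square(3)[OF N bddG])
  have c_le: "(norm (c x))\<^sup>2 \<le> S i * t\<^sup>2" if x: "x \<in> eigenvalue_shell n i a" for x i
  proof -
    let ?s = "sqrt (sublaplacian_eigenvalue n (fst x) (snd x))"
    have "?s / real N \<in> {(real i - 1) / real N..real i / real N}"
      using x by (auto simp: eigenvalue_shell_def intro!: divide_right_mono)
    then have "(norm (?G (?s / real N)))\<^sup>2 \<le> S i"
      unfolding S_def by (rule block_norm_square(2)[OF N bddG])
    then have "(norm (F ?s))\<^sup>2 \<le> S i"
      using N by simp
    moreover have "(norm (\<Theta> y))\<^sup>2 \<le> t\<^sup>2" for y
      using t by (intro power_mono) auto
    ultimately show ?thesis
      unfolding c_def norm_mult power_mult_distrib using S0 by (intro mult_mono) auto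
  qed
  define V where "V = ((real N)\<^sup>2) ^ (n - 2) * ((real N)\<^sup>2 + a * real N)"
  define R where "R = V * real N"
  define kappa where "kappa = 112 * (real n + 2) * 2 ^ (n - 2)"
  define W where "W i = (\<Sum>x\<in>eigenvalue_shell n i a. real (dimension_weight n x))" for i
  have K_eq: "K = kappa / \<sigma>"
    by (simp add: K_def \<sigma>_def kappa_def)
  have K0: "0 \<le> K" using \<sigma> by (simp add: K_eq kappa_def)
  have norm_g: "(LINT z|sphere_measure. (norm (g z))\<^sup>2) \<le> K * t\<^sup>2 * L\<^sup>2 * b\<^sup>2 * R"
  proof -
    let ?h = "\<lambda>x. (norm (c x))\<^sup>2 * (real (dimension_weight n x) / \<sigma> * L\<^sup>2)"
    have h0: "0 \<le> ?h x" for x using \<sigma> by simp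
    have "(LINT z|sphere_measure. (norm (g z))\<^sup>2) = (\<Sum>x\<in>U. (norm (c x))\<^sup>2 * (LINT z|sphere_measure. (norm (P x z))\<^sup>2))"
      unfolding g_def by (rule norm_orthogonal_sum[OF U]) (use P1 in blast)
    also have "\<dots> \<le> (\<Sum>x\<in>U. ?h x)"
      by (rule sum_mono, rule mult_left_mono[OF P3]) simp
    also have "\<dots> \<le> (\<Sum>i\<in>{1..N}. \<Sum>x\<in>eigenvalue_shell n i a. ?h x)"
      unfolding U_def by (rule sum_UNION_le[OF _ fin_shell h0]) simp
    also have "\<dots> \<le> (\<Sum>i\<in>{1..N}. S i * (K * t\<^sup>2 * L\<^sup>2 * V))"
    proof (rule sum_mono)
      fix i assume i: "i \<in> {1..N}"
      have "(\<Sum>x\<in>eigenvalue_shell n i a. ?h x)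
          \<le> (\<Sum>x\<in>eigenvalue_shell n i a. S i * t\<^sup>2 * (real (dimension_weight n x) / \<sigma> * L\<^sup>2))"
        by (rule sum_mono, rule mult_right_mono[OF c_le]) (use \<sigma> in simp_all)
      also have "\<dots> = S i * t\<^sup>2 * L\<^sup>2 / \<sigma> * W i"
        by (simp add: W_def sum_distrib_left sum_divide_distrib mult_ac)
      also have "\<dots> \<le> S i * t\<^sup>2 * L\<^sup>2 / \<sigma> * (kappa * V)"
      proof (rule mult_left_mono)
        have "1 \<le> i" "real i \<le> real N" using i by simp_all
        then have iN: "(real i)\<^sup>2 \<le> (real N)\<^sup>2" by (intro power_mono) simp_all
        have "W i \<le> kappa * (((real i)\<^sup>2) ^ (n - 2) * ((real i)\<^sup>2 + a * real i))"
          unfolding W_def kappa_def by (rule eigenvalue_shell_weight(2)[OF n \<open>1 \<le> i\<close> a0])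
        also have "\<dots> \<le> kappa * V"
          unfolding V_def kappa_def using iN \<open>real i \<le> real N\<close> a0 by (intro mult_left_mono mult_mono power_mono add_mono) simp_all
        finally show "W i \<le> kappa * V" .
      qed (use S0 \<sigma> in simp)
      also have "\<dots> = S i * (K * t\<^sup>2 * L\<^sup>2 * V)"
        by (simp add: K_eq)
      finally show "(\<Sum>x\<in>eigenvalue_shell n i a. ?h x)
          \<le> S i * (K * t\<^sup>2 * L\<^sup>2 * V)" .
    qed
    also have "\<dots> = K * t\<^sup>2 * L\<^sup>2 * b\<^sup>2 * R"
      unfolding sum_distrib_right[symmetric] S_sum R_def by (simp only: mult_ac)
    finally show ?thesis .
  qed
  have XY: "0 \<le> X" "0 \<le> Y" by (simp_all add: X_def Y_def)
  have "(LINT z|sphere_measure. (norm (g z))\<^sup>2) \<le> K * t\<^sup>2 * L\<^sup>2 * b\<^sup>2 * (2 powr \<epsilon> * (X + Y)\<^sup>2)"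
  proof (cases "1 / 2 \<le> a")
    case True
    note pow = bound_terms_squared(1)[OF n N, where \<epsilon> = \<epsilon> and \<mu> = "real_of_int M", folded a_def X_def]
      bound_terms_squared(2)[OF n N, where \<mu> = "real_of_int M", folded a_def Y_def]
    have one: "1 \<le> 2 powr \<epsilon>" using \<epsilon> by (simp add: ge_one_powr_ge_zero)
    let ?B = "((real N)\<^sup>2) ^ (n - 2) * (real N)\<^sup>2 * real N"
    have "?B * 1 \<le> ?B * (2 powr \<epsilon> * a powr \<epsilon>)"
      by (rule mult_left_mono[OF one_le_powr_of_double[OF True \<epsilon>]]) simp
    then have 1: "?B \<le> 2 powr \<epsilon> * X\<^sup>2"
      unfolding pow(1) by (simp add: mult_ac)
    have 2: "((real N)\<^sup>2) ^ (n - 2) * (a * real N) * real N \<le> 2 powr \<epsilon> * Y\<^sup>2"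
      unfolding pow(2)[symmetric] using mult_right_mono[OF one, of "Y\<^sup>2"] by simp
    have "R = ?B + ((real N)\<^sup>2) ^ (n - 2) * (a * real N) * real N"
      by (simp add: R_def V_def distrib_left distrib_right)
    also have "\<dots> \<le> 2 powr \<epsilon> * X\<^sup>2 + 2 powr \<epsilon> * Y\<^sup>2"
      using 1 2 by (rule add_mono)
    also have "\<dots> \<le> 2 powr \<epsilon> * (X + Y)\<^sup>2"
      using XY unfolding distrib_left[symmetric] by (intro mult_left_mono) (simp_all add: power2_sum)
    finally have "R \<le> 2 powr \<epsilon> * (X + Y)\<^sup>2" .
    then have "K * t\<^sup>2 * L\<^sup>2 * b\<^sup>2 * R \<le> K * t\<^sup>2 * L\<^sup>2 * b\<^sup>2 * (2 powr \<epsilon> * (X + Y)\<^sup>2)"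
      using K0 by (intro mult_left_mono) simp_all
    with norm_g show ?thesis by linarith
  next
    case False
    \<comment> \<open>Distinct indices differ by at least \<open>1 > 2a\<close>, so the operator vanishes on \<open>f\<close>.\<close>
    have "eigenvalue_shell n i a = {}" for i
    proof -
      have "1 \<le> \<bar>real l - real l'\<bar>" if "l \<noteq> l'" for l l' :: nat
        using that by linarith
      then show ?thesis using False by (force simp: eigenvalue_shell_def)
    qed
    then have "g = (\<lambda>z. 0)" by (simp add: g_def U_def)
    then have "(LINT z|sphere_measure. (norm (g z))\<^sup>2) = 0" by simp
    also have "0 \<le> K * t\<^sup>2 * L\<^sup>2 * b\<^sup>2 * (2 powr \<epsilon> * (X + Y)\<^sup>2)"
      using K0 by (intro mult_nonneg_nonneg) simp_all
    finally show ?thesis .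
  qed
  also have "\<dots> = (t * sqrt (K * 2 powr \<epsilon>) * (X + Y) * b * L)\<^sup>2"
    using K0 by (simp add: power_mult_distrib)
  finally have "sqrt (LINT z|sphere_measure. (norm (g z))\<^sup>2) \<le> t * sqrt (K * 2 powr \<epsilon>) * (X + Y) * b * L"
    using t0 XY b0 L0 K0 by (intro real_le_lsqrt mult_nonneg_nonneg) simp_all
  moreover have "(LINT z|sphere_measure. (norm (truncated_operator M \<Theta> F f z))\<^sup>2) = (LINT z|sphere_measure. (norm (g z))\<^sup>2)"
    by (rule Bochner_Integration.integral_cong) (simp_all add: T_eq)
  ultimately show "L2_norm sphere_measure (truncated_operator M \<Theta> F f)
      \<le> Linf_norm \<Theta> * sqrt (K * 2 powr \<epsilon>) * (X + Y) * block_norm N ?G * L1_norm sphere_measure f"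
    unfolding L2_norm_def t_def b_def L_def by simp
qed

theorem proposition3p1:
  fixes n d Q :: nat
  assumes "n = CARD('n::finite)" and "n \<ge> 2" and "d = 2 * n - 1" and "Q = 2 * n"
  shows "\<exists>C :: real \<Rightarrow> real \<Rightarrow> real.
    \<forall>\<epsilon> > 0. \<forall>N \<ge> (1::nat). \<forall>M :: int. \<forall>F :: real \<Rightarrow> complex. \<forall>\<Theta> :: real \<Rightarrow> complex.
      F \<in> borel_measurable borel \<longrightarrow> bounded (range F) \<longrightarrow>
      (\<forall>x. x \<notin> {0..real N} \<longrightarrow> F x = 0) \<longrightarrow>
      bump_function_on {(real N)\<^sup>2 / 2..2 * (real N)\<^sup>2} \<Theta> \<longrightarrow>
      (\<forall>\<tau> > 0. ((\<lambda>k :: int. \<Theta> (2 powi k * \<tau>)) has_sum 1) UNIV) \<longrightarrow>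
      (\<forall>f :: complex^'n \<Rightarrow> complex. integrable sphere_measure f \<longrightarrow>
         square_integrable sphere_measure (truncated_operator M \<Theta> F f) \<and>
         L2_norm sphere_measure (truncated_operator M \<Theta> F f)
           \<le> C \<epsilon> (Linf_norm \<Theta>)
              * (real N powr (real d / 2 + \<epsilon>) * 2 powr (- (real_of_int M * \<epsilon> / 2))
                 + real N powr (real Q / 2) * 2 powr (- (real_of_int M / 2)))
              * block_norm N (\<lambda>x. F (real N * x)) * L1_norm sphere_measure f)"
proof -
  define K where "K = 112 * (real n + 2) * 2 ^ (n - 2) / measure sphere_measure (sphere (0 :: complex^'n) 1)"
  show ?thesis
    unfolding assms(3,4)
    by (intro exI[where x = "\<lambda>\<epsilon> t. t * sqrt (K * 2 powr \<epsilon>)"] allI impI conjI)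
      (rule truncated_operator_bound[OF assms(1,2), folded K_def]; assumption)+
qed

end
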